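(* Let $G$ be a connected block graph on $n$ vertices. The following algorithm, with input $G$, outputs the Krull dimension of $S/J_G$ as the final value of the variable $\mathrm{dim}$ (for any choices made in step 7). 1. Set $\mathrm{dim}:=n+1$. 2. Set $\mathcal{G}:=\{G\}$. 3. For every graph $H\in\mathcal{G}$ (continuing until $\mathcal{G}$ is empty), perform steps 4–9: 4. $\mathcal{G}:=\mathcal{G}\setminus\{H\}$. 5. Decompose $H$ into its indecomposable subgraphs $\mathcal{I}=\{G_1,\dots,G_r\}$. 6. Remove from $\mathcal{I}$ the graphs which are blocks (complete graphs); then for every graph $G_i\in\mathcal{I}$ perform steps 7–9: 7. Take $v\in V(G_i)$ such that $v$ belongs to at least $2$ endblocks of $G_i$. 8. $\mathrm{dim}:=\mathrm{dim}+\operatorname{cdeg}(v)-2$, where $\operatorname{cdeg}(v)$ is the clique degree of $v$ in $G_i$. 9. $\mathcal{G}:=\mathcal{G}\cup\{H_v\}$, where $H_v$ is the graph obtained from $G_i$ by removing $v$ and the endblocks (all their vertices) of $G_i$ to which $v$ belongs.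
   Context: Graphs are finite and simple. Let $K$ be a field and $S=K[x_i,y_i : i\in V(G)]$. The binomial edge ideal of $G$ (with $V(G)=[n]$) is $J_G=(x_iy_j-x_jy_i : i<j,\ \{i,j\}\in E(G))\subseteq S$. A cutpoint of a graph is a vertex whose removal increases the number of connected components. A block is a connected subgraph that has no cutpoint and is maximal with this property. A graph is a block graph if all its blocks are complete graphs. An endblock is a block having exactly one cutpoint. The clique degree $\operatorname{cdeg}(v)$ of a vertex is the number of maximal cliques containing $v$; $v$ is free if $\operatorname{cdeg}(v)=1$. A graph $G$ is decomposable if $G=G_1\cup G_2$ with $V(G_1)\cap V(G_2)=\{v\}$, where $v$ is a free, non-isolated vertex of both $G_1$ and $G_2$; otherwise it is indecomposable. Decomposing recursively, $G=G_1\cup\dots\cup G_r$ with all $G_i$ indecomposable and, for $i<j$, $V(G_i)\cap V(G_j)$ either empty or a single vertex that is free in both $G_i$ and $G_j$; this decomposition is unique up to ordering, and the $G_i$ are the indecomposable subgraphs into which $G$ decomposes. For a possibly disconnected graph $H$, one takes all indecomposable subgraphs of all its connected components (none if $H$ is empty). *)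

theory Defs
  imports "HOL-Library.Poly_Mapping" "HOL-Library.Extended_Nat" "HOL-Algebra.QuotRing"
begin

section \<open>Finite simple graphs\<close>

record 'v ugraph =
  verts :: "'v set"
  edges :: "'v set set"

definition simple_graph :: "'v ugraph \<Rightarrow> bool" where
  "simple_graph G \<longleftrightarrow> finite (verts G) \<and> (\<forall>e\<in>edges G. e \<subseteq> verts G \<and> card e = 2)"

definition subgraph :: "'v ugraph \<Rightarrow> 'v ugraph \<Rightarrow> bool" where
  "subgraph H G \<longleftrightarrow> simple_graph H \<and> verts H \<subseteq> verts G \<and> edges H \<subseteq> edges G"

definition graph_union :: "'v ugraph \<Rightarrow> 'v ugraph \<Rightarrow> 'v ugraph" where
  "graph_union G H = \<lparr>verts = verts G \<union> verts H, edges = edges G \<union> edges H\<rparr>"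

definition induced :: "'v ugraph \<Rightarrow> 'v set \<Rightarrow> 'v ugraph" where
  "induced G A = \<lparr>verts = verts G \<inter> A, edges = {e \<in> edges G. e \<subseteq> A}\<rparr>"

definition remove_verts :: "'v ugraph \<Rightarrow> 'v set \<Rightarrow> 'v ugraph" where
  "remove_verts G A = induced G (verts G - A)"

definition complete_graph :: "'v ugraph \<Rightarrow> bool" where
  "complete_graph G \<longleftrightarrow> (\<forall>u\<in>verts G. \<forall>v\<in>verts G. u \<noteq> v \<longrightarrow> {u, v} \<in> edges G)"

definition reachable :: "'v ugraph \<Rightarrow> 'v \<Rightarrow> 'v \<Rightarrow> bool" where
  "reachable G = (\<lambda>u v. {u, v} \<in> edges G)\<^sup>*\<^sup>*"

text \<open>The empty graph has no components and does not count as connected.\<close>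

definition connected_graph :: "'v ugraph \<Rightarrow> bool" where
  "connected_graph G \<longleftrightarrow> verts G \<noteq> {} \<and> (\<forall>u\<in>verts G. \<forall>v\<in>verts G. reachable G u v)"

definition components :: "'v ugraph \<Rightarrow> 'v ugraph set" where
  "components G = (\<lambda>v. induced G {u \<in> verts G. reachable G v u}) ` verts G"


section \<open>Blocks and cliques\<close>

definition cutpoint :: "'v ugraph \<Rightarrow> 'v \<Rightarrow> bool" where
  "cutpoint G v \<longleftrightarrow>
     v \<in> verts G \<and> card (components G) < card (components (remove_verts G {v}))"

definition nonseparable_subgraph :: "'v ugraph \<Rightarrow> 'v ugraph \<Rightarrow> bool" where
  "nonseparable_subgraph G B \<longleftrightarrow>
     subgraph B G \<and> connected_graph B \<and> (\<forall>v\<in>verts B. \<not> cutpoint B v)"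

definition block :: "'v ugraph \<Rightarrow> 'v ugraph \<Rightarrow> bool" where
  "block G B \<longleftrightarrow> nonseparable_subgraph G B \<and>
     (\<forall>B'. nonseparable_subgraph G B' \<and> subgraph B B' \<longrightarrow> B' = B)"

definition block_graph :: "'v ugraph \<Rightarrow> bool" where
  "block_graph G \<longleftrightarrow> (\<forall>B. block G B \<longrightarrow> complete_graph B)"

text \<open>The cutpoints of a block \<open>B\<close> of \<open>G\<close> counted here are cutpoints of \<open>G\<close>;
  \<open>B\<close> itself has none.\<close>

definition endblock :: "'v ugraph \<Rightarrow> 'v ugraph \<Rightarrow> bool" where
  "endblock G B \<longleftrightarrow> block G B \<and> (\<exists>!v. v \<in> verts B \<and> cutpoint G v)"

definition endblocks_at :: "'v ugraph \<Rightarrow> 'v \<Rightarrow> 'v ugraph set" where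
  "endblocks_at G v = {B. endblock G B \<and> v \<in> verts B}"

definition clique :: "'v ugraph \<Rightarrow> 'v set \<Rightarrow> bool" where
  "clique G C \<longleftrightarrow> C \<subseteq> verts G \<and> (\<forall>u\<in>C. \<forall>v\<in>C. u \<noteq> v \<longrightarrow> {u, v} \<in> edges G)"

definition maximal_clique :: "'v ugraph \<Rightarrow> 'v set \<Rightarrow> bool" where
  "maximal_clique G C \<longleftrightarrow> clique G C \<and> (\<forall>D. clique G D \<and> C \<subseteq> D \<longrightarrow> D = C)"

definition cdeg :: "'v ugraph \<Rightarrow> 'v \<Rightarrow> nat" where
  "cdeg G v = card {C. maximal_clique G C \<and> v \<in> C}"

definition free_vertex :: "'v ugraph \<Rightarrow> 'v \<Rightarrow> bool" where
  "free_vertex G v \<longleftrightarrow> v \<in> verts G \<and> cdeg G v = 1"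

definition isolated_vertex :: "'v ugraph \<Rightarrow> 'v \<Rightarrow> bool" where
  "isolated_vertex G v \<longleftrightarrow> v \<in> verts G \<and> (\<forall>e\<in>edges G. v \<notin> e)"


section \<open>Decomposition into indecomposable subgraphs\<close>

definition splits_into :: "'v ugraph \<Rightarrow> 'v ugraph \<Rightarrow> 'v ugraph \<Rightarrow> bool" where
  "splits_into G G1 G2 \<longleftrightarrow>
     simple_graph G1 \<and> simple_graph G2 \<and> G = graph_union G1 G2 \<and>
     (\<exists>v. verts G1 \<inter> verts G2 = {v} \<and>
          free_vertex G1 v \<and> \<not> isolated_vertex G1 v \<and>
          free_vertex G2 v \<and> \<not> isolated_vertex G2 v)"

definition indecomposable :: "'v ugraph \<Rightarrow> bool" where
  "indecomposable G \<longleftrightarrow> (\<nexists>G1 G2. splits_into G G1 G2)"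

text \<open>The decomposition is the result of splitting recursively. Merely asking for a union of
  indecomposable graphs meeting pairwise in at most one vertex that is free in both would not
  determine it: a star with three edges is indecomposable, yet its three edges also form such a
  union.\<close>

inductive recursive_decomposition :: "'v ugraph \<Rightarrow> 'v ugraph set \<Rightarrow> bool" where
  indecomposable: "indecomposable G \<Longrightarrow> recursive_decomposition G {G}"
| split: "splits_into G G1 G2 \<Longrightarrow> recursive_decomposition G1 I1 \<Longrightarrow>
    recursive_decomposition G2 I2 \<Longrightarrow> recursive_decomposition G (I1 \<union> I2)"

definition indecomposable_decomposition :: "'v ugraph \<Rightarrow> 'v ugraph set \<Rightarrow> bool" where
  "indecomposable_decomposition H I \<longleftrightarrow>
     (\<exists>D. (\<forall>C\<in>components H. recursive_decomposition C (D C)) \<and> I = \<Union> (D ` components H))"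


section \<open>The algorithm\<close>

text \<open>A state \<open>(d, \<G>, \<I>)\<close> holds the current value of the variable dim, the
  graphs still to be decomposed, and the pieces of the current graph for which the inner loop has
  yet to be performed; a new graph is taken from \<open>\<G>\<close> only once \<open>\<I>\<close> is
  empty. All choices (order of the loops, vertex \<open>v\<close>) are nondeterministic. The natural
  number subtraction does not truncate, since \<open>d \<ge> 2\<close> holds throughout a run.\<close>

type_synonym 'v alg_state = "nat \<times> 'v ugraph set \<times> 'v ugraph set"

definition remaining_graph :: "'v ugraph \<Rightarrow> 'v \<Rightarrow> 'v ugraph" where
  "remaining_graph G v = remove_verts G ({v} \<union> (\<Union>B\<in>endblocks_at G v. verts B))"

inductive alg_step :: "'v alg_state \<Rightarrow> 'v alg_state \<Rightarrow> bool" where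
  decompose: "H \<in> \<G> \<Longrightarrow> indecomposable_decomposition H I \<Longrightarrow>
    alg_step (d, \<G>, {}) (d, \<G> - {H}, {G \<in> I. \<not> complete_graph G})"
| process: "G \<in> \<I> \<Longrightarrow> v \<in> verts G \<Longrightarrow> 2 \<le> card (endblocks_at G v) \<Longrightarrow>
    alg_step (d, \<G>, \<I>)
      (d + cdeg G v - 2, \<G> \<union> {remaining_graph G v}, \<I> - {G})"

definition alg_init :: "'v ugraph \<Rightarrow> 'v alg_state" where
  "alg_init G = (card (verts G) + 1, {G}, {})"

definition alg_final :: "'v alg_state \<Rightarrow> bool" where
  "alg_final s \<longleftrightarrow> (\<exists>d. s = (d, {}, {}))"

text \<open>Total correctness: no run is infinite, no run gets stuck before both loops are finished
  (so the decomposition and the vertex \<open>v\<close> always exist), and every run that finishes does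
  so with the value \<open>r\<close>.\<close>

definition algorithm_outputs :: "'v ugraph \<Rightarrow> enat \<Rightarrow> bool" where
  "algorithm_outputs G r \<longleftrightarrow>
     (\<nexists>run :: nat \<Rightarrow> 'v alg_state. run 0 = alg_init G \<and> (\<forall>i. alg_step (run i) (run (Suc i)))) \<and>
     (\<forall>s. alg_step\<^sup>*\<^sup>* (alg_init G) s \<longrightarrow> alg_final s \<or> (\<exists>s'. alg_step s s')) \<and>
     (\<forall>d. alg_step\<^sup>*\<^sup>* (alg_init G) (d, {}, {}) \<longrightarrow> enat d = r)"


section \<open>The binomial edge ideal and Krull dimension\<close>

datatype 'v bvar = X 'v | Y 'v

type_synonym ('x, 'k) mpoly = "('x \<Rightarrow>\<^sub>0 nat) \<Rightarrow>\<^sub>0 'k"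

definition poly_ring :: "'x set \<Rightarrow> ('x, 'k::comm_ring_1) mpoly ring" where
  "poly_ring A =
     \<lparr>carrier = {p. \<forall>m\<in>Poly_Mapping.keys p. Poly_Mapping.keys m \<subseteq> A},
      mult = (*), one = 1, zero = 0, add = (+)\<rparr>"

definition pvar :: "'x \<Rightarrow> ('x, 'k::comm_ring_1) mpoly" where
  "pvar x = Poly_Mapping.single (Poly_Mapping.single x 1) 1"

definition edge_poly_ring :: "'v ugraph \<Rightarrow> ('v bvar, 'k::field) mpoly ring" where
  "edge_poly_ring G = poly_ring (X ` verts G \<union> Y ` verts G)"

definition binomial_edge_ideal :: "'v::linorder ugraph \<Rightarrow> ('v bvar, 'k::field) mpoly set" where
  "binomial_edge_ideal G = genideal (edge_poly_ring G)
     {pvar (X i) * pvar (Y j) - pvar (X j) * pvar (Y i) | i j. i < j \<and> {i, j} \<in> edges G}"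

text \<open>Supremum of the lengths of chains of prime ideals. (A zero ring gets the value 0.)\<close>

definition krull_dim :: "('a, 'm) ring_scheme \<Rightarrow> enat" where
  "krull_dim R = Sup {enat n | n P.
     (\<forall>i\<le>n. primeideal (P i) R) \<and> (\<forall>i<n. P i \<subset> P (Suc i))}"

end

theory Submission
  imports Defs
begin

text \<open>
  Both sides of the claim equal the maximum, over all sets \<open>U\<close> of vertices, of \<open>|U| + c(U)\<close>, where
  \<open>c(U)\<close> is the number of connected components of the subgraph induced on \<open>U\<close>.

  For the Krull dimension, let \<open>P\<close> be a prime containing the binomial edge ideal, and let \<open>U\<close> be the set
  of the vertices \<open>i\<close> for which \<open>x\<^sub>i\<close> and \<open>y\<^sub>i\<close> are not both in \<open>P\<close>. In the domain \<open>S/P\<close> the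
  vectors \<open>(x\<^sub>i, y\<^sub>i)\<close> with \<open>i \<in> U\<close> are nonzero, and for adjacent vertices they are proportional;
  hence all vectors belonging to one component of \<open>U\<close> are proportional. It follows that \<open>P\<close> contains
  the kernel of the substitution \<open>x\<^sub>i \<mapsto> s\<^sub>i\<close>, \<open>y\<^sub>i \<mapsto> s\<^sub>i t\<^sub>c\<close> (\<open>c\<close> the component of \<open>i\<close>) that
  kills the variables outside \<open>U\<close> (lemma \<open>kernel_param_subset_prime\<close>). Its target is a polynomial
  ring in \<open>|U| + c(U)\<close> variables, and this number bounds the length of every chain of primes starting
  at \<open>P\<close> (theorem \<open>prime_chain_length_le\<close>): elements chosen from the successive steps of a chain of
  length \<open>n\<close> have about \<open>M\<^sup>n\<close> products with exponents up to \<open>M\<close> that are linearly independent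
  modulo \<open>P\<close>, whereas their images live in a space whose dimension grows like \<open>M\<close> to the number of
  variables. Conversely, every \<open>U\<close> yields a chain of that length: kill the variables \<open>t\<^sub>c\<close> and then the
  variables \<open>s\<^sub>i\<close> one after the other and take the kernels (lemma \<open>prime_chain_over_minors\<close>).

  For the algorithm, call the excess of the maximum over its value at \<open>U = V(H)\<close> the gain of the graph
  \<open>H\<close>. The variable dim starts with the value \<open>|V| + 1\<close> at \<open>U = V\<close>, and the invariant is that dim plus
  the gains of all graphs still in store is the maximum. Adding a vertex to \<open>U\<close> increases
  \<open>|U| + c(U)\<close> by two minus the number of components of \<open>U\<close> that it is adjacent to. So free vertices
  may always be added to \<open>U\<close>, and so may a vertex at which a graph is decomposed; this makes the gain of
  a complete graph zero and the gain additive under decomposition. A vertex \<open>v\<close> of two endblocks, on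
  the other hand, may be removed from \<open>U\<close> once free vertices of both endblocks have been added; the gain
  then drops by \<open>cdeg v - 2\<close> when \<open>v\<close> and its endblocks are deleted (theorem
  \<open>gain_remove_endblocks\<close>).

  Block graphs enter through a single property: two neighbours of \<open>v\<close> that are connected in \<open>G - v\<close> are
  adjacent. It turns blocks into maximal cliques, cutpoints into vertices that are not free, and the
  cliques at \<open>v\<close> into the components of \<open>G - v\<close>. In an indecomposable graph every cutpoint leaves at
  least three components. If the cutpoint \<open>v\<close> and a component of \<open>G - v\<close> are chosen so that this
  component is as large as possible, then no other component of \<open>G - v\<close> contains a cutpoint, so that
  \<open>v\<close> belongs to at least two endblocks (theorem \<open>two_endblocks_exist\<close>).
\<close>

alias keys = Poly_Mapping.keys
alias lookup = Poly_Mapping.lookup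
alias single = Poly_Mapping.single

section \<open>Polynomial rings and substitution\<close>

abbreviation const :: "'k::zero \<Rightarrow> ('x, 'k) mpoly" where
  "const c \<equiv> single 0 c"

definition polys :: "'x set \<Rightarrow> ('x, 'k::zero) mpoly set" where
  "polys A = {p. \<forall>m\<in>keys p. keys m \<subseteq> A}"

lemma carrier_poly_ring: "carrier (poly_ring A) = polys A"
  by (simp add: poly_ring_def polys_def)

lemma keys_monomial_add:
  "keys (m + n) = keys m \<union> keys (n :: 'x \<Rightarrow>\<^sub>0 nat)"
  by (auto simp: in_keys_iff lookup_add)

lemma polys_0: "0 \<in> polys A"
  and polys_const: "const c \<in> polys A"
  by (auto simp: polys_def)

lemma polys_1: "(1 :: ('x, 'k::zero_neq_one) mpoly) \<in> polys A"
  by (auto simp: polys_def)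

lemma polys_add:
  "p \<in> polys A \<Longrightarrow> q \<in> polys A \<Longrightarrow> (p + q :: ('x, 'k::comm_ring_1) mpoly) \<in> polys A"
  unfolding polys_def using keys_add[of p q] by blast

lemma polys_uminus: "p \<in> polys A \<Longrightarrow> (- p :: ('x, 'k::comm_ring_1) mpoly) \<in> polys A"
  by (simp add: polys_def)

lemma polys_diff:
  "p \<in> polys A \<Longrightarrow> q \<in> polys A \<Longrightarrow> (p - q :: ('x, 'k::comm_ring_1) mpoly) \<in> polys A"
  using polys_add[of p A "- q"] polys_uminus[of q A] by simp

lemma polys_mult:
  assumes "p \<in> polys A" "q \<in> polys A"
  shows "(p * q :: ('x, 'k::comm_ring_1) mpoly) \<in> polys A"
  unfolding polys_def
proof (clarsimp)
  fix m x assume m: "m \<in> keys (p * q)" and x: "x \<in> keys m"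
  then obtain a b where "m = a + b" "a \<in> keys p" "b \<in> keys q"
    using keys_mult[of p q] by blast
  then show "x \<in> A"
    using x assms keys_monomial_add[of a b] by (fastforce simp: polys_def)
qed

lemma polys_power: "p \<in> polys A \<Longrightarrow> (p ^ n :: ('x, 'k::comm_ring_1) mpoly) \<in> polys A"
  by (induction n) (auto simp: polys_1 polys_mult)

lemma polys_sum:
  "(\<And>i. i \<in> I \<Longrightarrow> f i \<in> polys A) \<Longrightarrow> (\<Sum>i\<in>I. f i :: ('x, 'k::comm_ring_1) mpoly) \<in> polys A"
  by (induction I rule: infinite_finite_induct) (auto simp: polys_0 polys_add)

lemma polys_prod:
  "(\<And>i. i \<in> I \<Longrightarrow> f i \<in> polys A) \<Longrightarrow> (\<Prod>i\<in>I. f i :: ('x, 'k::comm_ring_1) mpoly) \<in> polys A"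
  by (induction I rule: infinite_finite_induct) (auto simp: polys_1 polys_mult)

lemma polys_single: "keys m \<subseteq> A \<Longrightarrow> single m c \<in> polys A"
  by (auto simp: polys_def)

lemma polys_pvar: "x \<in> A \<Longrightarrow> pvar x \<in> polys A"
  by (auto simp: polys_def pvar_def)

lemma cring_poly_ring: "cring (poly_ring A :: ('x, 'k::comm_ring_1) mpoly ring)"
proof (rule cringI)
  show "abelian_group (poly_ring A :: ('x, 'k) mpoly ring)"
  proof (rule abelian_groupI)
    fix x :: "('x, 'k) mpoly" assume "x \<in> carrier (poly_ring A)"
    then show "\<exists>y\<in>carrier (poly_ring A). y \<oplus>\<^bsub>poly_ring A\<^esub> x = \<zero>\<^bsub>poly_ring A\<^esub>"
      using polys_uminus[of x A]
      by (intro bexI[of _ "- x"]) (auto simp: carrier_poly_ring, simp add: poly_ring_def)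
  qed (auto simp: carrier_poly_ring polys_add polys_0 poly_ring_def polys_def[symmetric])
  show "Group.comm_monoid (poly_ring A :: ('x, 'k) mpoly ring)"
    by (rule comm_monoidI)
      (auto simp: poly_ring_def polys_def[symmetric] polys_mult polys_1 mult_ac)
qed (simp add: poly_ring_def distrib_right)

lemma poly_ring_ops:
  "mult (poly_ring A) = (*)" "add (poly_ring A) = (+)" "zero (poly_ring A) = 0" "one (poly_ring A) = 1"
  by (simp_all add: poly_ring_def)

lemma poly_sum_single: "p = (\<Sum>m\<in>keys p. single m (lookup p m))"
proof (rule poly_mapping_eqI)
  fix k
  have "(\<Sum>m\<in>keys p. lookup p m when m = k)
      = (\<Sum>m\<in>keys p. if k = m then lookup p m else 0)"
    by (intro sum.cong) (auto simp: when_def)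
  also have "\<dots> = lookup p k"
    by (subst sum.delta'[OF finite_keys]) (simp add: in_keys_iff)
  finally show "lookup p k = lookup (\<Sum>m\<in>keys p. single m (lookup p m)) k"
    by (simp add: lookup_sum lookup_single)
qed

definition subst_monom :: "('x \<Rightarrow> ('z, 'k::comm_ring_1) mpoly) \<Rightarrow> ('x \<Rightarrow>\<^sub>0 nat) \<Rightarrow> ('z, 'k) mpoly" where
  "subst_monom \<rho> m = (\<Prod>x\<in>keys m. \<rho> x ^ lookup m x)"

definition subst :: "('x \<Rightarrow> ('z, 'k::comm_ring_1) mpoly) \<Rightarrow> ('x, 'k) mpoly \<Rightarrow> ('z, 'k) mpoly" where
  "subst \<rho> p = (\<Sum>m\<in>keys p. const (lookup p m) * subst_monom \<rho> m)"

lemma subst_monom_superset: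
  "finite B \<Longrightarrow> keys m \<subseteq> B \<Longrightarrow> subst_monom \<rho> m = (\<Prod>x\<in>B. \<rho> x ^ lookup m x)"
  unfolding subst_monom_def by (rule prod.mono_neutral_left) (auto simp: in_keys_iff)

lemma subst_monom_add: "subst_monom \<rho> (m + n) = subst_monom \<rho> m * subst_monom \<rho> n"
proof -
  let ?B = "keys m \<union> keys n"
  have "subst_monom \<rho> (m + n) = (\<Prod>x\<in>?B. \<rho> x ^ lookup (m + n) x)"
    by (rule subst_monom_superset) (auto simp: keys_monomial_add)
  then show ?thesis
    by (simp add: subst_monom_superset[of ?B m] subst_monom_superset[of ?B n] lookup_add power_add
        prod.distrib)
qed

lemma subst_monom_0: "subst_monom \<rho> 0 = 1"
  by (simp add: subst_monom_def)

lemma const_add: "const (a + b) = const a + const (b::'k::comm_ring_1)"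
  by (simp add: single_add)

lemma const_mult: "const (a * b) = const a * const (b::'k::comm_ring_1)"
  by (simp add: mult_single)

lemma subst_superset:
  "finite B \<Longrightarrow> keys p \<subseteq> B \<Longrightarrow>
    subst \<rho> p = (\<Sum>m\<in>B. const (lookup p m) * subst_monom \<rho> m)"
  unfolding subst_def by (rule sum.mono_neutral_left) (auto simp: in_keys_iff)

lemma subst_add: "subst \<rho> (p + q) = subst \<rho> p + subst \<rho> q"
proof -
  let ?B = "keys p \<union> keys q"
  have "subst \<rho> (p + q) = (\<Sum>m\<in>?B. const (lookup (p + q) m) * subst_monom \<rho> m)"
    by (rule subst_superset) (auto simp: keys_add)
  then show ?thesis
    by (simp add: subst_superset[of ?B p] subst_superset[of ?B q] lookup_add const_add
        distrib_right sum.distrib)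
qed

lemma subst_0: "subst \<rho> 0 = 0"
  by (simp add: subst_def)

lemma subst_single: "subst \<rho> (single m c) = const c * subst_monom \<rho> m"
  by (simp add: subst_def)

lemma subst_sum: "subst \<rho> (\<Sum>i\<in>I. f i) = (\<Sum>i\<in>I. subst \<rho> (f i))"
  by (induction I rule: infinite_finite_induct) (auto simp: subst_0 subst_add)

lemma subst_mult: "subst \<rho> (p * q) = subst \<rho> p * subst \<rho> q"
proof -
  let ?s = "\<lambda>p m. single m (lookup p m)"
  have "p * q = (\<Sum>m\<in>keys p. \<Sum>n\<in>keys q. ?s p m * ?s q n)"
    by (subst poly_sum_single[of p], subst poly_sum_single[of q]) (rule sum_product)
  moreover have "subst \<rho> (single m a * single n b)
      = subst \<rho> (single m a) * subst \<rho> (single n b)" for m n and a b :: 'b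
  proof -
    have "subst \<rho> (single m a * single n b)
        = const (a * b) * (subst_monom \<rho> m * subst_monom \<rho> n)"
      by (simp only: mult_single subst_single subst_monom_add)
    also have "\<dots> = (const a * subst_monom \<rho> m) * (const b * subst_monom \<rho> n)"
      by (simp only: const_mult mult_ac)
    finally show ?thesis by (simp only: subst_single)
  qed
  ultimately have "subst \<rho> (p * q) = (\<Sum>m\<in>keys p. \<Sum>n\<in>keys q. subst \<rho> (?s p m) * subst \<rho> (?s q n))"
    by (simp only: subst_sum)
  also have "\<dots> = (\<Sum>m\<in>keys p. subst \<rho> (?s p m)) * (\<Sum>n\<in>keys q. subst \<rho> (?s q n))"
    by (rule sum_product[symmetric])
  also have "\<dots> = subst \<rho> p * subst \<rho> q"
    by (simp only: subst_sum[symmetric] poly_sum_single[symmetric])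
  finally show ?thesis .
qed

lemma subst_const: "subst \<rho> (const c) = const c"
  by (simp add: subst_single subst_monom_0)

lemma subst_1: "subst \<rho> 1 = 1"
  using subst_const[of \<rho> 1] by simp

lemma subst_uminus: "subst \<rho> (- p) = - subst \<rho> p"
  using subst_add[of \<rho> p "- p"] by (simp add: subst_0 eq_neg_iff_add_eq_0 add.commute)

lemma subst_diff: "subst \<rho> (p - q) = subst \<rho> p - subst \<rho> q"
  using subst_add[of \<rho> p "- q"] by (simp add: subst_uminus)

lemma subst_power: "subst \<rho> (p ^ n) = subst \<rho> p ^ n"
  by (induction n) (auto simp: subst_1 subst_mult)

lemma subst_pvar: "subst \<rho> (pvar x) = \<rho> x"
  by (simp add: pvar_def subst_single subst_monom_def)

lemma subst_in_polys:
  assumes "\<And>x. \<rho> x \<in> polys Z"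
  shows "subst \<rho> p \<in> polys Z"
  unfolding subst_def subst_monom_def
  by (intro polys_sum polys_mult polys_const polys_prod polys_power assms)

text \<open>The linear order on the target variables orders the monomials compatibly with multiplication, which
  makes the target an integral domain.\<close>

lemma primeideal_kernel_subst:
  fixes \<rho> :: "'x \<Rightarrow> ('z::linorder, 'k::field) mpoly"
  shows "primeideal {p \<in> polys A. subst \<rho> p = 0} (poly_ring A)"
proof (rule primeidealI2)
  interpret cring "poly_ring A :: ('x, 'k) mpoly ring" by (rule cring_poly_ring)
  show "additive_subgroup {p \<in> polys A. subst \<rho> p = 0} (poly_ring A)"
  proof (rule additive_subgroup.intro, rule add.subgroupI)
    fix a :: "('x, 'k) mpoly" assume a: "a \<in> {p \<in> polys A. subst \<rho> p = 0}"
    have "\<ominus>\<^bsub>poly_ring A\<^esub> a = - a"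
      by (rule minus_equality) (use a in \<open>auto simp: carrier_poly_ring poly_ring_ops polys_uminus\<close>)
    then show "\<ominus>\<^bsub>poly_ring A\<^esub> a \<in> {p \<in> polys A. subst \<rho> p = 0}"
      using a by (simp add: polys_uminus subst_uminus)
  qed (auto simp: carrier_poly_ring poly_ring_ops polys_add subst_add intro: exI[of _ 0] simp: polys_0 subst_0)
  show "carrier (poly_ring A) \<noteq> {p \<in> polys A. subst \<rho> p = 0}"
    using polys_1[of A] by (auto simp: carrier_poly_ring subst_1 set_eq_iff intro!: exI[of _ 1])
qed (auto simp: cring_poly_ring carrier_poly_ring poly_ring_ops polys_mult subst_mult)


section \<open>Counting dimension: chains of primes and substitutions\<close>

lemma homogeneous_system_nontrivial_solution:
  fixes a :: "'i \<Rightarrow> 'j \<Rightarrow> 'k::field"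
  assumes "finite I" "finite J" "card I < card J"
  shows "\<exists>c. (\<exists>j\<in>J. c j \<noteq> 0) \<and> (\<forall>i\<in>I. (\<Sum>j\<in>J. c j * a i j) = 0)"
  using assms
proof (induction I arbitrary: J a rule: finite_induct)
  case empty
  then have "J \<noteq> {}" by auto
  then show ?case by (intro exI[of _ "\<lambda>_. 1"]) auto
next
  case (insert i I)
  show ?case
  proof (cases "\<forall>j\<in>J. a i j = 0")
    case True
    then have "(\<Sum>j\<in>J. c j * a i j) = 0" for c by simp
    moreover have "card I < card J" using insert.prems insert.hyps by simp
    ultimately show ?thesis using insert.IH[OF insert.prems(1), of a] by auto
  next
    case False
    then obtain j0 where j0: "j0 \<in> J" "a i j0 \<noteq> 0" by blast
    define J' where "J' = J - {j0}"
    have fin: "finite J'" and J: "J = insert j0 J'" "j0 \<notin> J'"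
      using insert.prems j0 by (auto simp: J'_def)
    have "card I < card J'" using insert.prems(2) insert.hyps fin unfolding J(1) using J(2) by simp
    then obtain c where c: "\<exists>j\<in>J'. c j \<noteq> 0"
      "\<forall>k\<in>I. (\<Sum>j\<in>J'. c j * (a k j - a i j * a k j0 / a i j0)) = 0"
      using insert.IH[OF fin, of "\<lambda>k j. a k j - a i j * a k j0 / a i j0"] by blast
    \<comment> \<open>Equation \<open>i\<close> is solved for the pivot unknown \<open>j0\<close>.\<close>
    define d where "d = (\<lambda>j. if j = j0 then - (\<Sum>j\<in>J'. c j * a i j) / a i j0 else c j)"
    have split: "(\<Sum>j\<in>J. d j * a k j) = (\<Sum>j\<in>J'. c j * a k j) - (\<Sum>j\<in>J'. c j * a i j) / a i j0 * a k j0" for k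
    proof -
      have "(\<Sum>j\<in>J'. d j * a k j) = (\<Sum>j\<in>J'. c j * a k j)"
        by (rule sum.cong) (use J(2) in \<open>auto simp: d_def\<close>)
      then show ?thesis using J fin by (simp add: d_def)
    qed
    have "(\<Sum>j\<in>J. d j * a k j) = 0" if "k \<in> insert i I" for k
    proof (cases "k = i")
      case True then show ?thesis using j0 by (simp add: split)
    next
      case False
      then have "(\<Sum>j\<in>J'. c j * (a k j - a i j * a k j0 / a i j0)) = 0" using c(2) that by blast
      then show ?thesis
        by (simp add: split right_diff_distrib sum_subtractf sum_distrib_right sum_distrib_left sum_divide_distrib mult_ac)
    qed
    moreover have "\<exists>j\<in>J. d j \<noteq> 0"
      using c(1) J by (auto simp: d_def)
    ultimately show ?thesis by blast
  qed
qed

text \<open>Primes of \<open>poly_ring A\<close> in terms of the type class operations, for which rewriting is set up.\<close>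

lemma prime_poly_idealD:
  fixes P :: "('x, 'k::field) mpoly set"
  assumes "primeideal P (poly_ring A)"
  shows "P \<subseteq> polys A" "0 \<in> P"
    "\<And>p q. p \<in> P \<Longrightarrow> q \<in> P \<Longrightarrow> p + q \<in> P"
    "\<And>p q. p \<in> P \<Longrightarrow> q \<in> P \<Longrightarrow> p - q \<in> P"
    "\<And>p q. p \<in> P \<Longrightarrow> q \<in> polys A \<Longrightarrow> q * p \<in> P"
    "\<And>p q. p \<in> P \<Longrightarrow> q \<in> polys A \<Longrightarrow> p * q \<in> P"
    "\<And>p q. p * q \<in> P \<Longrightarrow> p \<in> polys A \<Longrightarrow> q \<in> polys A \<Longrightarrow> p \<in> P \<or> q \<in> P"
    "1 \<notin> P"
proof -
  interpret primeideal P "poly_ring A" by fact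
  show sub: "P \<subseteq> polys A" using a_subset by (simp add: carrier_poly_ring)
  show "0 \<in> P" using additive_subgroup.zero_closed[OF is_additive_subgroup] by (simp add: poly_ring_ops)
  show add: "p + q \<in> P" if "p \<in> P" "q \<in> P" for p q
    using additive_subgroup.a_closed[OF is_additive_subgroup that] by (simp add: poly_ring_ops)
  show l: "q * p \<in> P" if "p \<in> P" "q \<in> polys A" for p q
    using I_l_closed that by (simp add: poly_ring_ops carrier_poly_ring)
  show "p * q \<in> P" if "p \<in> P" "q \<in> polys A" for p q
    using I_r_closed that by (simp add: poly_ring_ops carrier_poly_ring)
  show "p - q \<in> P" if "p \<in> P" "q \<in> P" for p q
    using add[OF that(1) l[OF that(2) polys_uminus[OF polys_1]]] by simp
  show "p \<in> P \<or> q \<in> P" if "p * q \<in> P" "p \<in> polys A" "q \<in> polys A" for p q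
    using I_prime that by (simp add: poly_ring_ops carrier_poly_ring)
  show "1 \<notin> P" using one_imp_carrier I_notcarr by (auto simp: poly_ring_ops)
qed

definition independent_mod :: "('x, 'k::comm_ring_1) mpoly set \<Rightarrow> 'i set \<Rightarrow> ('i \<Rightarrow> ('x, 'k) mpoly) \<Rightarrow> bool" where
  "independent_mod P I f \<longleftrightarrow> (\<forall>c. (\<Sum>i\<in>I. const (c i) * f i) \<in> P \<longrightarrow> (\<forall>i\<in>I. c i = 0))"

text \<open>Modulo \<open>Q\<close> only the terms without a factor \<open>q\<close> survive, so their coefficients vanish because \<open>f\<close> is
  independent modulo \<open>Q\<close>. The rest is divisible by \<open>q\<close>, which may be cancelled modulo \<open>P\<close>, and the
  argument repeats.\<close>

lemma independent_mod_powers: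
  fixes P Q :: "('x, 'k::field) mpoly set"
  assumes P: "primeideal P (poly_ring A)" and Q: "primeideal Q (poly_ring A)" and "P \<subseteq> Q"
    and q: "q \<in> Q" "q \<notin> P"
    and f: "\<And>i. i \<in> I \<Longrightarrow> f i \<in> polys A" and ind: "independent_mod Q I f"
    and rel: "(\<Sum>j\<le>M. q ^ j * (\<Sum>i\<in>I. const (c j i) * f i)) \<in> P"
  shows "\<forall>j\<le>M. \<forall>i\<in>I. c j i = 0"
  using rel
proof (induction M arbitrary: c)
  case 0
  then show ?case using ind \<open>P \<subseteq> Q\<close> by (auto simp: independent_mod_def)
next
  case (Suc M)
  note Pi = prime_poly_idealD[OF P] and Qi = prime_poly_idealD[OF Q]
  let ?g = "\<lambda>j. \<Sum>i\<in>I. const (c j i) * f i"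
  have g: "?g j \<in> polys A" for j by (intro polys_sum polys_mult polys_const f)
  have qA: "q \<in> polys A" using q Qi(1) by blast
  let ?r = "\<Sum>j\<le>M. q ^ j * ?g (Suc j)"
  have r: "?r \<in> polys A" by (intro polys_sum polys_mult polys_power qA g)
  have eq: "(\<Sum>j\<le>Suc M. q ^ j * ?g j) = ?g 0 + q * ?r"
    by (simp add: sum.atMost_Suc_shift sum_distrib_left mult.assoc del: sum.atMost_Suc)
  then have "?g 0 + q * ?r \<in> Q" using Suc.prems \<open>P \<subseteq> Q\<close> by auto
  moreover have "q * ?r \<in> Q" using Qi(6) q r by blast
  ultimately have "?g 0 \<in> Q" using Qi(4)[of "?g 0 + q * ?r" "q * ?r"] by simp
  then have c0: "\<forall>i\<in>I. c 0 i = 0" using ind by (auto simp: independent_mod_def)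
  then have "?g 0 = 0" by simp
  then have "q * ?r \<in> P" using Suc.prems eq by simp
  then have "?r \<in> P" using Pi(7) q qA r by blast
  then have "\<forall>j\<le>M. \<forall>i\<in>I. c (Suc j) i = 0" using Suc.IH[of "\<lambda>j. c (Suc j)"] by simp
  then show ?case using c0 by (metis Suc_le_mono not0_implies_Suc)
qed

definition exponents_le :: "nat \<Rightarrow> ('x, 'k::zero) mpoly \<Rightarrow> bool" where
  "exponents_le N p \<longleftrightarrow> (\<forall>m\<in>keys p. \<forall>x. lookup m x \<le> N)"

lemma exponents_le_mono: "exponents_le N p \<Longrightarrow> N \<le> N' \<Longrightarrow> exponents_le N' p"
  by (auto simp: exponents_le_def intro: order_trans)

lemma exponents_le_mult:
  "exponents_le M p \<Longrightarrow> exponents_le N q \<Longrightarrow> exponents_le (M + N) (p * q :: ('x, 'k::comm_ring_1) mpoly)"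
  unfolding exponents_le_def
proof (intro ballI allI)
  fix m x assume *: "\<forall>m\<in>keys p. \<forall>x. lookup m x \<le> M"
    "\<forall>m\<in>keys q. \<forall>x. lookup m x \<le> N" and "m \<in> keys (p * q)"
  then obtain a b where "m = a + b" "a \<in> keys p" "b \<in> keys q"
    using keys_mult[of p q] by blast
  then show "lookup m x \<le> M + N" using * by (simp add: lookup_add add_mono)
qed

lemma exponents_le_power:
  "exponents_le N p \<Longrightarrow> exponents_le (j * N) (p ^ j :: ('x, 'k::comm_ring_1) mpoly)"
  by (induction j) (auto simp: exponents_le_mult, simp add: exponents_le_def)

lemma exponents_le_exists: "\<exists>N. exponents_le N p"
proof -
  have "lookup m x \<le> (\<Sum>m\<in>keys p. \<Sum>x\<in>keys m. lookup m x)"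
    if "m \<in> keys p" for m x
  proof -
    have "lookup m x \<le> (\<Sum>x\<in>keys m. lookup m x)"
      by (cases "x \<in> keys m") (auto intro: member_le_sum simp: in_keys_iff)
    also have "\<dots> \<le> (\<Sum>m\<in>keys p. \<Sum>x\<in>keys m. lookup m x)"
      by (rule member_le_sum) (use that in auto)
    finally show ?thesis .
  qed
  then show ?thesis unfolding exponents_le_def by blast
qed

text \<open>Pick \<open>q\<^sub>i\<close> in \<open>P (Suc i)\<close> but not in \<open>P i\<close>. The family consists of the products
  \<open>q\<^sub>0\<^sup>a \<cdot> q\<^sub>1\<^sup>b \<cdots>\<close> with exponents up to \<open>M\<close>, indexed by their exponent lists. The constant
  \<open>e\<close> bounds the exponents that occur in the images of the \<open>q\<^sub>i\<close>; it has to be chosen before \<open>M\<close>, so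
  that the exponents in the images grow only linearly in \<open>M\<close>.\<close>

lemma prime_chain_independent_products:
  fixes P :: "nat \<Rightarrow> ('x, 'k::field) mpoly set"
  assumes "\<forall>i\<le>n. primeideal (P i) (poly_ring A)" "\<forall>i<n. P i \<subset> P (Suc i)"
  shows "\<exists>e. \<forall>M. \<exists>(I :: nat list set) f. finite I \<and> card I = (M + 1) ^ n \<and> (\<forall>i\<in>I. f i \<in> polys A) \<and>
    independent_mod (P 0) I f \<and> (\<forall>i\<in>I. exponents_le (n * e * M) (subst \<rho> (f i)))"
  using assms
proof (induction n arbitrary: P)
  case 0
  note Pi = prime_poly_idealD[of "P 0" A]
  have "c = 0" if "const c \<in> P 0" for c
  proof (rule ccontr)
    assume "c \<noteq> 0"
    then have "const (inverse c) * const c = (1 :: ('x, 'k) mpoly)"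
      by (simp add: const_mult[symmetric] del: mult_single)
    then show False using Pi(5)[OF _ that polys_const[of "inverse c"]] Pi(8) 0 by auto
  qed
  then show ?case
    by (intro exI[of _ 0] allI exI[of _ "{[]}"] exI[of _ "\<lambda>_. 1"])
      (auto simp: polys_1 independent_mod_def subst_1 exponents_le_def)
next
  case (Suc n)
  have P0: "primeideal (P 0) (poly_ring A)" and P1: "primeideal (P (Suc 0)) (poly_ring A)"
    and sub: "P 0 \<subset> P (Suc 0)"
    using Suc.prems by auto
  obtain e where e: "\<And>M. \<exists>(I :: nat list set) f. finite I \<and> card I = (M + 1) ^ n \<and> (\<forall>i\<in>I. f i \<in> polys A) \<and>
    independent_mod (P (Suc 0)) I f \<and> (\<forall>i\<in>I. exponents_le (n * e * M) (subst \<rho> (f i)))"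
    using Suc.IH[of "\<lambda>i. P (Suc i)"] Suc.prems by auto
  obtain q where q: "q \<in> P (Suc 0)" "q \<notin> P 0" using sub by blast
  have qA: "q \<in> polys A" using q prime_poly_idealD(1)[OF P1] by blast
  obtain e' where e': "exponents_le e' (subst \<rho> q)" using exponents_le_exists by blast
  define E where "E = max e e'"
  show ?case
  proof (intro exI[of _ E] allI)
    fix M
    obtain I :: "nat list set" and f where I: "finite I" "card I = (M + 1) ^ n" "\<And>i. i \<in> I \<Longrightarrow> f i \<in> polys A"
      "independent_mod (P (Suc 0)) I f" "\<And>i. i \<in> I \<Longrightarrow> exponents_le (n * e * M) (subst \<rho> (f i))"
      using e[of M] by blast
    define I' where "I' = (\<lambda>(j, l). j # l) ` ({..M} \<times> I)"
    define f' where "f' = (\<lambda>l. q ^ hd l * f (tl l))"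
    have inj: "inj_on (\<lambda>(j, l). j # l) ({..M} \<times> I)" by (auto simp: inj_on_def)
    have "card I' = (M + 1) ^ Suc n"
      by (simp add: I'_def card_image[OF inj] card_cartesian_product I)
    moreover have "finite I'" by (simp add: I'_def I)
    moreover have "\<forall>l\<in>I'. f' l \<in> polys A"
      by (auto simp: I'_def f'_def intro!: polys_mult polys_power qA I)
    moreover have "independent_mod (P 0) I' f'"
      unfolding independent_mod_def
    proof (intro allI impI)
      fix c assume c: "(\<Sum>l\<in>I'. const (c l) * f' l) \<in> P 0"
      have "(\<Sum>l\<in>I'. const (c l) * f' l) = (\<Sum>(j, l)\<in>{..M} \<times> I. const (c (j # l)) * (q ^ j * f l))"
        unfolding I'_def sum.reindex[OF inj] by (rule sum.cong) (auto simp: f'_def)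
      also have "\<dots> = (\<Sum>j\<le>M. \<Sum>l\<in>I. const (c (j # l)) * (q ^ j * f l))"
        by (rule sum.cartesian_product[symmetric])
      also have "\<dots> = (\<Sum>j\<le>M. q ^ j * (\<Sum>l\<in>I. const (c (j # l)) * f l))"
        by (simp only: sum_distrib_left mult.left_commute)
      finally have "(\<Sum>j\<le>M. q ^ j * (\<Sum>l\<in>I. const (c (j # l)) * f l)) \<in> P 0" using c by simp
      then have "\<forall>j\<le>M. \<forall>l\<in>I. c (j # l) = 0"
        by (intro independent_mod_powers[OF P0 P1 _ q, where f = f]) (use sub I in auto)
      then show "\<forall>l\<in>I'. c l = 0" by (auto simp: I'_def)
    qed
    moreover have "exponents_le (Suc n * E * M) (subst \<rho> (f' l))" if l: "l \<in> I'" for l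
    proof -
      obtain j l' where jl: "l = j # l'" "j \<le> M" "l' \<in> I" using l by (auto simp: I'_def)
      have "exponents_le (j * e' + n * e * M) (subst \<rho> (f' l))"
        using exponents_le_mult[OF exponents_le_power[OF e', of j] I(5)[OF jl(3)]]
        by (simp add: f'_def jl subst_mult subst_power)
      moreover have "j * e' + n * e * M \<le> Suc n * E * M"
      proof -
        have "j * e' \<le> M * E" "n * e * M \<le> n * E * M"
          using jl by (auto simp: E_def intro!: mult_mono)
        then have "j * e' + n * e * M \<le> M * E + n * E * M" by (rule add_mono)
        then show ?thesis by (simp add: algebra_simps)
      qed
      ultimately show ?thesis by (rule exponents_le_mono)
    qed
    ultimately show "\<exists>(I :: nat list set) f. finite I \<and> card I = (M + 1) ^ Suc n \<and> (\<forall>i\<in>I. f i \<in> polys A) \<and>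
      independent_mod (P 0) I f \<and> (\<forall>i\<in>I. exponents_le (Suc n * E * M) (subst \<rho> (f i)))"
      by blast
  qed
qed

lemma card_exponent_box:
  fixes N :: nat
  assumes "finite Z"
  defines "B \<equiv> {m :: 'z \<Rightarrow>\<^sub>0 nat. keys m \<subseteq> Z \<and> (\<forall>z. lookup m z \<le> N)}"
  shows "finite B" "card B \<le> (N + 1) ^ card Z"
proof -
  let ?h = "\<lambda>m. restrict (lookup m) Z"
  have inj: "inj_on ?h B"
  proof (rule inj_onI)
    fix m m' assume "m \<in> B" "m' \<in> B" and eq: "?h m = ?h m'"
    show "m = m'"
    proof (rule poly_mapping_eqI)
      fix z
      show "lookup m z = lookup m' z"
      proof (cases "z \<in> Z")
        case True then show ?thesis using fun_cong[OF eq, of z] by simp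
      next
        case False
        then have "z \<notin> keys m" "z \<notin> keys m'"
          using \<open>m \<in> B\<close> \<open>m' \<in> B\<close> by (auto simp: B_def)
        then show ?thesis by (simp add: in_keys_iff)
      qed
    qed
  qed
  have sub: "?h ` B \<subseteq> PiE Z (\<lambda>_. {..N})" by (auto simp: B_def)
  have fin: "finite (PiE Z (\<lambda>_. {..N}))" using assms by (simp add: finite_PiE)
  then show "finite B" using inj sub by (metis finite_imageD finite_subset)
  have "card B = card (?h ` B)" by (rule card_image[OF inj, symmetric])
  also have "\<dots> \<le> card (PiE Z (\<lambda>_. {..N}))" by (rule card_mono[OF fin sub])
  finally show "card B \<le> (N + 1) ^ card Z" using assms by (simp add: card_PiE)
qed

text \<open>Otherwise, for large \<open>M\<close>, there are more independent products than monomials in their images, so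
  some linear combination of the products with nonzero coefficients has image zero. It then lies in
  \<open>P 0\<close>, contrary to independence. This growth argument does the work of transcendence degrees.\<close>

theorem prime_chain_length_le:
  fixes P :: "nat \<Rightarrow> ('x, 'k::field) mpoly set" and \<rho> :: "'x \<Rightarrow> ('z, 'k) mpoly"
  assumes chain: "\<forall>i\<le>n. primeideal (P i) (poly_ring A)" "\<forall>i<n. P i \<subset> P (Suc i)"
    and Z: "finite Z" "\<And>x. \<rho> x \<in> polys Z"
    and ker: "\<And>p. p \<in> polys A \<Longrightarrow> subst \<rho> p = 0 \<Longrightarrow> p \<in> P 0"
  shows "n \<le> card Z"
proof (rule ccontr)
  assume "\<not> n \<le> card Z"
  define d where "d = card Z"
  have nd: "d < n" using \<open>\<not> n \<le> card Z\<close> by (simp add: d_def)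
  obtain e where e: "\<And>M. \<exists>(I :: nat list set) f. finite I \<and> card I = (M + 1) ^ n \<and> (\<forall>i\<in>I. f i \<in> polys A) \<and>
    independent_mod (P 0) I f \<and> (\<forall>i\<in>I. exponents_le (n * e * M) (subst \<rho> (f i)))"
    using prime_chain_independent_products[OF chain, of \<rho>] by blast
  \<comment> \<open>Large enough for \<open>(n e M + 1)\<^sup>d \<le> ((n e + 1) (M + 1))\<^sup>d = M (M + 1)\<^sup>d < (M + 1)\<^sup>n\<close>.\<close>
  define M where "M = (n * e + 1) ^ d"
  obtain I :: "nat list set" and f where I: "finite I" "card I = (M + 1) ^ n" "\<And>i. i \<in> I \<Longrightarrow> f i \<in> polys A"
      "independent_mod (P 0) I f" "\<And>i. i \<in> I \<Longrightarrow> exponents_le (n * e * M) (subst \<rho> (f i))"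
    using e[of M] by blast
  let ?B = "{m :: 'z \<Rightarrow>\<^sub>0 nat. keys m \<subseteq> Z \<and> (\<forall>z. lookup m z \<le> n * e * M)}"
  have "card ?B \<le> (n * e * M + 1) ^ d"
    unfolding d_def by (rule card_exponent_box(2)[OF Z(1)])
  also have "\<dots> \<le> ((n * e + 1) * (M + 1)) ^ d" by (intro power_mono) auto
  also have "\<dots> = M * (M + 1) ^ d" by (subst power_mult_distrib) (simp only: M_def)
  also have "\<dots> < (M + 1) ^ Suc d" by simp
  also have "\<dots> \<le> (M + 1) ^ n" using nd by (intro power_increasing) auto
  finally have "card ?B < card I" by (simp add: I)
  then obtain c where c: "\<exists>i\<in>I. c i \<noteq> 0"
    "\<forall>m\<in>?B. (\<Sum>i\<in>I. c i * lookup (subst \<rho> (f i)) m) = 0"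
    using homogeneous_system_nontrivial_solution[OF card_exponent_box(1)[OF Z(1), of "n * e * M"] I(1),
      of "\<lambda>m i. lookup (subst \<rho> (f i)) m"] by blast
  have "(\<Sum>i\<in>I. const (c i) * subst \<rho> (f i)) = 0"
  proof (rule poly_mapping_eqI)
    fix m
    have lk: "lookup (const (c i) * p) m = c i * lookup p m" for i and p :: "('z, 'k) mpoly"
      by (simp add: mult_map_scale_conv_mult[symmetric] Poly_Mapping.map.rep_eq when_def)
    have "(\<Sum>i\<in>I. c i * lookup (subst \<rho> (f i)) m) = 0"
    proof (cases "m \<in> ?B")
      case True then show ?thesis using c(2) by blast
    next
      case False
      have "lookup (subst \<rho> (f i)) m = 0" if "i \<in> I" for i
      proof (rule ccontr)
        assume "lookup (subst \<rho> (f i)) m \<noteq> 0"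
        then have "m \<in> keys (subst \<rho> (f i))" by (simp add: in_keys_iff)
        then have "m \<in> ?B" using I(5)[OF that] subst_in_polys[of \<rho> Z "f i", OF Z(2)]
          by (auto simp: exponents_le_def polys_def)
        then show False using False by blast
      qed
      then show ?thesis by simp
    qed
    then show "lookup (\<Sum>i\<in>I. const (c i) * subst \<rho> (f i)) m = lookup 0 m"
      by (simp add: lookup_sum lk)
  qed
  then have "subst \<rho> (\<Sum>i\<in>I. const (c i) * f i) = 0"
    by (simp add: subst_sum subst_mult subst_const)
  then have "(\<Sum>i\<in>I. const (c i) * f i) \<in> P 0"
    by (intro ker polys_sum polys_mult polys_const I)
  then show False using I(4) c(1) by (auto simp: independent_mod_def)
qed

section \<open>Primes of a quotient ring\<close>

text \<open>Taking images and preimages under the surjection \<open>R \<rightarrow> R/J\<close> matches the primes of \<open>R/J\<close> with the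
  primes above \<open>J\<close> and keeps inclusions strict.\<close>

theorem krull_dim_Quot:
  fixes R (structure)
  assumes "cring R" "ideal J R"
  shows "krull_dim (R Quot J) = Sup {enat n | n P.
    (\<forall>i\<le>n. primeideal (P i) R \<and> J \<subseteq> P i) \<and> (\<forall>i<n. P i \<subset> P (Suc i))}"
proof -
  have zero: "\<zero>\<^bsub>R Quot J\<^esub> = J" by (simp add: FactRing_def)
  interpret cring R by fact
  interpret J: ideal J R by fact
  interpret h: ring_hom_ring R "R Quot J" "(+>) J" by (rule J.rcos_ring_hom_ring)
  have Qc: "cring (R Quot J)" by (rule J.quotient_is_cring) (rule is_cring)
  have surj: "\<exists>a\<in>carrier R. x = J +> a" if "x \<in> carrier (R Quot J)" for x
    using that unfolding FactRing_def A_RCOSETS_def'[of R J] by auto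
  have mem: "J +> a \<in> (+>) J ` P \<longleftrightarrow> a \<in> P" if "ideal P R" "J \<subseteq> P" "a \<in> carrier R" for P a
  proof
    assume "J +> a \<in> (+>) J ` P"
    then obtain b where b: "b \<in> P" "J +> a = J +> b" by blast
    then have "b \<in> carrier R" using that(1) by (meson ideal.Icarr)
    then have "a \<ominus> b \<in> J" using b that(3) quotient_eq_iff_same_a_r_cos[OF assms(2), of a b] by simp
    then have "(a \<ominus> b) \<oplus> b \<in> P"
      using that b(1) by (meson additive_subgroup.a_closed ideal.axioms(1) subsetD)
    then show "a \<in> P" using \<open>b \<in> carrier R\<close> that(3)
      by (simp add: a_minus_def a_assoc l_neg)
  qed auto
  have img: "primeideal ((+>) J ` P) (R Quot J)" if P: "primeideal P R" "J \<subseteq> P" for P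
  proof (rule primeidealI)
    interpret P: primeideal P R by fact
    show "ideal ((+>) J ` P) (R Quot J)" by (rule ring_ideal_imp_quot_ideal[OF assms(2) P.is_ideal])
    show "cring (R Quot J)" by (rule Qc)
    have "J +> \<one> \<notin> (+>) J ` P"
      using mem[OF P.is_ideal P(2), of \<one>] P.one_imp_carrier P.I_notcarr by auto
    then show "carrier (R Quot J) \<noteq> (+>) J ` P" using h.hom_closed[of \<one>] by auto
    fix x y assume x: "x \<in> carrier (R Quot J)" and y: "y \<in> carrier (R Quot J)"
      and xy: "x \<otimes>\<^bsub>R Quot J\<^esub> y \<in> (+>) J ` P"
    obtain a where a: "a \<in> carrier R" "x = J +> a" using surj[OF x] by (elim bexE)
    obtain b where b: "b \<in> carrier R" "y = J +> b" using surj[OF y] by (elim bexE)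
    note ab = a b
    have "J +> (a \<otimes> b) \<in> (+>) J ` P" using xy by (simp only: ab h.hom_mult)
    then have "a \<otimes> b \<in> P" using mem[OF P.is_ideal P(2) m_closed[OF a(1) b(1)]] by (simp only:)
    then show "x \<in> (+>) J ` P \<or> y \<in> (+>) J ` P" using P.I_prime ab by blast
  qed
  define pre where "pre = (\<lambda>P'. {a \<in> carrier R. J +> a \<in> P'})"
  have vimg: "primeideal (pre P') R \<and> J \<subseteq> pre P'" if "primeideal P' (R Quot J)" for P'
  proof
    interpret P': primeideal P' "R Quot J" by fact
    have id: "ideal (pre P') R" unfolding pre_def by (rule h.ideal_vimage) (rule P'.is_ideal)
    show "primeideal (pre P') R"
    proof (rule primeidealI[OF id is_cring])
      have "J +> \<one> \<notin> P'" using P'.one_imp_carrier P'.I_notcarr h.hom_one by auto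
      then have "\<one> \<notin> pre P'" unfolding pre_def by blast
      then show "carrier R \<noteq> pre P'" using one_closed by metis
      fix a b assume a: "a \<in> carrier R" and b: "b \<in> carrier R" and "a \<otimes> b \<in> pre P'"
      then have "(J +> a) \<otimes>\<^bsub>R Quot J\<^esub> (J +> b) \<in> P'"
        unfolding pre_def mem_Collect_eq by (simp only: h.hom_mult)
      then have "J +> a \<in> P' \<or> J +> b \<in> P'"
        by (rule P'.I_prime[OF h.hom_closed[OF a] h.hom_closed[OF b]])
      then show "a \<in> pre P' \<or> b \<in> pre P'"
        unfolding pre_def mem_Collect_eq using a b by (simp only: simp_thms)
    qed
    show "J \<subseteq> pre P'"
    proof
      fix a assume a: "a \<in> J"
      have "J +> a \<in> P'"
        using additive_subgroup.zero_closed[OF P'.is_additive_subgroup] unfolding zero J.a_rcos_const[OF a] .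
      then show "a \<in> pre P'" unfolding pre_def mem_Collect_eq using J.Icarr[OF a] by (rule conjI[rotated])
    qed
  qed
  have "(\<exists>P. (\<forall>i\<le>n. primeideal (P i) (R Quot J)) \<and> (\<forall>i<n. P i \<subset> P (Suc i))) \<longleftrightarrow>
    (\<exists>P. (\<forall>i\<le>n. primeideal (P i) R \<and> J \<subseteq> P i) \<and> (\<forall>i<n. P i \<subset> P (Suc i)))" (is "?L \<longleftrightarrow> ?R") for n :: nat
  proof
    assume ?L
    then obtain P where P: "\<forall>i\<le>n. primeideal (P i) (R Quot J)" "\<forall>i<n. P i \<subset> P (Suc i)" by blast
    have "pre (P i) \<subset> pre (P (Suc i))" if "i < n" for i
    proof -
      have sub: "P i \<subset> P (Suc i)" using P(2) that by simp
      obtain x where x: "x \<in> P (Suc i)" "x \<notin> P i" using psubset_imp_ex_mem[OF sub] by auto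
      have "primeideal (P (Suc i)) (R Quot J)" using P(1) that by simp
      then have "x \<in> carrier (R Quot J)" using x(1) by (meson ideal.Icarr primeideal.axioms(1))
      then obtain a where "a \<in> carrier R" "x = J +> a" using surj by blast
      then have "a \<in> pre (P (Suc i)) - pre (P i)" using x by (simp add: pre_def)
      moreover have "pre (P i) \<subseteq> pre (P (Suc i))" using sub unfolding pre_def by blast
      ultimately show ?thesis by blast
    qed
    then show ?R using vimg P(1) by (intro exI[of _ "\<lambda>i. pre (P i)"]) auto
  next
    assume ?R
    then obtain P where P: "\<forall>i\<le>n. primeideal (P i) R \<and> J \<subseteq> P i" "\<forall>i<n. P i \<subset> P (Suc i)" by blast
    have "(+>) J ` P i \<subset> (+>) J ` P (Suc i)" if "i < n" for i
    proof -
      have sub: "P i \<subset> P (Suc i)" using P(2) that by simp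
      obtain a where a: "a \<in> P (Suc i)" "a \<notin> P i" using psubset_imp_ex_mem[OF sub] by auto
      have i: "ideal (P i) R" "J \<subseteq> P i" "ideal (P (Suc i)) R"
        using P(1)[rule_format, of i] P(1)[rule_format, of "Suc i"] that
        by (simp_all add: primeideal.axioms(1))
      then have "a \<in> carrier R" using a(1) by (meson ideal.Icarr)
      then have "J +> a \<notin> (+>) J ` P i" using mem i a(2) by blast
      then show ?thesis using a(1) sub by blast
    qed
    then show ?L using img P(1) by (intro exI[of _ "\<lambda>i. (+>) J ` P i"]) auto
  qed
  then show ?thesis unfolding krull_dim_def by (intro arg_cong[where f = Sup]) auto
qed

section \<open>Components of induced subgraphs\<close>

locale finite_graph =
  fixes G :: "'v ugraph"
  assumes simple: "simple_graph G"
begin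

abbreviation adj :: "'v \<Rightarrow> 'v \<Rightarrow> bool" where
  "adj u v \<equiv> {u, v} \<in> edges G"

abbreviation connected_in :: "'v set \<Rightarrow> 'v \<Rightarrow> 'v \<Rightarrow> bool" where
  "connected_in A \<equiv> reachable (induced G A)"

lemma finite_verts: "finite (verts G)"
  using simple by (simp add: simple_graph_def)

lemma adj_verts: "adj u v \<Longrightarrow> u \<in> verts G \<and> v \<in> verts G \<and> u \<noteq> v"
proof -
  assume "adj u v"
  then have "{u, v} \<subseteq> verts G" "card {u, v} = 2" using simple by (auto simp: simple_graph_def)
  then show ?thesis by (auto simp: card_insert_if split: if_splits)
qed

lemma adj_sym: "adj u v \<longleftrightarrow> adj v u"
  by (simp add: insert_commute)

lemma edges_induced: "{u, v} \<in> edges (induced G A) \<longleftrightarrow> adj u v \<and> u \<in> A \<and> v \<in> A"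
  by (auto simp: induced_def)

lemma verts_induced: "A \<subseteq> verts G \<Longrightarrow> verts (induced G A) = A"
  by (auto simp: induced_def)

lemma induced_induced: "induced (induced G A) B = induced G (A \<inter> B)"
  by (auto simp: induced_def)

lemma remove_verts_induced: "A \<subseteq> verts G \<Longrightarrow> remove_verts (induced G A) B = induced G (A - B)"
proof -
  assume A: "A \<subseteq> verts G"
  have "A \<inter> (A - B) = A - B" by blast
  then show ?thesis by (simp add: remove_verts_def verts_induced[OF A] induced_induced)
qed

lemma induced_verts: "induced G (verts G) = G"
  using simple by (cases G) (auto simp: induced_def simple_graph_def)

lemma simple_induced: "simple_graph (induced G A)"
  using simple by (auto simp: simple_graph_def induced_def)

lemma edge_obtain: "e \<in> edges G \<Longrightarrow> \<exists>u v. e = {u, v} \<and> u \<noteq> v"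
  using simple by (auto simp: simple_graph_def card_2_iff)

lemma connected_refl [simp]: "connected_in A u u"
  by (simp add: reachable_def)

lemma connected_trans: "connected_in A u v \<Longrightarrow> connected_in A v w \<Longrightarrow> connected_in A u w"
  unfolding reachable_def by (rule rtranclp_trans)

lemma connected_sym: "connected_in A u v \<Longrightarrow> connected_in A v u"
proof -
  have "symp (\<lambda>u v. {u, v} \<in> edges (induced G A))" by (rule sympI) (simp add: insert_commute)
  then show "connected_in A u v \<Longrightarrow> connected_in A v u"
    unfolding reachable_def by (metis symp_rtranclp sympD)
qed

lemma connected_adj: "adj u v \<Longrightarrow> u \<in> A \<Longrightarrow> v \<in> A \<Longrightarrow> connected_in A u v"
  unfolding reachable_def by (rule r_into_rtranclp) (simp add: edges_induced)

lemma connected_mono: "A \<subseteq> B \<Longrightarrow> connected_in A u v \<Longrightarrow> connected_in B u v"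
  unfolding reachable_def
  by (erule rtranclp_mono[THEN predicate2D, rotated]) (auto simp: edges_induced)

lemma connected_induct [consumes 1, case_names refl step]:
  assumes "connected_in A u v" "P u"
    "\<And>x y. connected_in A u x \<Longrightarrow> P x \<Longrightarrow> adj x y \<Longrightarrow> x \<in> A \<Longrightarrow> y \<in> A \<Longrightarrow> P y"
  shows "P v"
  using assms(1) unfolding reachable_def
  by (induction rule: rtranclp_induct) (use assms(2,3) in \<open>auto simp: reachable_def edges_induced\<close>)

lemma connected_closed:
  assumes "connected_in A u v" "u \<in> C" "\<And>x y. x \<in> C \<Longrightarrow> y \<in> A \<Longrightarrow> adj x y \<Longrightarrow> y \<in> C"
  shows "v \<in> C"
  using assms(1) by (induction rule: connected_induct) (use assms in auto)

lemma connected_closed_in: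
  assumes "connected_in A u v" "u \<in> C" "C \<subseteq> A" "\<And>x y. x \<in> C \<Longrightarrow> y \<in> A \<Longrightarrow> adj x y \<Longrightarrow> y \<in> C"
  shows "connected_in C u v \<and> v \<in> C"
  using assms(1)
proof (induction rule: connected_induct)
  case (step x y)
  then show ?case using assms(4) connected_adj[of x y C] connected_trans by blast
qed (use assms in simp)

text \<open>Components are recorded as vertex sets, so that the induced subgraphs of one graph can be compared
  through their vertex sets alone.\<close>

definition comps :: "'v set \<Rightarrow> 'v set set" where
  "comps A = (\<lambda>v. {u \<in> A. connected_in A v u}) ` A"

abbreviation ncomp :: "'v set \<Rightarrow> nat" where
  "ncomp A \<equiv> card (comps A)"

lemma finite_comps: "finite A \<Longrightarrow> finite (comps A)"
  by (simp add: comps_def)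

lemma Union_comps: "\<Union> (comps A) = A"
  by (auto simp: comps_def)

lemma comps_subset: "C \<in> comps A \<Longrightarrow> C \<subseteq> A"
  by (auto simp: comps_def)

lemma comps_nonempty: "C \<in> comps A \<Longrightarrow> C \<noteq> {}"
  by (auto simp: comps_def)

lemma comps_eq_class: "C \<in> comps A \<Longrightarrow> u \<in> C \<Longrightarrow> C = {w \<in> A. connected_in A u w}"
proof -
  assume "C \<in> comps A" and u: "u \<in> C"
  then obtain v where C: "C = {w \<in> A. connected_in A v w}" by (auto simp: comps_def)
  then have vu: "connected_in A v u" using u by simp
  have "connected_in A v w \<longleftrightarrow> connected_in A u w" for w
    using connected_trans[OF vu, of w] connected_trans[OF connected_sym[OF vu], of w] by (rule iffI[rotated])
  then show ?thesis unfolding C by simp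
qed

lemma comps_disjoint: "C \<in> comps A \<Longrightarrow> D \<in> comps A \<Longrightarrow> u \<in> C \<Longrightarrow> u \<in> D \<Longrightarrow> C = D"
  using comps_eq_class[of C A u] comps_eq_class[of D A u] by simp

lemma comps_connected: "C \<in> comps A \<Longrightarrow> u \<in> C \<Longrightarrow> w \<in> C \<Longrightarrow> connected_in A u w"
  using comps_eq_class[of C A u] by simp

lemma comps_closed: "C \<in> comps A \<Longrightarrow> u \<in> C \<Longrightarrow> w \<in> A \<Longrightarrow> adj u w \<Longrightarrow> w \<in> C"
  using comps_eq_class[of C A u] connected_adj[of u w A] comps_subset[of C A] by auto

lemma comps_connected_inner: "C \<in> comps A \<Longrightarrow> u \<in> C \<Longrightarrow> w \<in> C \<Longrightarrow> connected_in C u w"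
  by (rule connected_closed_in[THEN conjunct1, of A])
    (auto intro: comps_connected comps_closed dest: comps_subset)

lemma comp_of: "u \<in> A \<Longrightarrow> \<exists>C\<in>comps A. u \<in> C"
  using Union_comps by blast

lemma comps_eqI:
  assumes "\<Union> \<P> = A"
    and ne: "\<And>C. C \<in> \<P> \<Longrightarrow> C \<noteq> {}"
    and conn: "\<And>C u w. C \<in> \<P> \<Longrightarrow> u \<in> C \<Longrightarrow> w \<in> C \<Longrightarrow> connected_in A u w"
    and closed: "\<And>C u w. C \<in> \<P> \<Longrightarrow> u \<in> C \<Longrightarrow> w \<in> A \<Longrightarrow> adj u w \<Longrightarrow> w \<in> C"
  shows "comps A = \<P>"
proof -
  have eq: "C = {w \<in> A. connected_in A u w}" if "C \<in> \<P>" "u \<in> C" for C u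
  proof
    show "C \<subseteq> {w \<in> A. connected_in A u w}" using conn that assms(1) by blast
    show "{w \<in> A. connected_in A u w} \<subseteq> C"
      using connected_closed[of A u _ C] closed that by blast
  qed
  show ?thesis
  proof
    show "\<P> \<subseteq> comps A"
    proof
      fix C assume C: "C \<in> \<P>"
      then obtain u where u: "u \<in> C" using ne by blast
      then have "u \<in> A" using C assms(1) by blast
      then show "C \<in> comps A" unfolding comps_def using eq[OF C u] by blast
    qed
    show "comps A \<subseteq> \<P>"
    proof
      fix C assume "C \<in> comps A"
      then obtain u where u: "u \<in> A" "C = {w \<in> A. connected_in A u w}" by (auto simp: comps_def)
      then obtain D where "D \<in> \<P>" "u \<in> D" using assms(1) by blast
      then show "C \<in> \<P>" using eq[of D u] u by simp
    qed
  qed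
qed

lemma comps_empty [simp]: "comps {} = {}"
  by (simp add: comps_def)

lemma components_induced: "A \<subseteq> verts G \<Longrightarrow> components (induced G A) = induced G ` comps A"
proof -
  assume A: "A \<subseteq> verts G"
  have "A \<inter> {u \<in> A. connected_in A v u} = {u \<in> A. connected_in A v u}" for v by blast
  then show ?thesis
    by (simp add: components_def comps_def verts_induced[OF A] induced_induced image_image)
qed

lemma inj_on_induced: "inj_on (induced G) (Pow (verts G))"
  by (rule inj_onI) (metis PowD verts_induced)

lemma card_components_induced: "A \<subseteq> verts G \<Longrightarrow> card (components (induced G A)) = ncomp A"
  unfolding components_induced
  by (rule card_image, rule inj_on_subset[OF inj_on_induced]) (use comps_subset in blast)

lemma comps_connected_set:
  "connected_graph (induced G A) \<longleftrightarrow> comps A = {A}" if "A \<subseteq> verts G"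
proof
  assume "connected_graph (induced G A)"
  then show "comps A = {A}"
    by (intro comps_eqI) (auto simp: connected_graph_def verts_induced that)
next
  assume "comps A = {A}"
  then show "connected_graph (induced G A)"
    using comps_nonempty[of A A] comps_connected[of A A]
    by (simp add: connected_graph_def verts_induced that)
qed

lemma comps_disjoint_Un:
  assumes "\<And>a b. a \<in> A \<Longrightarrow> b \<in> B \<Longrightarrow> \<not> adj a b"
  shows "comps (A \<union> B) = comps A \<union> comps B"
proof (rule comps_eqI)
  show "connected_in (A \<union> B) u w" if "C \<in> comps A \<union> comps B" "u \<in> C" "w \<in> C" for C u w
    using that comps_connected[of C A u w] comps_connected[of C B u w]
      connected_mono[of A "A \<union> B" u w] connected_mono[of B "A \<union> B" u w] by blast
  show "w \<in> C" if "C \<in> comps A \<union> comps B" "u \<in> C" "w \<in> A \<union> B" "adj u w" for C u w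
    using that comps_closed comps_subset assms adj_sym by blast
qed (auto simp: Union_comps dest: comps_nonempty)

lemma ncomp_disjoint_Un:
  assumes "finite A" "finite B" "A \<inter> B = {}" "\<And>a b. a \<in> A \<Longrightarrow> b \<in> B \<Longrightarrow> \<not> adj a b"
  shows "ncomp (A \<union> B) = ncomp A + ncomp B"
proof -
  have "comps A \<inter> comps B = {}"
    using assms(3) comps_subset comps_nonempty by blast
  then show ?thesis
    using comps_disjoint_Un[of A B] assms by (simp add: card_Un_disjoint finite_comps)
qed

definition adj_comps :: "'v \<Rightarrow> 'v set \<Rightarrow> 'v set set" where
  "adj_comps v A = {C \<in> comps A. \<exists>u\<in>C. adj v u}"

lemma comps_insert:
  assumes "v \<notin> A"
  shows "comps (insert v A) = (comps A - adj_comps v A) \<union> {insert v (\<Union> (adj_comps v A))}"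
proof (rule comps_eqI)
  let ?D = "insert v (\<Union> (adj_comps v A))"
  show "\<Union> ((comps A - adj_comps v A) \<union> {?D}) = insert v A"
  proof -
    have sub: "adj_comps v A \<subseteq> comps A" by (auto simp: adj_comps_def)
    have "\<Union> ((comps A - adj_comps v A) \<union> {?D}) = insert v (\<Union> (comps A - adj_comps v A \<union> adj_comps v A))"
      by blast
    also have "comps A - adj_comps v A \<union> adj_comps v A = comps A" using sub by blast
    finally show ?thesis unfolding Union_comps .
  qed
  have "connected_in (insert v A) v w" if w: "w \<in> ?D" for w
  proof (cases "w = v")
    case False
    then obtain C u where C: "C \<in> comps A" "w \<in> C" "u \<in> C" "adj v u" using w by (auto simp: adj_comps_def)
    have "connected_in (insert v A) v u" by (rule connected_adj) (use C comps_subset in auto)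
    moreover have "connected_in (insert v A) u w"
      by (rule connected_mono[of A]) (use C comps_connected in auto)
    ultimately show ?thesis by (rule connected_trans)
  qed simp
  note vD = this
  show "connected_in (insert v A) u w"
    if C: "C \<in> (comps A - adj_comps v A) \<union> {?D}" and u: "u \<in> C" and w: "w \<in> C" for C u w
  proof (cases "C = ?D")
    case True
    then show ?thesis using connected_trans[OF connected_sym[OF vD[of u]] vD[of w]] u w by simp
  next
    case False
    then have "connected_in A u w" using C u w comps_connected[of C A u w] by blast
    then show ?thesis by (rule connected_mono[rotated]) auto
  qed
  show "w \<in> C" if C: "C \<in> (comps A - adj_comps v A) \<union> {?D}" and u: "u \<in> C" "w \<in> insert v A" "adj u w" for C u w
  proof (cases "C = ?D")
    case True
    show ?thesis
    proof (cases "w = v \<or> u = v")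
      case True
      moreover have "w \<in> \<Union> (adj_comps v A)" if "u = v" "w \<noteq> v"
        using comp_of[of w A] that u by (auto simp: adj_comps_def)
      ultimately show ?thesis using \<open>C = ?D\<close> by auto
    next
      case False
      then obtain D where "D \<in> adj_comps v A" "u \<in> D" using u \<open>C = ?D\<close> by auto
      then show ?thesis using comps_closed[of D A u w] u False \<open>C = ?D\<close> by (auto simp: adj_comps_def)
    qed
  next
    case False
    then have C: "C \<in> comps A" "\<And>x. x \<in> C \<Longrightarrow> \<not> adj v x" using C by (auto simp: adj_comps_def)
    then have "w \<noteq> v" using u adj_sym by blast
    then show ?thesis using comps_closed[OF C(1)] u by blast
  qed
qed (auto dest: comps_nonempty)

lemma ncomp_insert:
  assumes "finite A" "v \<notin> A"
  shows "ncomp (insert v A) + card (adj_comps v A) = ncomp A + 1"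
proof -
  let ?D = "insert v (\<Union> (adj_comps v A))"
  have "?D \<notin> comps A" using comps_subset assms(2) by blast
  moreover have sub: "adj_comps v A \<subseteq> comps A" by (auto simp: adj_comps_def)
  moreover have fin: "finite (comps A)" using assms by (simp add: finite_comps)
  ultimately have "ncomp (insert v A) = card (comps A - adj_comps v A) + 1"
    unfolding comps_insert[OF assms(2)] by simp
  moreover have "card (adj_comps v A) \<le> ncomp A" by (rule card_mono[OF fin sub])
  moreover have "card (comps A - adj_comps v A) = ncomp A - card (adj_comps v A)"
    by (rule card_Diff_subset[OF finite_subset[OF sub fin] sub])
  ultimately show ?thesis by simp
qed

lemma card_adj_comps_le_1:
  assumes "\<And>a b. a \<in> A \<Longrightarrow> b \<in> A \<Longrightarrow> adj v a \<Longrightarrow> adj v b \<Longrightarrow> a = b \<or> adj a b"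
  shows "card (adj_comps v A) \<le> 1"
proof -
  have "C = D" if C: "C \<in> adj_comps v A" "D \<in> adj_comps v A" for C D
  proof -
    obtain a b where ab: "a \<in> C" "adj v a" "b \<in> D" "adj v b" "C \<in> comps A" "D \<in> comps A"
      using C by (auto simp: adj_comps_def)
    then have "a \<in> A" "b \<in> A" using comps_subset by blast+
    then have "b \<in> C" using assms[of a b] ab comps_closed[of C A a b] by blast
    then show ?thesis using comps_disjoint ab by blast
  qed
  then have "adj_comps v A = {} \<or> (\<exists>C. adj_comps v A = {C})" by blast
  then show ?thesis by auto
qed

section \<open>The maximum of card U + ncomp U\<close>

text \<open>The dimension of \<open>S\<close> modulo the kernel of the substitution attached to \<open>U\<close>: one scalar for each
  vertex of \<open>U\<close> and one ratio for each component.\<close>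

definition prime_dim :: "'v set \<Rightarrow> nat" where
  "prime_dim U = card U + ncomp U"

definition max_prime_dim :: "'v set \<Rightarrow> nat" where
  "max_prime_dim A = Max (prime_dim ` Pow A)"

definition gain :: "'v set \<Rightarrow> nat" where
  "gain A = max_prime_dim A - prime_dim A"

lemma prime_dim_le_max_prime_dim: "finite A \<Longrightarrow> U \<subseteq> A \<Longrightarrow> prime_dim U \<le> max_prime_dim A"
  unfolding max_prime_dim_def by (rule Max_ge) auto

lemma max_prime_dim_attained: "finite A \<Longrightarrow> \<exists>U\<subseteq>A. prime_dim U = max_prime_dim A"
proof -
  assume "finite A"
  then have "max_prime_dim A \<in> prime_dim ` Pow A" unfolding max_prime_dim_def by (intro Max_in) auto
  then show ?thesis by auto
qed

lemma max_prime_dim_leI: "finite A \<Longrightarrow> (\<And>U. U \<subseteq> A \<Longrightarrow> prime_dim U \<le> n) \<Longrightarrow> max_prime_dim A \<le> n"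
  using max_prime_dim_attained by metis

lemma max_prime_dim_eq_gain: "finite A \<Longrightarrow> max_prime_dim A = prime_dim A + gain A"
  using prime_dim_le_max_prime_dim[of A A] by (simp add: gain_def)

text \<open>Adding \<open>v\<close> pays unless \<open>v\<close> is adjacent to more than two components of \<open>U\<close>.\<close>

lemma prime_dim_insert: "finite U \<Longrightarrow> v \<notin> U \<Longrightarrow> prime_dim (insert v U) + card (adj_comps v U) = prime_dim U + 2"
  using ncomp_insert[of U v] by (simp add: prime_dim_def)

definition simplicial :: "'v set \<Rightarrow> 'v \<Rightarrow> bool" where
  "simplicial A v \<longleftrightarrow> (\<forall>a\<in>A. \<forall>b\<in>A. adj v a \<longrightarrow> adj v b \<longrightarrow> a = b \<or> adj a b)"

lemma simplicial_subset: "simplicial A v \<Longrightarrow> B \<subseteq> A \<Longrightarrow> simplicial B v"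
  by (auto simp: simplicial_def)

text \<open>The neighbours of \<open>v\<close> in \<open>U\<close> form a clique and hence meet at most one component.\<close>

lemma prime_dim_insert_simplicial:
  assumes "finite A" "U \<subseteq> A" "simplicial A v"
  shows "prime_dim U \<le> prime_dim (insert v U)"
proof (cases "v \<in> U")
  case False
  have "card (adj_comps v U) \<le> 1"
    by (rule card_adj_comps_le_1) (use simplicial_subset[OF assms(3,2)] in \<open>auto simp: simplicial_def\<close>)
  then show ?thesis using prime_dim_insert[of U v] False assms finite_subset by fastforce
qed (simp add: insert_absorb)

text \<open>Every \<open>U\<close> can be enlarged to \<open>A\<close> one vertex at a time without a decrease.\<close>

lemma gain_simplicial:
  assumes "finite A" "\<And>v. v \<in> A \<Longrightarrow> simplicial A v"
  shows "gain A = 0"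
proof -
  have "prime_dim U \<le> prime_dim (U \<union> B)" if "finite B" "B \<subseteq> A" "U \<subseteq> A" for U B
    using that
  proof (induction B rule: finite_induct)
    case (insert b B)
    have "prime_dim (U \<union> B) \<le> prime_dim (insert b (U \<union> B))"
      by (rule prime_dim_insert_simplicial[OF assms(1)]) (use insert assms in auto)
    then show ?case using insert by simp
  qed simp
  from this[of A] have "prime_dim U \<le> prime_dim A" if "U \<subseteq> A" for U
    using that assms by (metis Un_absorb1 order_refl)
  then have "max_prime_dim A \<le> prime_dim A" using max_prime_dim_leI assms by blast
  then show ?thesis by (simp add: gain_def)
qed

lemma prime_dim_disjoint_Un:
  assumes "finite A" "finite B" "A \<inter> B = {}" "\<And>a b. a \<in> A \<Longrightarrow> b \<in> B \<Longrightarrow> \<not> adj a b"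
  shows "prime_dim (A \<union> B) = prime_dim A + prime_dim B"
  using ncomp_disjoint_Un[OF assms] assms by (simp add: prime_dim_def card_Un_disjoint)

lemma max_prime_dim_disjoint_Un:
  assumes "finite A" "finite B" "A \<inter> B = {}" "\<And>a b. a \<in> A \<Longrightarrow> b \<in> B \<Longrightarrow> \<not> adj a b"
  shows "max_prime_dim (A \<union> B) = max_prime_dim A + max_prime_dim B"
proof (rule antisym)
  show "max_prime_dim (A \<union> B) \<le> max_prime_dim A + max_prime_dim B"
  proof (rule max_prime_dim_leI)
    fix U assume U: "U \<subseteq> A \<union> B"
    have "prime_dim ((U \<inter> A) \<union> (U \<inter> B)) = prime_dim (U \<inter> A) + prime_dim (U \<inter> B)"
      by (rule prime_dim_disjoint_Un) (use assms in auto)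
    also have "(U \<inter> A) \<union> (U \<inter> B) = U" using U by blast
    finally show "prime_dim U \<le> max_prime_dim A + max_prime_dim B"
      using prime_dim_le_max_prime_dim[of A "U \<inter> A"] prime_dim_le_max_prime_dim[of B "U \<inter> B"] assms by simp
  qed (use assms in simp)
  obtain U W where UW: "U \<subseteq> A" "prime_dim U = max_prime_dim A" "W \<subseteq> B" "prime_dim W = max_prime_dim B"
    using max_prime_dim_attained assms by metis
  have "prime_dim (U \<union> W) = prime_dim U + prime_dim W"
    by (rule prime_dim_disjoint_Un) (use assms UW finite_subset in blast)+
  then show "max_prime_dim A + max_prime_dim B \<le> max_prime_dim (A \<union> B)"
    using prime_dim_le_max_prime_dim[of "A \<union> B" "U \<union> W"] UW assms by (simp add: le_supI1 le_supI2)
qed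

lemma gain_disjoint_Un:
  assumes "finite A" "finite B" "A \<inter> B = {}" "\<And>a b. a \<in> A \<Longrightarrow> b \<in> B \<Longrightarrow> \<not> adj a b"
  shows "gain (A \<union> B) = gain A + gain B"
  using max_prime_dim_disjoint_Un[OF assms] prime_dim_disjoint_Un[OF assms] max_prime_dim_eq_gain[of A]
    max_prime_dim_eq_gain[of B] max_prime_dim_eq_gain[of "A \<union> B"] assms(1,2) by simp

lemma gain_comps:
  assumes "finite A"
  shows "gain A = (\<Sum>C\<in>comps A. gain C)"
proof -
  have "gain (\<Union>\<C>) = (\<Sum>C\<in>\<C>. gain C)" if "finite \<C>" "\<C> \<subseteq> comps A" for \<C>
    using that
  proof (induction \<C> rule: finite_induct)
    case empty
    show ?case using gain_simplicial[of "{}"] by simp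
  next
    case (insert C \<C>)
    have "gain (C \<union> \<Union>\<C>) = gain C + gain (\<Union>\<C>)"
    proof (rule gain_disjoint_Un)
      show "finite C" "finite (\<Union>\<C>)"
        using insert.prems comps_subset[of _ A] by (auto intro!: finite_subset[OF _ assms])
      show "C \<inter> \<Union>\<C> = {}" using insert.hyps insert.prems comps_disjoint[of C A] by blast
      show "\<not> adj a b" if ab: "a \<in> C" "b \<in> \<Union>\<C>" for a b
      proof
        assume "adj a b"
        obtain D where D: "D \<in> \<C>" "b \<in> D" using ab by blast
        then have "b \<in> C" using comps_closed[of C A a b] comps_subset[of D A] \<open>adj a b\<close> ab insert.prems by blast
        then have "C = D" using comps_disjoint[of C A D b] D insert.prems by blast
        then show False using D insert.hyps by blast
      qed
    qed
    then show ?case using insert by simp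
  qed
  from this[of "comps A"] show ?thesis using finite_comps assms Union_comps by simp
qed

lemma prime_dim_wedge:
  assumes fin: "finite U" "finite W" and v: "U \<inter> W = {v}"
    and no: "\<And>a b. a \<in> U - {v} \<Longrightarrow> b \<in> W - {v} \<Longrightarrow> \<not> adj a b"
  shows "prime_dim (U \<union> W) + 2 = prime_dim U + prime_dim W" "ncomp (U \<union> W) + 1 = ncomp U + ncomp W"
proof -
  let ?U = "U - {v}" and ?W = "W - {v}"
  have comps: "comps (?U \<union> ?W) = comps ?U \<union> comps ?W"
    by (rule comps_disjoint_Un) (rule no)
  have disj: "comps ?U \<inter> comps ?W = {}"
    using v comps_subset comps_nonempty by blast
  have "adj_comps v (?U \<union> ?W) = adj_comps v ?U \<union> adj_comps v ?W"
    "adj_comps v ?U \<inter> adj_comps v ?W = {}"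
    using disj by (auto simp: adj_comps_def comps)
  then have k: "card (adj_comps v (?U \<union> ?W)) = card (adj_comps v ?U) + card (adj_comps v ?W)"
    using fin finite_comps by (simp add: card_Un_disjoint adj_comps_def)
  have n: "ncomp (?U \<union> ?W) = ncomp ?U + ncomp ?W"
    unfolding comps using disj fin by (intro card_Un_disjoint finite_comps) auto
  have ins: "insert v ?U = U" "insert v ?W = W" "insert v (?U \<union> ?W) = U \<union> W"
    using v by auto
  show *: "ncomp (U \<union> W) + 1 = ncomp U + ncomp W"
    using ncomp_insert[of ?U v] ncomp_insert[of ?W v] ncomp_insert[of "?U \<union> ?W" v] k n fin
    unfolding ins by simp
  have "card (U \<union> W) + 1 = card U + card W"
    using card_Un_Int[OF fin] v by simp
  then show "prime_dim (U \<union> W) + 2 = prime_dim U + prime_dim W" using * by (simp add: prime_dim_def)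
qed

lemma max_prime_dim_at_simplicial:
  assumes "finite A" "v \<in> A" "simplicial A v"
  obtains U where "U \<subseteq> A" "v \<in> U" "prime_dim U = max_prime_dim A"
proof -
  obtain U where U: "U \<subseteq> A" "prime_dim U = max_prime_dim A" using max_prime_dim_attained assms by metis
  have "prime_dim (insert v U) = max_prime_dim A"
    using prime_dim_insert_simplicial[OF assms(1) U(1) assms(3)] prime_dim_le_max_prime_dim[OF assms(1), of "insert v U"]
      U assms by simp
  then show ?thesis using that[of "insert v U"] U assms by auto
qed

text \<open>The vertex \<open>v\<close> is adjacent to at most one component of \<open>U\<close> on each side, that is, to at most two.
  So an optimal \<open>U\<close> may be taken to contain \<open>v\<close>, and it then consists of two sets that overlap in \<open>v\<close>
  only.\<close>

lemma max_prime_dim_wedge: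
  assumes fin: "finite A" "finite B" and v: "A \<inter> B = {v}"
    and no: "\<And>a b. a \<in> A - {v} \<Longrightarrow> b \<in> B - {v} \<Longrightarrow> \<not> adj a b"
    and simp: "simplicial A v" "simplicial B v"
  shows "max_prime_dim (A \<union> B) + 2 = max_prime_dim A + max_prime_dim B"
proof (rule antisym)
  have wedge: "prime_dim (U \<union> W) + 2 = prime_dim U + prime_dim W" if "U \<subseteq> A" "W \<subseteq> B" "v \<in> U" "v \<in> W" for U W
    by (rule prime_dim_wedge(1)) (use that fin v no finite_subset in blast)+
  have vAB: "v \<in> A" "v \<in> B" using v by auto
  obtain U where U: "U \<subseteq> A \<union> B" "prime_dim U = max_prime_dim (A \<union> B)" using max_prime_dim_attained fin by (metis finite_UnI)
  have "prime_dim U \<le> prime_dim (insert v U)"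
  proof (cases "v \<in> U")
    case False
    have "adj_comps v U \<subseteq> adj_comps v (U \<inter> A) \<union> adj_comps v (U \<inter> B)"
    proof -
      have "comps ((U \<inter> A) \<union> (U \<inter> B)) = comps (U \<inter> A) \<union> comps (U \<inter> B)"
        by (rule comps_disjoint_Un) (use False no in auto)
      also have "(U \<inter> A) \<union> (U \<inter> B) = U" using U by blast
      finally show ?thesis by (auto simp: adj_comps_def)
    qed
    then have "card (adj_comps v U) \<le> card (adj_comps v (U \<inter> A) \<union> adj_comps v (U \<inter> B))"
      by (rule card_mono[rotated]) (simp add: adj_comps_def finite_comps fin)
    also have "\<dots> \<le> card (adj_comps v (U \<inter> A)) + card (adj_comps v (U \<inter> B))" by (rule card_Un_le)
    also have "\<dots> \<le> 1 + 1"
      by (intro add_mono card_adj_comps_le_1) (use simp in \<open>auto simp: simplicial_def\<close>)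
    finally show ?thesis using prime_dim_insert[of U v] False U fin finite_subset by fastforce
  qed (simp add: insert_absorb)
  moreover have "insert v U = insert v (U \<inter> A) \<union> insert v (U \<inter> B)" using U by blast
  ultimately have "max_prime_dim (A \<union> B) + 2 \<le> prime_dim (insert v (U \<inter> A)) + prime_dim (insert v (U \<inter> B))"
    using wedge[of "insert v (U \<inter> A)" "insert v (U \<inter> B)"] U vAB by auto
  also have "\<dots> \<le> max_prime_dim A + max_prime_dim B"
    by (intro add_mono prime_dim_le_max_prime_dim) (use fin v in auto)
  finally show "max_prime_dim (A \<union> B) + 2 \<le> max_prime_dim A + max_prime_dim B" .
  obtain U1 where U1: "U1 \<subseteq> A" "v \<in> U1" "prime_dim U1 = max_prime_dim A"
    using max_prime_dim_at_simplicial[OF fin(1) _ simp(1)] v by blast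
  obtain U2 where U2: "U2 \<subseteq> B" "v \<in> U2" "prime_dim U2 = max_prime_dim B"
    using max_prime_dim_at_simplicial[OF fin(2) _ simp(2)] v by blast
  have "max_prime_dim A + max_prime_dim B = prime_dim (U1 \<union> U2) + 2" using wedge U1 U2 by simp
  also have "\<dots> \<le> max_prime_dim (A \<union> B) + 2" using U1 U2 fin by (intro add_right_mono prime_dim_le_max_prime_dim) auto
  finally show "max_prime_dim A + max_prime_dim B \<le> max_prime_dim (A \<union> B) + 2" .
qed

lemma gain_wedge:
  assumes "finite A" "finite B" "A \<inter> B = {v}"
    and "\<And>a b. a \<in> A - {v} \<Longrightarrow> b \<in> B - {v} \<Longrightarrow> \<not> adj a b"
    and "simplicial A v" "simplicial B v"
  shows "gain (A \<union> B) = gain A + gain B"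
  using max_prime_dim_wedge[OF assms] prime_dim_wedge(1)[OF assms(1-4)] max_prime_dim_eq_gain[of A] max_prime_dim_eq_gain[of B]
    max_prime_dim_eq_gain[of "A \<union> B"] assms by simp

end

section \<open>Krull dimension of binomial edge ideals\<close>

text \<open>Any linear order on the variables would do; it only serves to show that kernels of substitutions
  are prime.\<close>

instantiation bvar :: (linorder) linorder
begin

fun less_eq_bvar :: "'a bvar \<Rightarrow> 'a bvar \<Rightarrow> bool" where
  "X i \<le> X j \<longleftrightarrow> i \<le> j"
| "Y i \<le> Y j \<longleftrightarrow> i \<le> j"
| "X i \<le> Y j \<longleftrightarrow> True"
| "Y i \<le> X j \<longleftrightarrow> False"

definition less_bvar :: "'a bvar \<Rightarrow> 'a bvar \<Rightarrow> bool" where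
  "less_bvar a b \<longleftrightarrow> a \<le> b \<and> \<not> b \<le> a"

instance
proof
  fix a b c :: "'a bvar"
  show "a \<le> a" by (cases a) auto
  show "a \<le> b \<or> b \<le> a" by (cases a; cases b) auto
  show "a \<le> b \<Longrightarrow> b \<le> a \<Longrightarrow> a = b" by (cases a; cases b) auto
  show "a \<le> b \<Longrightarrow> b \<le> c \<Longrightarrow> a \<le> c" by (cases a; cases b; cases c) auto
qed (simp add: less_bvar_def)

end

abbreviation bvars :: "'v ugraph \<Rightarrow> 'v bvar set" where
  "bvars G \<equiv> X ` verts G \<union> Y ` verts G"

abbreviation minor :: "'v \<Rightarrow> 'v \<Rightarrow> ('v bvar, 'k::field) mpoly" where
  "minor i j \<equiv> pvar (X i) * pvar (Y j) - pvar (X j) * pvar (Y i)"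

lemma binomial_edge_ideal_subset_iff:
  assumes G: "simple_graph (G :: 'v::linorder ugraph)"
    and P: "primeideal P (edge_poly_ring G :: ('v bvar, 'k::field) mpoly ring)"
  shows "binomial_edge_ideal G \<subseteq> P \<longleftrightarrow> (\<forall>i j. {i, j} \<in> edges G \<longrightarrow> minor i j \<in> P)"
proof -
  interpret finite_graph G by unfold_locales (rule G)
  interpret cring "edge_poly_ring G :: ('v bvar, 'k) mpoly ring"
    unfolding edge_poly_ring_def by (rule cring_poly_ring)
  let ?M = "{minor i j :: ('v bvar, 'k) mpoly | i j. i < j \<and> {i, j} \<in> edges G}"
  note Pi = prime_poly_idealD[OF P[unfolded edge_poly_ring_def]]
  have M: "?M \<subseteq> carrier (edge_poly_ring G)"
    using adj_verts by (auto simp: edge_poly_ring_def carrier_poly_ring intro!: polys_diff polys_mult polys_pvar)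
  have "binomial_edge_ideal G \<subseteq> P \<longleftrightarrow> ?M \<subseteq> P"
    unfolding binomial_edge_ideal_def
    using genideal_self[OF M] genideal_minimal[OF primeideal.axioms(1)[OF P], of ?M] by blast
  also have "\<dots> \<longleftrightarrow> (\<forall>i j. {i, j} \<in> edges G \<longrightarrow> minor i j \<in> P)"
  proof
    assume sub: "?M \<subseteq> P"
    show "\<forall>i j. {i, j} \<in> edges G \<longrightarrow> minor i j \<in> P"
    proof (intro allI impI)
      fix i j assume ij: "{i, j} \<in> edges G"
      then have "i \<noteq> j" using adj_verts by blast
      then consider "i < j" | "j < i" by fastforce
      then show "minor i j \<in> P"
      proof cases
        case 2
        then have "minor j i \<in> P" using ij sub adj_sym by blast
        then have "0 - minor j i \<in> P" using Pi(2,4) by blast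
        then show ?thesis by simp
      qed (use ij sub in blast)
    qed
  qed blast
  finally show ?thesis .
qed

lemma ideal_binomial_edge_ideal:
  assumes "simple_graph (G :: 'v::linorder ugraph)"
  shows "ideal (binomial_edge_ideal G) (edge_poly_ring G :: ('v bvar, 'k::field) mpoly ring)"
proof -
  interpret finite_graph G by unfold_locales (rule assms)
  interpret cring "edge_poly_ring G :: ('v bvar, 'k) mpoly ring"
    unfolding edge_poly_ring_def by (rule cring_poly_ring)
  show ?thesis
    unfolding binomial_edge_ideal_def
    by (rule genideal_ideal)
      (use adj_verts in \<open>auto simp: edge_poly_ring_def carrier_poly_ring intro!: polys_diff polys_mult polys_pvar\<close>)
qed

context finite_graph
begin

text \<open>A representative vertex of the component of \<open>i\<close>, so that components can index variables.\<close>

definition rep :: "'v set \<Rightarrow> 'v \<Rightarrow> 'v" where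
  "rep U i = (SOME j. j \<in> U \<and> connected_in U i j)"

lemma rep: "i \<in> U \<Longrightarrow> rep U i \<in> U \<and> connected_in U i (rep U i)"
  unfolding rep_def by (rule someI[of _ i]) simp

lemma rep_eq_iff:
  assumes "i \<in> U" "j \<in> U"
  shows "rep U i = rep U j \<longleftrightarrow> connected_in U i j"
proof
  assume "rep U i = rep U j"
  then show "connected_in U i j"
    using rep[OF assms(1)] rep[OF assms(2)] connected_trans[of U i "rep U i" j] connected_sym[of U j "rep U i"]
    by simp
next
  assume ij: "connected_in U i j"
  have "connected_in U i k \<longleftrightarrow> connected_in U j k" for k
    using connected_trans[OF ij, of k] connected_trans[OF connected_sym[OF ij], of k] by blast
  then show "rep U i = rep U j" by (simp add: rep_def)
qed

lemma card_rep: "card (rep U ` U) = ncomp U"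
proof -
  let ?cl = "\<lambda>i. {u \<in> U. connected_in U i u}"
  have "bij_betw ?cl (rep U ` U) (comps U)"
    unfolding bij_betw_def
  proof
    show "inj_on ?cl (rep U ` U)"
    proof (rule inj_onI)
      fix a b assume "a \<in> rep U ` U" "b \<in> rep U ` U" and eq: "?cl a = ?cl b"
      then obtain i j where ij: "i \<in> U" "a = rep U i" "j \<in> U" "b = rep U j" by blast
      have ra: "a \<in> U" "connected_in U i a" and rb: "b \<in> U" "connected_in U j b" using rep ij by auto
      have "b \<in> ?cl a" unfolding eq using rb by simp
      then have "connected_in U i b" using connected_trans[OF ra(2)] by simp
      then have "connected_in U i j" using connected_trans[OF _ connected_sym[OF rb(2)]] by blast
      then show "a = b" using rep_eq_iff ij by simp
    qed
    have cl: "?cl (rep U i) = ?cl i" if "i \<in> U" for i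
    proof -
      have ii: "connected_in U i (rep U i)" using rep[OF that] by simp
      have "connected_in U i k \<longleftrightarrow> connected_in U (rep U i) k" for k
        using connected_trans[OF ii, of k] connected_trans[OF connected_sym[OF ii], of k] by blast
      then show ?thesis by simp
    qed
    have "?cl ` rep U ` U = (\<lambda>i. ?cl (rep U i)) ` U" by (rule image_image)
    also have "\<dots> = ?cl ` U" by (rule image_cong) (simp_all only: cl)
    finally show "?cl ` rep U ` U = comps U" by (simp add: comps_def)
  qed
  then show ?thesis by (rule bij_betw_same_card)
qed

end

text \<open>The target ring \<open>K[s\<^sub>i, t\<^sub>c]\<close> is written in the variables of \<open>S\<close> itself: \<open>X i\<close> is \<open>s\<^sub>i\<close>, and \<open>Y c\<close> is
  \<open>t\<^sub>c\<close> for a component represented by the vertex \<open>c = r i\<close>. So \<open>x\<^sub>i\<close> goes to \<open>s\<^sub>i\<close> and \<open>y\<^sub>i\<close> to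
  \<open>s\<^sub>i t\<^bsub>r i\<^esub>\<close>. The set \<open>B\<close> below holds the target variables that have not been killed.\<close>

definition var_monom :: "('v \<Rightarrow> 'v) \<Rightarrow> 'v bvar \<Rightarrow> ('v bvar \<Rightarrow>\<^sub>0 nat)" where
  "var_monom r x = (case x of X i \<Rightarrow> single (X i) 1
    | Y i \<Rightarrow> single (X i) 1 + single (Y (r i)) 1)"

definition param :: "('v \<Rightarrow> 'v) \<Rightarrow> 'v bvar set \<Rightarrow> 'v bvar \<Rightarrow> ('v bvar, 'k::field) mpoly" where
  "param r B x = (if keys (var_monom r x) \<subseteq> B then single (var_monom r x) 1 else 0)"

lemma keys_var_monom:
  "keys (var_monom r (X i)) = {X i}" "keys (var_monom r (Y i)) = {X i, Y (r i)}"
  by (auto simp: var_monom_def keys_monomial_add)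

lemma keys_var_monom_nonempty: "keys (var_monom r x) \<noteq> {}"
  by (cases x) (simp_all only: keys_var_monom insert_not_empty not_False_eq_True)

lemma param_X: "param r B (X i) = (if X i \<in> B then pvar (X i) else 0)"
  and param_Y: "param r B (Y i) = (if X i \<in> B \<and> Y (r i) \<in> B then pvar (X i) * pvar (Y (r i)) else 0)"
  by (simp_all add: param_def keys_var_monom) (simp_all add: var_monom_def pvar_def mult_single)

lemma param_in_polys: "param r B x \<in> polys B"
  by (auto simp: param_def polys_0 intro: polys_single)


definition image_monom :: "('v \<Rightarrow> 'v) \<Rightarrow> ('v bvar \<Rightarrow>\<^sub>0 nat) \<Rightarrow> ('v bvar \<Rightarrow>\<^sub>0 nat)" where
  "image_monom r m = (\<Sum>x\<in>keys m. \<Sum>_<lookup m x. var_monom r x)"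

lemma lookup_image_monom:
  assumes "finite A" "keys m \<subseteq> A"
  shows "lookup (image_monom r m) z =
    (\<Sum>x\<in>A. lookup m x * lookup (var_monom r x) z)"
proof -
  have "lookup (image_monom r m) z =
    (\<Sum>x\<in>keys m. lookup m x * lookup (var_monom r x) z)"
    by (simp add: image_monom_def lookup_sum)
  also have "\<dots> = (\<Sum>x\<in>A. lookup m x * lookup (var_monom r x) z)"
    by (rule sum.mono_neutral_left) (use assms in \<open>auto simp: in_keys_iff\<close>)
  finally show ?thesis .
qed

lemma image_monom_add: "image_monom r (m + n) = image_monom r m + image_monom r n"
proof (rule poly_mapping_eqI)
  fix z
  let ?A = "keys m \<union> keys n"
  show "lookup (image_monom r (m + n)) z = lookup (image_monom r m + image_monom r n) z"
    by (simp add: lookup_add lookup_image_monom[of ?A] keys_monomial_add distrib_right sum.distrib)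
qed

lemma image_monom_single: "image_monom r (single x 1) = var_monom r x"
  by (simp add: image_monom_def)

lemma keys_image_monom:
  "keys (image_monom r m) = (\<Union>x\<in>keys m. keys (var_monom r x))"
proof (rule Set.set_eqI)
  fix z
  have "z \<in> keys (image_monom r m) \<longleftrightarrow>
    (\<exists>x\<in>keys m. lookup m x * lookup (var_monom r x) z \<noteq> 0)"
    unfolding in_keys_iff[of z] lookup_image_monom[OF finite_keys order_refl] by simp
  also have "\<dots> \<longleftrightarrow> z \<in> (\<Union>x\<in>keys m. keys (var_monom r x))"
    unfolding UN_iff by (rule bex_cong[OF refl]) (simp add: in_keys_iff)
  finally show "z \<in> keys (image_monom r m) \<longleftrightarrow>
    z \<in> (\<Union>x\<in>keys m. keys (var_monom r x))" .
qed

definition total_degree :: "('x \<Rightarrow>\<^sub>0 nat) \<Rightarrow> nat" where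
  "total_degree m = (\<Sum>x\<in>keys m. lookup m x)"

lemma total_degree_add: "total_degree (m + n) = total_degree m + total_degree n"
proof -
  let ?A = "keys m \<union> keys n"
  have "total_degree k = (\<Sum>x\<in>?A. lookup k x)" if "keys k \<subseteq> ?A" for k
    unfolding total_degree_def by (rule sum.mono_neutral_left) (use that in \<open>auto simp: in_keys_iff\<close>)
  then show ?thesis by (simp add: keys_monomial_add lookup_add sum.distrib)
qed

lemma total_degree_single: "total_degree (single x 1) = 1"
  by (simp add: total_degree_def)

lemma monomial_remove_var:
  assumes "x \<in> keys (m :: 'x \<Rightarrow>\<^sub>0 nat)"
  obtains n where "m = single x 1 + n" "keys n \<subseteq> keys m"
    "\<And>y. y \<in> keys m \<Longrightarrow> y \<noteq> x \<Longrightarrow> y \<in> keys n"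
proof
  let ?n = "m - single x 1"
  show eq: "m = single x 1 + ?n"
  proof (rule poly_mapping_eqI)
    fix y
    show "lookup m y = lookup (single x 1 + ?n) y"
      using assms by (cases "y = x") (auto simp: lookup_add lookup_minus lookup_single in_keys_iff)
  qed
  then show "keys ?n \<subseteq> keys m"
    using keys_monomial_add by (metis Un_upper2)
  show "y \<in> keys ?n" if "y \<in> keys m" "y \<noteq> x" for y
    using that by (auto simp: lookup_minus lookup_single in_keys_iff)
qed

abbreviation monomial :: "('x \<Rightarrow>\<^sub>0 nat) \<Rightarrow> ('x, 'k::zero_neq_one) mpoly" where
  "monomial m \<equiv> single m 1"

lemma monomial_add: "monomial (m + n) = monomial m * (monomial n :: ('x, 'k::comm_ring_1) mpoly)"
  by (simp add: mult_single)

lemma monomial_var_add: "monomial (single x 1 + n) = pvar x * (monomial n :: ('x, 'k::comm_ring_1) mpoly)"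
  by (simp add: mult_single pvar_def)

lemma monomial_sum: "finite A \<Longrightarrow> monomial (\<Sum>x\<in>A. f x) = (\<Prod>x\<in>A. monomial (f x) :: ('x, 'k::comm_ring_1) mpoly)"
  by (induction A rule: finite_induct) (simp_all add: monomial_add)

lemma monomial_image_monom:
  "monomial (image_monom r m) = (\<Prod>x\<in>keys m. monomial (var_monom r x) ^ lookup m x
    :: ('v bvar, 'k::comm_ring_1) mpoly)"
  by (simp only: image_monom_def monomial_sum finite_keys finite_lessThan prod_constant card_lessThan)

text \<open>Modulo \<open>P\<close>, proportionality of vectors is transitive across a nonzero vector, here the one of
  \<open>x\<close>.\<close>

lemma minor_path:
  fixes P :: "('v::linorder bvar, 'k::field) mpoly set"
  assumes P: "primeideal P (poly_ring A)" and A: "\<And>k. k \<in> {i, x, y} \<Longrightarrow> X k \<in> A \<and> Y k \<in> A"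
    and ix: "minor i x \<in> P" and xy: "minor x y \<in> P" and x: "\<not> (pvar (X x) \<in> P \<and> pvar (Y x) \<in> P)"
  shows "minor i y \<in> P"
proof -
  note Pi = prime_poly_idealD[OF P]
  have pA: "pvar (X k) \<in> polys A" "pvar (Y k) \<in> polys A" if "k \<in> {i, x, y}" for k
    using A[OF that] by (auto intro: polys_pvar)
  have m: "minor i y \<in> polys A" by (intro polys_diff polys_mult pA) auto
  have X: "pvar (X x) * minor i y = minor i x * pvar (X y) + minor x y * pvar (X i)"
    by (simp add: algebra_simps)
  have 1: "pvar (X x) * minor i y \<in> P" unfolding X by (intro Pi(3) Pi(6) ix xy pA) auto
  have Y: "pvar (Y x) * minor i y = minor i x * pvar (Y y) + minor x y * pvar (Y i)"
    by (simp add: algebra_simps)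
  have 2: "pvar (Y x) * minor i y \<in> P" unfolding Y by (intro Pi(3) Pi(6) ix xy pA) auto
  show ?thesis using Pi(7)[OF 1] Pi(7)[OF 2] m pA x by auto
qed

text \<open>Modulo \<open>P\<close> a factor \<open>x\<^sub>i y\<^sub>j\<close> of a monomial may be replaced by \<open>x\<^sub>j y\<^sub>i\<close> when \<open>i\<close> and \<open>j\<close> have
  the same representative. Two monomials with the same image contain a common index \<open>i\<close>. If it occurs
  as the same variable in both, that variable is cancelled. If it occurs as \<open>x\<^sub>i\<close> in the one and as
  \<open>y\<^sub>i\<close> in the other, then the former also contains some \<open>y\<^sub>j\<close> with \<open>r j = r i\<close>, because both have
  the same degree in \<open>t\<^bsub>r i\<^esub>\<close>, and a swap makes \<open>y\<^sub>i\<close> common to both.\<close>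

lemma monomial_congruence:
  fixes P :: "('v::linorder bvar, 'k::field) mpoly set"
  assumes P: "primeideal P (poly_ring A)" and UA: "X ` U \<union> Y ` U \<subseteq> A"
    and swap: "\<And>i j. i \<in> U \<Longrightarrow> j \<in> U \<Longrightarrow> r i = r j \<Longrightarrow> minor i j \<in> P"
    and m: "keys m \<subseteq> X ` U \<union> Y ` U" "keys m' \<subseteq> X ` U \<union> Y ` U"
    and eq: "image_monom r m = image_monom r m'"
  shows "monomial m - monomial m' \<in> P"
  using m eq
proof (induction "total_degree m" arbitrary: m m' rule: less_induct)
  case less
  note Pi = prime_poly_idealD[OF P]
  have mon: "monomial n \<in> polys A" if "keys n \<subseteq> X ` U \<union> Y ` U" for n
    using that UA by (intro polys_single) blast
  have cancel: "monomial (single x 1 + n) - monomial (single x 1 + n') \<in> P"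
    if "x \<in> X ` U \<union> Y ` U" "total_degree n < total_degree m" "keys n \<subseteq> X ` U \<union> Y ` U"
      "keys n' \<subseteq> X ` U \<union> Y ` U"
      "image_monom r (single x 1 + n) = image_monom r (single x 1 + n')" for x n n'
  proof -
    have "image_monom r n = image_monom r n'" using that(5) by (simp add: image_monom_add)
    then have "monomial n - monomial n' \<in> P" using less.hyps that by blast
    then have "pvar x * (monomial n - monomial n') \<in> P"
      by (rule Pi(5)) (use that UA in \<open>auto intro: polys_pvar\<close>)
    then show ?thesis by (simp only: monomial_var_add right_diff_distrib)
  qed
  show ?case
  proof (cases "m = 0")
    case True
    then have "keys (image_monom r m') = {}"
      using less.prems(3) by (metis keys_image_monom keys_zero UN_empty)
    then have "keys m' = {}"
      unfolding keys_image_monom using keys_var_monom_nonempty by blast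
    then have "m' = 0" by simp
    then show ?thesis using True Pi(2) by simp
  next
    case False
    then obtain z where z: "z \<in> keys m" by fastforce
    have keys: "(\<Union>x\<in>keys m. keys (var_monom r x)) =
      (\<Union>x\<in>keys m'. keys (var_monom r x))"
      using less.prems(3) by (metis keys_image_monom)
    obtain i where i: "i \<in> U" "z = X i \<or> z = Y i" using z less.prems(1) by blast
    then have "X i \<in> keys (var_monom r z)" by (auto simp: keys_var_monom)
    then obtain x where x: "x \<in> keys m'" "X i \<in> keys (var_monom r x)"
      using keys z by blast
    have xi: "x = X i \<or> x = Y i" using x(2) by (cases x) (auto simp: keys_var_monom)
    have xU: "X k \<in> X ` U \<union> Y ` U" "Y k \<in> X ` U \<union> Y ` U" if "k \<in> U" for k using that by auto
    obtain n where n: "m = single z 1 + n" "keys n \<subseteq> keys m"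
      "\<And>y. y \<in> keys m \<Longrightarrow> y \<noteq> z \<Longrightarrow> y \<in> keys n"
      by (rule monomial_remove_var[OF z]) blast
    obtain n' where n': "m' = single x 1 + n'" "keys n' \<subseteq> keys m'"
      "\<And>y. y \<in> keys m' \<Longrightarrow> y \<noteq> x \<Longrightarrow> y \<in> keys n'"
      by (rule monomial_remove_var[OF x(1)]) blast
    have tn: "total_degree n < total_degree m" unfolding n(1) total_degree_add total_degree_single by simp
    have swapped: "monomial (single (X a) 1 + (single (Y b) 1 + k))
        - monomial (single (Y a) 1 + (single (X b) 1 + k)) \<in> P"
      "image_monom r (single (X a) 1 + (single (Y b) 1 + k))
        = image_monom r (single (Y a) 1 + (single (X b) 1 + k))"
      if ab: "a \<in> U" "b \<in> U" "r a = r b" "keys k \<subseteq> X ` U \<union> Y ` U" for a b k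
    proof -
      have "minor a b * monomial k \<in> P" using Pi(6)[OF swap[OF ab(1-3)] mon[OF ab(4)]] .
      then show "monomial (single (X a) 1 + (single (Y b) 1 + k))
        - monomial (single (Y a) 1 + (single (X b) 1 + k)) \<in> P"
        by (simp only: monomial_var_add) (simp add: algebra_simps)
      show "image_monom r (single (X a) 1 + (single (Y b) 1 + k))
        = image_monom r (single (Y a) 1 + (single (X b) 1 + k))"
        by (simp only: image_monom_add image_monom_single var_monom_def bvar.case ab(3) add_ac)
    qed
    consider "x = z" | "z = X i" "x = Y i" | "z = Y i" "x = X i" using i xi by blast
    then show ?thesis
    proof cases
      case 1
      show ?thesis unfolding n(1) n'(1) 1
        by (rule cancel) (use z n n' tn less.prems 1 in auto)
    next
      case 2
      have "Y (r i) \<in> keys (var_monom r x)" by (simp add: 2 keys_var_monom)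
      then obtain y where y: "y \<in> keys m" "Y (r i) \<in> keys (var_monom r y)"
        using keys x(1) by blast
      then obtain j where j: "y = Y j" "r j = r i" by (cases y) (auto simp: keys_var_monom)
      have jU: "j \<in> U" using y(1) less.prems(1) j by auto
      have "y \<in> keys n" using n(3)[OF y(1)] j 2 by simp
      then obtain k where k: "n = single y 1 + k" "keys k \<subseteq> keys n"
        using monomial_remove_var by metis
      have kU: "keys k \<subseteq> X ` U \<union> Y ` U" using k n less.prems(1) by blast
      let ?m = "single (Y i) 1 + (single (X j) 1 + k)"
      have m_eq: "m = single (X i) 1 + (single (Y j) 1 + k)"
        unfolding n(1) k(1) 2 j ..
      note sw = swapped[OF i(1) jU j(2)[symmetric] kU, folded m_eq]
      have "monomial ?m - monomial m' \<in> P"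
        unfolding n'(1) 2(2)
      proof (rule cancel)
        show "total_degree (single (X j) 1 + k) < total_degree m"
          unfolding m_eq total_degree_add total_degree_single by simp
        show "keys (single (X j) 1 + k) \<subseteq> X ` U \<union> Y ` U"
          using kU jU by (auto simp: keys_monomial_add)
        show "keys n' \<subseteq> X ` U \<union> Y ` U" using n'(2) less.prems(2) by blast
        show "image_monom r ?m = image_monom r (single (Y i) 1 + n')"
          using sw(2) less.prems(3) unfolding n'(1) 2(2) by simp
      qed (use xU i in blast)
      then have "(monomial m - monomial ?m) + (monomial ?m - monomial m') \<in> P" using Pi(3)[OF sw(1)] by blast
      then show ?thesis by simp
    next
      case 3
      have "Y (r i) \<in> keys (var_monom r z)" by (simp add: 3 keys_var_monom)
      then obtain y where y: "y \<in> keys m'" "Y (r i) \<in> keys (var_monom r y)"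
        using keys z by blast
      then obtain j where j: "y = Y j" "r j = r i" by (cases y) (auto simp: keys_var_monom)
      have jU: "j \<in> U" using y(1) less.prems(2) j by auto
      have "y \<in> keys n'" using n'(3)[OF y(1)] j 3 by simp
      then obtain k where k: "n' = single y 1 + k" "keys k \<subseteq> keys n'"
        using monomial_remove_var by metis
      have kU: "keys k \<subseteq> X ` U \<union> Y ` U" using k n' less.prems(2) by blast
      let ?m = "single (Y i) 1 + (single (X j) 1 + k)"
      have m_eq: "m' = single (X i) 1 + (single (Y j) 1 + k)"
        unfolding n'(1) k(1) 3 j ..
      note sw = swapped[OF i(1) jU j(2)[symmetric] kU, folded m_eq]
      have "monomial m - monomial ?m \<in> P"
        unfolding n(1) 3(1)
      proof (rule cancel)
        show "total_degree n < total_degree m" by (rule tn)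
        show "keys n \<subseteq> X ` U \<union> Y ` U" using n(2) less.prems(1) by blast
        show "keys (single (X j) 1 + k) \<subseteq> X ` U \<union> Y ` U"
          using kU jU by (auto simp: keys_monomial_add)
        show "image_monom r (single (Y i) 1 + n) = image_monom r ?m"
          using sw(2) less.prems(3) unfolding n(1) 3(1) by simp
      qed (use xU i in blast)
      then have "(monomial m - monomial ?m) - (monomial m' - monomial ?m) \<in> P" using Pi(4)[OF _ sw(1)] by blast
      then show ?thesis by simp
    qed
  qed
qed

lemma prime_poly_ideal_sum:
  fixes P :: "('x, 'k::field) mpoly set"
  assumes "primeideal P (poly_ring A)" "\<And>i. i \<in> I \<Longrightarrow> f i \<in> P"
  shows "(\<Sum>i\<in>I. f i) \<in> P"
  using assms(2) by (induction I rule: infinite_finite_induct)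
    (auto intro: prime_poly_idealD(2,3)[OF assms(1)])

text \<open>The monomials of \<open>p\<close> with a variable outside \<open>U\<close> lie in \<open>P\<close>. The others are grouped by their
  images: in each group the coefficients add up to zero, and the monomials are congruent modulo \<open>P\<close>.\<close>

lemma kernel_param_subset_prime:
  fixes P :: "('v::linorder bvar, 'k::field) mpoly set"
  assumes P: "primeideal P (poly_ring A)" and UA: "X ` U \<union> Y ` U \<subseteq> A"
    and swap: "\<And>i j. i \<in> U \<Longrightarrow> j \<in> U \<Longrightarrow> r i = r j \<Longrightarrow> minor i j \<in> P"
    and van: "\<And>x. x \<in> A \<Longrightarrow> x \<notin> X ` U \<union> Y ` U \<Longrightarrow> pvar x \<in> P"
    and p: "p \<in> polys A" "subst (param r (X ` U \<union> Y ` r ` U)) p = 0"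
  shows "p \<in> P"
proof -
  note Pi = prime_poly_idealD[OF P]
  let ?W = "X ` U \<union> Y ` U" and ?\<rho> = "param r (X ` U \<union> Y ` r ` U) :: 'v bvar \<Rightarrow> ('v bvar, 'k) mpoly"
  let ?c = "lookup p" and ?\<mu> = "image_monom r"
  have \<rho>: "?\<rho> x = (if x \<in> ?W then monomial (var_monom r x) else 0)" for x
    by (cases x) (auto simp: param_def keys_var_monom)
  have sm: "subst_monom ?\<rho> m = (if keys m \<subseteq> ?W then monomial (?\<mu> m) else 0)" for m
  proof (cases "keys m \<subseteq> ?W")
    case True
    have "subst_monom ?\<rho> m = (\<Prod>x\<in>keys m. monomial (var_monom r x) ^ lookup m x)"
      unfolding subst_monom_def by (rule prod.cong) (use True in \<open>auto simp: \<rho>\<close>)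
    then show ?thesis using True by (simp only: monomial_image_monom if_True)
  next
    case False
    then obtain x where "x \<in> keys m" "x \<notin> ?W" by blast
    then have "\<exists>x\<in>keys m. ?\<rho> x ^ lookup m x = 0"
      by (intro bexI[of _ x]) (auto simp: \<rho> in_keys_iff zero_power)
    then have "subst_monom ?\<rho> m = 0" unfolding subst_monom_def by (intro prod_zero) auto
    then show ?thesis using False by simp
  qed
  define K where "K = {m \<in> keys p. keys m \<subseteq> ?W}"
  have finK: "finite K" by (simp add: K_def)
  have outside: "single m (?c m) \<in> P" if m: "m \<in> keys p - K" for m
  proof -
    obtain x where x: "x \<in> keys m" "x \<notin> ?W" using m by (auto simp: K_def)
    have mA: "keys m \<subseteq> A" using m p(1) by (auto simp: polys_def)
    obtain n where n: "m = single x 1 + n" "keys n \<subseteq> keys m"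
      using monomial_remove_var[OF x(1)] by metis
    have "single m (?c m) = pvar x * single n (?c m)"
      by (subst n(1)) (simp add: pvar_def mult_single)
    moreover have "pvar x \<in> P" using van x mA by blast
    moreover have "single n (?c m) \<in> polys A"
      by (rule polys_single) (use n(2) mA in blast)
    ultimately show ?thesis using Pi(6)[of "pvar x" "single n (?c m)"] by simp
  qed
  have class0: "(\<Sum>m\<in>{m \<in> K. ?\<mu> m = k}. ?c m) = 0" for k
  proof -
    have "subst ?\<rho> p = (\<Sum>m\<in>keys p. if m \<in> K then single (?\<mu> m) (?c m) else 0)"
      unfolding subst_def by (rule sum.cong) (auto simp: sm K_def mult_single)
    also have "\<dots> = (\<Sum>m\<in>K. single (?\<mu> m) (?c m))"
      by (rule sum.mono_neutral_cong_right) (auto simp: K_def)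
    finally have "(\<Sum>m\<in>K. lookup (single (?\<mu> m) (?c m)) k) = 0"
      using p(2) by (simp add: lookup_sum[symmetric])
    moreover have "(\<Sum>m\<in>K. lookup (single (?\<mu> m) (?c m)) k)
        = (\<Sum>m\<in>{m \<in> K. ?\<mu> m = k}. ?c m)"
      using finK by (intro sum.mono_neutral_cong_right) (auto simp: lookup_single when_def)
    ultimately show ?thesis by simp
  qed
  \<comment> \<open>A representative of each group of monomials with equal images.\<close>
  define \<nu> where "\<nu> = (\<lambda>k. SOME m. m \<in> K \<and> ?\<mu> m = k)"
  have \<nu>: "\<nu> (?\<mu> m) \<in> K \<and> ?\<mu> (\<nu> (?\<mu> m)) = ?\<mu> m" if "m \<in> K" for m
    unfolding \<nu>_def by (rule someI[of _ m]) (use that in simp)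
  have "(\<Sum>m\<in>K. const (?c m) * monomial (\<nu> (?\<mu> m)))
      = (\<Sum>k\<in>?\<mu> ` K. \<Sum>m\<in>{m \<in> K. ?\<mu> m = k}. const (?c m) * monomial (\<nu> (?\<mu> m)))"
    by (rule sum.image_gen[OF finK])
  also have "\<dots> = (\<Sum>k\<in>?\<mu> ` K. single (\<nu> k) (\<Sum>m\<in>{m \<in> K. ?\<mu> m = k}. ?c m))"
  proof (rule sum.cong[OF refl])
    fix k
    have "(\<Sum>m\<in>S. single (\<nu> k) (?c m)) = single (\<nu> k) (\<Sum>m\<in>S. ?c m)" for S
      by (induction S rule: infinite_finite_induct) (simp_all add: single_add)
    moreover have "(\<Sum>m\<in>{m \<in> K. ?\<mu> m = k}. const (?c m) * monomial (\<nu> (?\<mu> m)))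
        = (\<Sum>m\<in>{m \<in> K. ?\<mu> m = k}. single (\<nu> k) (?c m))"
      by (rule sum.cong) (auto simp: mult_single)
    ultimately show "(\<Sum>m\<in>{m \<in> K. ?\<mu> m = k}. const (?c m) * monomial (\<nu> (?\<mu> m)))
        = single (\<nu> k) (\<Sum>m\<in>{m \<in> K. ?\<mu> m = k}. ?c m)" by simp
  qed
  also have "\<dots> = 0" by (simp add: class0)
  finally have reps: "(\<Sum>m\<in>K. const (?c m) * monomial (\<nu> (?\<mu> m))) = 0" .
  have "(\<Sum>m\<in>K. const (?c m) * (monomial m - monomial (\<nu> (?\<mu> m)))) \<in> P"
  proof (rule prime_poly_ideal_sum[OF P])
    fix m assume m: "m \<in> K"
    have "monomial m - monomial (\<nu> (?\<mu> m)) \<in> P"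
      by (rule monomial_congruence[OF P UA swap]) (use m \<nu>[OF m] in \<open>auto simp: K_def\<close>)
    then show "const (?c m) * (monomial m - monomial (\<nu> (?\<mu> m))) \<in> P" by (rule Pi(5)) (rule polys_const)
  qed
  then have inK: "(\<Sum>m\<in>K. const (?c m) * monomial m) \<in> P"
    using reps by (simp add: right_diff_distrib sum_subtractf)
  have "p = (\<Sum>m\<in>keys p. single m (?c m))" by (rule poly_sum_single)
  also have "\<dots> = (\<Sum>m\<in>keys p - K. single m (?c m)) + (\<Sum>m\<in>K. single m (?c m))"
    by (rule sum.subset_diff) (auto simp: K_def)
  also have "(\<Sum>m\<in>K. single m (?c m)) = (\<Sum>m\<in>K. const (?c m) * monomial m)"
    by (simp add: mult_single)
  finally have p_eq: "p = (\<Sum>m\<in>keys p - K. single m (?c m))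
    + (\<Sum>m\<in>K. const (?c m) * monomial m)" .
  show ?thesis
    by (subst p_eq) (rule Pi(3)[OF prime_poly_ideal_sum[OF P outside] inK])
qed

context finite_graph
begin

lemma card_param_vars:
  assumes "finite U"
  shows "card (X ` U \<union> Y ` rep U ` U) = prime_dim U"
proof -
  have "card (X ` U \<union> Y ` rep U ` U) = card (X ` U) + card (Y ` rep U ` U)"
    by (rule card_Un_disjoint) (use assms in auto)
  also have "\<dots> = card U + card (rep U ` U)"
    by (simp add: card_image inj_on_def)
  finally show ?thesis by (simp add: card_rep prime_dim_def)
qed

end

text \<open>The set \<open>U\<close> consists of the vertices whose two variables do not both vanish modulo \<open>P 0\<close>.\<close>

lemma prime_chain_over_minors_le:
  fixes P :: "nat \<Rightarrow> ('v::linorder bvar, 'k::field) mpoly set"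
  assumes G: "simple_graph G"
    and chain: "\<forall>i\<le>n. primeideal (P i) (poly_ring (bvars G))" "\<forall>i<n. P i \<subset> P (Suc i)"
    and J: "\<And>i j. {i, j} \<in> edges G \<Longrightarrow> minor i j \<in> P 0"
  shows "\<exists>U\<subseteq>verts G. n \<le> finite_graph.prime_dim G U"
proof -
  interpret finite_graph G by unfold_locales (rule G)
  define U where "U = {i \<in> verts G. \<not> (pvar (X i) \<in> P 0 \<and> pvar (Y i) \<in> P 0)}"
  have UV: "U \<subseteq> verts G" by (auto simp: U_def)
  then have finU: "finite U" using finite_verts finite_subset by blast
  have P0: "primeideal (P 0) (poly_ring (bvars G))" using chain(1) by simp
  have swap: "minor i j \<in> P 0" if "i \<in> U" "j \<in> U" "rep U i = rep U j" for i j
  proof -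
    have "connected_in U i j" using rep_eq_iff that by blast
    then show ?thesis
    proof (induction rule: connected_induct)
      case refl
      show ?case using prime_poly_idealD(2)[OF P0] by simp
    next
      case (step x y)
      show ?case
      proof (rule minor_path[OF P0 _ step.IH J[OF \<open>adj x y\<close>]])
        show "\<not> (pvar (X x) \<in> P 0 \<and> pvar (Y x) \<in> P 0)" using \<open>x \<in> U\<close> by (simp add: U_def)
        show "X k \<in> bvars G \<and> Y k \<in> bvars G" if "k \<in> {i, x, y}" for k
          using that UV \<open>x \<in> U\<close> \<open>y \<in> U\<close> \<open>i \<in> U\<close> by auto
      qed
    qed
  qed
  have "n \<le> card (X ` U \<union> Y ` rep U ` U)"
  proof (rule prime_chain_length_le[OF chain])
    show "finite (X ` U \<union> Y ` rep U ` U)" using finU by simp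
    show "param (rep U) (X ` U \<union> Y ` rep U ` U) x \<in> polys (X ` U \<union> Y ` rep U ` U)" for x
      by (rule param_in_polys)
    show "p \<in> P 0" if "p \<in> polys (bvars G)" "subst (param (rep U) (X ` U \<union> Y ` rep U ` U)) p = 0" for p
    proof (rule kernel_param_subset_prime[OF P0 _ swap _ that])
      show "X ` U \<union> Y ` U \<subseteq> bvars G" using UV by auto
      show "pvar x \<in> P 0" if "x \<in> bvars G" "x \<notin> X ` U \<union> Y ` U" for x
        using that by (auto simp: U_def)
    qed
  qed
  then show ?thesis using card_param_vars[OF finU] UV by auto
qed

lemma subst_prod: "subst \<kappa> (\<Prod>x\<in>A. f x) = (\<Prod>x\<in>A. subst \<kappa> (f x))"
  by (induction A rule: infinite_finite_induct) (simp_all add: subst_1 subst_mult)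

lemma subst_subst:
  fixes \<kappa> :: "'z \<Rightarrow> ('w, 'k::comm_ring_1) mpoly" and \<rho> :: "'x \<Rightarrow> ('z, 'k) mpoly"
  shows "subst \<kappa> (subst \<rho> p) = subst (\<lambda>x. subst \<kappa> (\<rho> x)) p"
proof -
  have "subst \<kappa> (subst_monom \<rho> m) = subst_monom (\<lambda>x. subst \<kappa> (\<rho> x)) m" for m
    by (simp add: subst_monom_def subst_power subst_prod)
  then show ?thesis
    by (simp add: subst_def[of \<rho>] subst_def[of "\<lambda>x. subst \<kappa> (\<rho> x)"] subst_sum subst_mult subst_const)
qed

lemma subst_zero_param:
  assumes "C \<subseteq> B"
  shows "subst (\<lambda>x. if x \<in> C then pvar x else 0) (param r B x) = (param r C x :: ('v bvar, 'k::field) mpoly)"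
proof -
  let ?\<kappa> = "\<lambda>x. if x \<in> C then pvar x else (0 :: ('v bvar, 'k) mpoly)"
  have m: "monomial (var_monom r x) = (\<Prod>y\<in>keys (var_monom r x). pvar y :: ('v bvar, 'k) mpoly)"
    by (cases x) (simp_all add: var_monom_def keys_monomial_add pvar_def mult_single add.commute)
  have "subst ?\<kappa> (monomial (var_monom r x)) = (\<Prod>y\<in>keys (var_monom r x). ?\<kappa> y)"
    unfolding m subst_prod subst_pvar ..
  also have "\<dots> = (if keys (var_monom r x) \<subseteq> C then monomial (var_monom r x) else 0)"
  proof (cases "keys (var_monom r x) \<subseteq> C")
    case True
    then have "(\<Prod>y\<in>keys (var_monom r x). ?\<kappa> y) = (\<Prod>y\<in>keys (var_monom r x). pvar y)"
      by (intro prod.cong) auto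
    then show ?thesis using True m by simp
  next
    case False
    then have "\<exists>y\<in>keys (var_monom r x). ?\<kappa> y = 0" by auto
    then show ?thesis using False by (subst prod_zero) auto
  qed
  finally show ?thesis using assms by (auto simp: param_def subst_0)
qed

definition param_kernel :: "'v set \<Rightarrow> ('v \<Rightarrow> 'v) \<Rightarrow> 'v bvar set \<Rightarrow> ('v bvar, 'k::field) mpoly set" where
  "param_kernel V r B = {p \<in> polys (X ` V \<union> Y ` V). subst (param r B) p = 0}"

lemma param_kernel_mono:
  fixes C B :: "'v bvar set"
  assumes "C \<subseteq> B"
  shows "param_kernel V r B \<subseteq> (param_kernel V r C :: ('v bvar, 'k::field) mpoly set)"
proof
  let ?\<kappa> = "\<lambda>x. if x \<in> C then pvar x else (0 :: ('v bvar, 'k) mpoly)"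
  fix p :: "('v bvar, 'k) mpoly" assume p: "p \<in> param_kernel V r B"
  have "subst ?\<kappa> (subst (param r B) p) = subst (\<lambda>x. subst ?\<kappa> (param r B x)) p"
    by (rule subst_subst)
  also have "(\<lambda>x. subst ?\<kappa> (param r B x)) = param r C"
    by (rule ext) (rule subst_zero_param[OF assms])
  finally have factor: "subst ?\<kappa> (subst (param r B) p) = subst (param r C) p" .
  have p': "p \<in> polys (X ` V \<union> Y ` V)" "subst (param r B) p = 0"
    using p unfolding param_kernel_def by blast+
  have "subst (param r C) p = 0" using factor unfolding p'(2) subst_0 by (rule sym)
  then show "p \<in> param_kernel V r C" using p'(1) unfolding param_kernel_def by blast
qed

text \<open>The variable \<open>z\<close> of \<open>S\<close> witnesses strictness. As \<open>y\<^sub>c\<close> goes to \<open>s\<^sub>c t\<^sub>c\<close>, it detects the removal of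
  \<open>t\<^sub>c\<close> only while \<open>s\<^sub>c\<close> is still present.\<close>

lemma param_kernel_strict:
  assumes C: "C \<subseteq> B" and z: "z \<in> B" "z \<notin> C" "z \<in> X ` V \<union> Y ` V"
    and Y: "\<And>c. z = Y c \<Longrightarrow> r c = c \<and> X c \<in> B"
  shows "param_kernel V r B \<subset> (param_kernel V r C :: ('v bvar, 'k::field) mpoly set)"
proof -
  have "keys (var_monom r z) \<subseteq> B"
  proof (cases z)
    case (X i)
    then show ?thesis using z(1) by (simp add: keys_var_monom)
  next
    case (Y c)
    then show ?thesis using z(1) assms(5)[OF Y] by (simp add: keys_var_monom)
  qed
  moreover have "monomial (var_monom r z) \<noteq> (0 :: ('v bvar, 'k) mpoly)"
    by (metis lookup_single_eq lookup_zero zero_neq_one)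
  ultimately have 1: "param r B z \<noteq> (0 :: ('v bvar, 'k) mpoly)" by (simp add: param_def)
  have "\<not> keys (var_monom r z) \<subseteq> C"
  proof (cases z)
    case (X i)
    then show ?thesis using z(2) by (simp add: keys_var_monom)
  next
    case (Y c)
    then show ?thesis using z(2) assms(5)[OF Y] by (simp add: keys_var_monom)
  qed
  then have 2: "param r C z = (0 :: ('v bvar, 'k) mpoly)" by (simp add: param_def)
  have "pvar z \<in> polys (X ` V \<union> Y ` V)" by (rule polys_pvar[OF z(3)])
  then have "pvar z \<in> (param_kernel V r C :: ('v bvar, 'k) mpoly set)"
    "pvar z \<notin> (param_kernel V r B :: ('v bvar, 'k) mpoly set)"
    using 1 2 unfolding param_kernel_def mem_Collect_eq subst_pvar by blast+
  then show ?thesis using param_kernel_mono[OF C, of V r] by blast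
qed

text \<open>The target variables are killed one at a time, all \<open>t\<^sub>c\<close> before the first \<open>s\<^sub>i\<close>, so that each removal
  enlarges the kernel.\<close>

lemma prime_chain_over_minors:
  assumes G: "simple_graph (G :: 'v::linorder ugraph)" and UV: "U \<subseteq> verts G"
  shows "\<exists>P :: nat \<Rightarrow> ('v bvar, 'k::field) mpoly set.
    (\<forall>i. primeideal (P i) (poly_ring (bvars G))) \<and> (\<forall>i<finite_graph.prime_dim G U. P i \<subset> P (Suc i)) \<and>
    (\<forall>k i j. {i, j} \<in> edges G \<longrightarrow> minor i j \<in> P k)"
proof -
  interpret finite_graph G by unfold_locales (rule G)
  let ?r = "rep U"
  have finU: "finite U" using UV finite_verts finite_subset by blast
  obtain xs where xs: "set xs = X ` U" "distinct xs" using finite_distinct_list[of "X ` U"] finU by auto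
  obtain ys where ys: "set ys = Y ` ?r ` U" "distinct ys" using finite_distinct_list[of "Y ` ?r ` U"] finU by auto
  let ?zs = "ys @ xs"
  define P where "P k = (param_kernel (verts G) ?r (set (drop k ?zs)) :: ('v bvar, 'k) mpoly set)" for k
  have dist: "distinct ?zs" using xs ys by auto
  have len: "length ?zs = prime_dim U"
  proof -
    have "length ?zs = card (set ?zs)" using distinct_card[OF dist] by simp
    also have "set ?zs = X ` U \<union> Y ` ?r ` U" using xs ys by auto
    finally show ?thesis using card_param_vars[OF finU] by simp
  qed
  have prime: "primeideal (P k) (poly_ring (bvars G))" for k
    unfolding P_def param_kernel_def by (rule primeideal_kernel_subst)
  have strict: "P k \<subset> P (Suc k)" if k: "k < prime_dim U" for k
    unfolding P_def
  proof (rule param_kernel_strict)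
    have kl: "k < length ?zs" using k len by simp
    have dk: "drop k ?zs = ?zs ! k # drop (Suc k) ?zs" by (rule Cons_nth_drop_Suc[OF kl, symmetric])
    show "set (drop (Suc k) ?zs) \<subseteq> set (drop k ?zs)" unfolding dk by auto
    show "?zs ! k \<in> set (drop k ?zs)" unfolding dk by simp
    have "distinct (drop k ?zs)" using dist by (rule distinct_drop)
    then show "?zs ! k \<notin> set (drop (Suc k) ?zs)" unfolding dk by simp
    have z: "?zs ! k \<in> set ?zs" using kl by (rule nth_mem)
    have rU: "?r i \<in> U" if "i \<in> U" for i using rep[OF that] by blast
    show "?zs ! k \<in> X ` verts G \<union> Y ` verts G"
    proof -
      have "?r ` U \<subseteq> verts G" using rU UV by blast
      then have "Y ` ?r ` U \<subseteq> Y ` verts G" by (rule image_mono)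
      moreover have "X ` U \<subseteq> X ` verts G" using UV by (rule image_mono)
      ultimately have "set ?zs \<subseteq> X ` verts G \<union> Y ` verts G"
        unfolding set_append xs(1) ys(1) by (intro Un_least le_supI1 le_supI2)
      then show ?thesis using z by (rule subsetD)
    qed
    fix c assume c: "?zs ! k = Y c"
    then have "Y c \<in> set ys" using z xs(1) by auto
    then obtain i where i: "i \<in> U" "c = ?r i" using ys(1) by auto
    have "?r c = c" using rep_eq_iff[OF rU[OF i(1)] i(1)] rep[OF i(1)] connected_sym i(2) by blast
    moreover have "k < length ys"
    proof (rule ccontr)
      assume "\<not> k < length ys"
      then have "?zs ! k \<in> set xs" using kl by (simp add: nth_append)
      then show False using c xs(1) by auto
    qed
    then have "set xs \<subseteq> set (drop k ?zs)" by simp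
    then have "X c \<in> set (drop k ?zs)" using xs(1) rU i by blast
    ultimately show "?r c = c \<and> X c \<in> set (drop k ?zs)" by blast
  qed
  have minors: "minor i j \<in> P k" if ij: "{i, j} \<in> edges G" for i j k
  proof -
    let ?B = "set (drop k ?zs)"
    have B: "?B \<subseteq> X ` U \<union> Y ` ?r ` U" using set_drop_subset[of k ?zs] xs ys by auto
    have V: "i \<in> verts G" "j \<in> verts G" using adj_verts[OF ij] by auto
    have "param ?r ?B (X i) * param ?r ?B (Y j) = (param ?r ?B (X j) * param ?r ?B (Y i) :: ('v bvar, 'k) mpoly)"
    proof (cases "X i \<in> ?B \<and> X j \<in> ?B")
      case True
      then have U: "i \<in> U" "j \<in> U" using B by auto
      then have "?r i = ?r j" using rep_eq_iff connected_adj[OF ij] by blast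
      then show ?thesis using True
        by (simp only: param_X param_Y if_True simp_thms) (simp add: mult_ac)
    qed (simp only: param_X param_Y, auto)
    then show ?thesis
      unfolding P_def param_kernel_def using V
      by (auto simp: subst_diff subst_mult subst_pvar intro!: polys_diff polys_mult polys_pvar)
  qed
  show ?thesis using prime strict minors by blast
qed

theorem krull_dim_binomial_edge_ideal:
  assumes G: "simple_graph (G :: 'v::linorder ugraph)"
  shows "krull_dim ((edge_poly_ring G :: ('v bvar, 'k::field) mpoly ring) Quot binomial_edge_ideal G)
    = enat (finite_graph.max_prime_dim G (verts G))"
proof -
  interpret finite_graph G by unfold_locales (rule G)
  let ?R = "edge_poly_ring G :: ('v bvar, 'k) mpoly ring"
  let ?S = "{enat n | n P. (\<forall>i\<le>n. primeideal (P i) ?R \<and> binomial_edge_ideal G \<subseteq> P i) \<and> (\<forall>i<n. P i \<subset> P (Suc i))}"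
  have cr: "cring ?R" unfolding edge_poly_ring_def by (rule cring_poly_ring)
  have eq: "krull_dim (?R Quot binomial_edge_ideal G) = Sup ?S"
    by (rule krull_dim_Quot[OF cr ideal_binomial_edge_ideal[OF G]])
  have J: "binomial_edge_ideal G \<subseteq> P \<longleftrightarrow> (\<forall>i j. {i, j} \<in> edges G \<longrightarrow> minor i j \<in> P)"
    if "primeideal P ?R" for P
    by (rule binomial_edge_ideal_subset_iff[OF G that])
  have upper: "s \<le> enat (max_prime_dim (verts G))" if s: "s \<in> ?S" for s
  proof -
    obtain n P where n: "s = enat n" "\<forall>i\<le>n. primeideal (P i) ?R \<and> binomial_edge_ideal G \<subseteq> P i"
      "\<forall>i<n. P i \<subset> P (Suc i)" using s by blast
    have "\<exists>U\<subseteq>verts G. n \<le> prime_dim U"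
    proof (rule prime_chain_over_minors_le[OF G _ n(3)])
      show "\<forall>i\<le>n. primeideal (P i) (poly_ring (bvars G))" using n(2) by (simp add: edge_poly_ring_def)
      show "minor i j \<in> P 0" if "{i, j} \<in> edges G" for i j using n(2) J[of "P 0"] that by blast
    qed
    then show ?thesis using prime_dim_le_max_prime_dim[OF finite_verts] n(1) by (metis enat_ord_simps(1) le_trans)
  qed
  obtain U where U: "U \<subseteq> verts G" "prime_dim U = max_prime_dim (verts G)" using max_prime_dim_attained[OF finite_verts] by blast
  obtain P :: "nat \<Rightarrow> ('v bvar, 'k) mpoly set" where P: "\<forall>i. primeideal (P i) (poly_ring (bvars G))"
    "\<forall>i<prime_dim U. P i \<subset> P (Suc i)" "\<forall>k i j. {i, j} \<in> edges G \<longrightarrow> minor i j \<in> P k"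
    using prime_chain_over_minors[OF G U(1)] by blast
  have "primeideal (P i) ?R \<and> binomial_edge_ideal G \<subseteq> P i" for i
    using P J by (simp add: edge_poly_ring_def)
  then have "enat (prime_dim U) \<in> ?S" using P(2) by blast
  then have "enat (max_prime_dim (verts G)) \<le> Sup ?S" using U(2) by (simp add: Sup_upper)
  moreover have "Sup ?S \<le> enat (max_prime_dim (verts G))" by (rule Sup_least) (rule upper)
  ultimately show ?thesis unfolding eq by (rule antisym[rotated])
qed

section \<open>Block graphs\<close>

context finite_graph
begin

lemma card_ge_2I: "finite S \<Longrightarrow> x \<in> S \<Longrightarrow> y \<in> S \<Longrightarrow> x \<noteq> y \<Longrightarrow> 2 \<le> card S"
  using card_mono[of S "{x, y}"] by simp

lemma connected_graph_comps: "connected_graph G \<longleftrightarrow> comps (verts G) = {verts G}"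
  using comps_connected_set[of "verts G"] by (simp add: induced_verts)

lemma cutpoint_iff: "cutpoint G v \<longleftrightarrow> v \<in> verts G \<and> ncomp (verts G) < ncomp (verts G - {v})"
  using card_components_induced[of "verts G"] card_components_induced[of "verts G - {v}"]
    remove_verts_induced[of "verts G" "{v}"]
  by (auto simp: cutpoint_def induced_verts)

lemma comps_connectedI:
  "W \<noteq> {} \<Longrightarrow> (\<And>u w. u \<in> W \<Longrightarrow> w \<in> W \<Longrightarrow> connected_in W u w) \<Longrightarrow> comps W = {W}"
  by (rule comps_eqI) auto

lemma ncomp_le_1:
  assumes "\<And>u w. u \<in> W \<Longrightarrow> w \<in> W \<Longrightarrow> connected_in W u w"
  shows "ncomp W \<le> 1"
  using comps_connectedI[OF _ assms] by (cases "W = {}") simp_all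

lemma connected_if_ncomp_le_1:
  assumes "finite W" "ncomp W \<le> 1" "u \<in> W" "w \<in> W"
  shows "connected_in W u w"
proof -
  obtain C D where C: "C \<in> comps W" "u \<in> C" and D: "D \<in> comps W" "w \<in> D"
    using comp_of assms(3,4) by metis
  have "C = D" using card_ge_2I[OF finite_comps[OF assms(1)] C(1) D(1)] assms(2) by fastforce
  then show ?thesis using comps_connected C D by simp
qed

lemma subgraph_induced: "subgraph (induced G W) G"
  using simple_induced by (auto simp: subgraph_def induced_def)

lemma nonseparable_inducedI:
  assumes W: "W \<subseteq> verts G" "W \<noteq> {}"
    and conn: "\<And>u w. u \<in> W \<Longrightarrow> w \<in> W \<Longrightarrow> connected_in W u w"
    and conn': "\<And>x u w. x \<in> W \<Longrightarrow> u \<in> W - {x} \<Longrightarrow> w \<in> W - {x} \<Longrightarrow> connected_in (W - {x}) u w"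
  shows "nonseparable_subgraph G (induced G W)"
proof -
  have c: "comps W = {W}" by (rule comps_connectedI[OF W(2) conn])
  have "\<not> cutpoint (induced G W) x" for x
  proof (cases "x \<in> W")
    case True
    have "W - {x} \<subseteq> verts G" using W by blast
    then have "card (components (remove_verts (induced G W) {x})) \<le> 1"
      using ncomp_le_1[of "W - {x}"] conn'[OF True]
      by (simp add: remove_verts_induced[OF W(1)] card_components_induced)
    then show ?thesis by (simp add: cutpoint_def card_components_induced[OF W(1)] c)
  qed (simp add: cutpoint_def verts_induced[OF W(1)])
  then show ?thesis
    using subgraph_induced comps_connected_set[OF W(1)] c by (simp add: nonseparable_subgraph_def)
qed

lemma nonseparable_clique:
  assumes "clique G C" "C \<noteq> {}"
  shows "nonseparable_subgraph G (induced G C)"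
proof -
  have "connected_in W u w" if "W \<subseteq> C" "u \<in> W" "w \<in> W" for W u w
  proof (cases "u = w")
    case False
    then have "adj u w" using assms(1) that by (auto simp: clique_def)
    then show ?thesis using connected_adj that by blast
  qed simp
  then show ?thesis using assms by (intro nonseparable_inducedI) (auto simp: clique_def)
qed

text \<open>A nonseparable subgraph with as many vertices and edges as possible is a block.\<close>

lemma nonseparable_in_block:
  assumes "nonseparable_subgraph G B"
  shows "\<exists>B'. block G B' \<and> subgraph B B'"
proof -
  define Q where "Q = (\<lambda>B'. nonseparable_subgraph G B' \<and> subgraph B B')"
  define sz where "sz = (\<lambda>B :: 'v ugraph. card (verts B) + card (edges B))"
  have finE: "finite (edges G)"
    by (rule finite_subset[of _ "Pow (verts G)"]) (use simple in \<open>auto simp: simple_graph_def\<close>)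
  have sub: "subgraph H G" if "nonseparable_subgraph G H" for H
    using that by (simp add: nonseparable_subgraph_def)
  have "Q B" using assms by (simp add: Q_def subgraph_def nonseparable_subgraph_def)
  moreover have "sz H < Suc (sz G)" if "Q H" for H
    using sub[of H] that finE finite_verts
    by (auto simp: Q_def sz_def subgraph_def less_Suc_eq_le intro!: add_mono card_mono)
  ultimately obtain B1 where B1: "Q B1" "\<And>H. Q H \<Longrightarrow> sz H \<le> sz B1"
    using ex_has_greatest_nat[of Q B sz "Suc (sz G)"] by blast
  have "B' = B1" if B': "nonseparable_subgraph G B'" "subgraph B1 B'" for B'
  proof -
    have s: "verts B1 \<subseteq> verts B'" "edges B1 \<subseteq> edges B'" using B'(2) by (auto simp: subgraph_def)
    have f: "finite (verts B')" "finite (edges B')"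
      using sub[OF B'(1)] finE finite_verts by (auto simp: subgraph_def intro: finite_subset)
    have "Q B'" using B' B1(1) by (auto simp: Q_def subgraph_def)
    then have "sz B' \<le> sz B1" by (rule B1(2))
    then have "card (verts B1) = card (verts B')" "card (edges B1) = card (edges B')"
      using card_mono[OF f(1) s(1)] card_mono[OF f(2) s(2)] by (auto simp: sz_def)
    then have "verts B1 = verts B'" "edges B1 = edges B'" using card_subset_eq f s by blast+
    then show ?thesis by simp
  qed
  then have "block G B1" using B1(1) by (auto simp: block_def Q_def)
  then show ?thesis using B1(1) by (auto simp: Q_def)
qed

lemma block_graph_nonseparable_clique:
  assumes "block_graph G" "nonseparable_subgraph G B" "u \<in> verts B" "w \<in> verts B" "u \<noteq> w"
  shows "adj u w"
proof -
  obtain B' where B': "block G B'" "subgraph B B'" using nonseparable_in_block assms by blast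
  then have "complete_graph B'" "edges B' \<subseteq> edges G"
    using assms(1) by (auto simp: block_graph_def block_def nonseparable_subgraph_def subgraph_def)
  then show ?thesis using B' assms by (auto simp: complete_graph_def subgraph_def)
qed

text \<open>Let \<open>W\<close> be a smallest vertex set avoiding \<open>v\<close> in which \<open>a\<close> and \<open>b\<close> are connected. For \<open>x\<close> in
  \<open>W\<close>, every component of \<open>W - x\<close> contains \<open>a\<close> or \<open>b\<close>, since otherwise it could be dropped from \<open>W\<close>;
  hence \<open>v\<close> still connects everything after the removal of \<open>x\<close>. So \<open>W\<close> together with \<open>v\<close> is
  nonseparable and lies in a block, which is complete.\<close>

lemma block_graph_neighbours:
  assumes bg: "block_graph G" and v: "adj v a" "adj v b" and ab: "connected_in (verts G - {v}) a b"
  shows "a = b \<or> adj a b"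
proof -
  define Q where "Q = (\<lambda>W. W \<subseteq> verts G - {v} \<and> a \<in> W \<and> b \<in> W \<and> connected_in W a b)"
  have "Q (verts G - {v})" using v ab adj_verts by (auto simp: Q_def)
  then obtain W where W: "Q W" "\<And>W'. Q W' \<Longrightarrow> card W \<le> card W'"
    using ex_has_least_nat[of Q _ card] by blast
  have fin: "finite W" using W(1) finite_verts by (auto simp: Q_def intro: finite_subset)
  have min: "W' = W" if "Q W'" "W' \<subseteq> W" for W'
    using card_subset_eq[OF fin that(2)] card_mono[OF fin that(2)] W(2)[OF that(1)] by simp
  have WQ: "W \<subseteq> verts G - {v}" "a \<in> W" "b \<in> W" "connected_in W a b" using W(1) by (auto simp: Q_def)
  have all: "connected_in W a u" if "u \<in> W" for u
  proof -
    define C where "C = {u \<in> W. connected_in W a u}"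
    have "connected_in C a b \<and> b \<in> C"
    proof (rule connected_closed_in[OF WQ(4)])
      show "y \<in> C" if "x \<in> C" "y \<in> W" "adj x y" for x y
        using that connected_trans[of W a x y] connected_adj[of x y W] by (auto simp: C_def)
    qed (use WQ in \<open>auto simp: C_def\<close>)
    then have "Q C" using WQ by (auto simp: Q_def C_def)
    then have "C = W" using min by (auto simp: C_def)
    then show ?thesis using that by (auto simp: C_def)
  qed
  have end_comp: "connected_in (W - {x}) u a \<and> a \<noteq> x \<or> connected_in (W - {x}) u b \<and> b \<noteq> x"
    if x: "x \<in> W" and u: "u \<in> W - {x}" for x u
  proof (rule ccontr)
    assume neg: "\<not> ?thesis"
    define C where "C = {w \<in> W - {x}. connected_in (W - {x}) u w}"
    have closed: "z \<in> C" if "y \<in> C" "z \<in> W - {x}" "adj y z" for y z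
      using that connected_trans[of "W - {x}" u y z] connected_adj[of y z "W - {x}"] by (auto simp: C_def)
    have C: "a \<notin> C" "b \<notin> C" "u \<in> C" "x \<notin> C" using neg u by (auto simp: C_def)
    \<comment> \<open>A walk from \<open>a\<close> to \<open>b\<close> can enter and leave \<open>C\<close> only through \<open>x\<close>, so \<open>D\<close>, with \<open>C\<close> added if
      \<open>x\<close> is reached, is closed under adjacency in \<open>W\<close>.\<close>
    define D where "D = {w \<in> W - C. connected_in (W - C) a w}"
    have Dstep: "z \<in> D" if "y \<in> D" "z \<in> W - C" "adj y z" for y z
      using that connected_trans[of "W - C" a y z] connected_adj[of y z "W - C"] by (auto simp: D_def)
    have "b \<in> D \<union> (if x \<in> D then C else {})"
    proof (rule connected_closed[OF WQ(4)])
      show "a \<in> D \<union> (if x \<in> D then C else {})" using WQ C by (auto simp: D_def)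
      fix y z assume y: "y \<in> D \<union> (if x \<in> D then C else {})" and z: "z \<in> W" "adj y z"
      show "z \<in> D \<union> (if x \<in> D then C else {})"
      proof (cases "y \<in> D")
        case yD: True
        show ?thesis
        proof (cases "z \<in> C")
          case True
          have "y = x"
          proof (rule ccontr)
            assume "y \<noteq> x"
            then have "y \<in> C" using closed[OF True, of y] yD z adj_sym by (auto simp: D_def)
            then show False using yD by (auto simp: D_def)
          qed
          then show ?thesis using yD True by simp
        qed (use Dstep[OF yD _ z(2)] z in simp)
      next
        case False
        then have "y \<in> C" "x \<in> D" using y by (auto split: if_splits)
        then show ?thesis using closed[of y z] z by (cases "z = x") auto
      qed
    qed
    then have "b \<in> D" using C by (auto split: if_splits)
    then have "Q (W - C)" using WQ C by (auto simp: Q_def D_def)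
    then have "W - C = W" using min by blast
    then show False using C u by blast
  qed
  let ?W = "insert v W"
  have "nonseparable_subgraph G (induced G ?W)"
  proof (rule nonseparable_inducedI)
    show "?W \<subseteq> verts G" using WQ v adj_verts by blast
    have "connected_in ?W v u" if "u \<in> ?W" for u
    proof (cases "u = v")
      case False
      then have "connected_in ?W a u" using all[of u] connected_mono[of W ?W a u] that by blast
      moreover have "connected_in ?W v a" using connected_adj[OF v(1)] WQ by blast
      ultimately show ?thesis using connected_trans by blast
    qed simp
    then show "connected_in ?W u w" if "u \<in> ?W" "w \<in> ?W" for u w
      using connected_trans[OF connected_sym, of ?W v u w] that by blast
    fix x u w assume x: "x \<in> ?W" and uw: "u \<in> ?W - {x}" "w \<in> ?W - {x}"
    show "connected_in (?W - {x}) u w"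
    proof (cases "x = v")
      case True
      then have "?W - {x} = W" using WQ by blast
      then show ?thesis using connected_trans[OF connected_sym[OF all] all] uw by simp
    next
      case False
      have "connected_in (?W - {x}) u v" if u: "u \<in> ?W - {x}" for u
      proof (cases "u = v")
        case False
        then have "u \<in> W - {x}" "x \<in> W" using u x \<open>x \<noteq> v\<close> by auto
        then consider "connected_in (W - {x}) u a" "a \<noteq> x" | "connected_in (W - {x}) u b" "b \<noteq> x"
          using end_comp by blast
        then obtain c where c: "connected_in (W - {x}) u c" "c \<noteq> x" "c \<in> W" "adj v c"
          using WQ v by metis
        have "connected_in (?W - {x}) u c" by (rule connected_mono[OF _ c(1)]) auto
        moreover have "connected_in (?W - {x}) c v"
          using connected_adj[of c v "?W - {x}"] c adj_sym \<open>x \<noteq> v\<close> by auto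
        ultimately show ?thesis by (rule connected_trans)
      qed simp
      from connected_trans[OF this[OF uw(1)] connected_sym[OF this[OF uw(2)]]] show ?thesis .
    qed
  qed simp
  then show ?thesis
    using block_graph_nonseparable_clique[OF bg, of "induced G ?W" a b] WQ v adj_verts
    by (auto simp: induced_def)
qed

end

text \<open>This form of the block graph property mentions no blocks and therefore passes to induced subgraphs
  at once. All graphs met by the algorithm are induced subgraphs of the input.\<close>

locale finite_block_graph = finite_graph +
  assumes neighbours_adj:
    "adj v a \<Longrightarrow> adj v b \<Longrightarrow> connected_in (verts G - {v}) a b \<Longrightarrow> a = b \<or> adj a b"

lemma (in finite_graph) finite_block_graphI: "block_graph G \<Longrightarrow> finite_block_graph G"
  using block_graph_neighbours by unfold_locales

context finite_block_graph
begin

lemma finite_block_graph_induced: "finite_block_graph (induced G A)"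
proof
  show "simple_graph (induced G A)" by (rule simple_induced)
  fix v a b assume *: "{v, a} \<in> edges (induced G A)" "{v, b} \<in> edges (induced G A)"
    "reachable (induced (induced G A) (verts (induced G A) - {v})) a b"
  then have "connected_in (A \<inter> (verts (induced G A) - {v})) a b" by (simp only: induced_induced)
  then have "connected_in (verts G - {v}) a b"
    by (rule connected_mono[rotated]) (auto simp: induced_def)
  then have "a = b \<or> adj a b" using * neighbours_adj[of v a b] by (simp add: edges_induced)
  then show "a = b \<or> {a, b} \<in> edges (induced G A)" using * by (simp add: edges_induced)
qed

text \<open>After the removal of a vertex \<open>x\<close>, the subgraph \<open>B\<close> stays connected; so any two neighbours of \<open>x\<close> in
  \<open>B\<close> are adjacent. Along a walk in \<open>B\<close> that starts at \<open>u\<close>, adjacency to \<open>u\<close> thus carries over from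
  each vertex to the next.\<close>

lemma nonseparable_is_clique:
  assumes "nonseparable_subgraph G B"
  shows "clique G (verts B)"
proof -
  have B: "simple_graph B" "verts B \<subseteq> verts G" "edges B \<subseteq> edges G" "connected_graph B"
    "\<And>v. v \<in> verts B \<Longrightarrow> \<not> cutpoint B v"
    using assms by (auto simp: nonseparable_subgraph_def subgraph_def)
  interpret B: finite_graph B by unfold_locales (rule B)
  have tr: "connected_in (verts G - {x}) u w" if "B.connected_in (verts B - {x}) u w" for x u w
    using that
  proof (induction rule: B.connected_induct)
    case (step y z)
    then have "connected_in (verts G - {x}) y z" using B by (intro connected_adj) auto
    then show ?case using step connected_trans by blast
  qed simp
  have conn: "B.connected_in (verts B - {x}) u w" if "x \<in> verts B" "u \<in> verts B - {x}" "w \<in> verts B - {x}" for x u w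
  proof (rule B.connected_if_ncomp_le_1)
    show "B.ncomp (verts B - {x}) \<le> 1"
      using B(5)[OF that(1)] B(4) that(1) unfolding B.cutpoint_iff B.connected_graph_comps by simp
  qed (use that B.finite_verts in auto)
  have "u = w \<or> adj u w" if "u \<in> verts B" "w \<in> verts B" for u w
  proof -
    have "B.connected_in (verts B) u w"
      using B(4) that by (simp add: connected_graph_def B.induced_verts)
    then show ?thesis
    proof (induction rule: B.connected_induct)
      case (step x y)
      then have xy: "adj x y" using B by blast
      show ?case
      proof (cases "u = x \<or> u = y")
        case False
        then have "adj x u" using step adj_sym by blast
        moreover have "connected_in (verts G - {x}) u y"
          by (rule tr, rule conn) (use step that False adj_verts[OF xy] in auto)
        ultimately show ?thesis using neighbours_adj[of x u y] xy by blast
      qed (use xy in auto)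
    qed simp
  qed
  then show ?thesis using B by (auto simp: clique_def)
qed

lemma maximal_clique_exists:
  assumes "clique G C"
  shows "\<exists>M. maximal_clique G M \<and> C \<subseteq> M"
proof -
  have "card D < Suc (card (verts G))" if "clique G D" for D
    using that finite_verts by (auto simp: clique_def less_Suc_eq_le intro: card_mono)
  then obtain M where M: "clique G M" "C \<subseteq> M" "\<And>D. clique G D \<Longrightarrow> C \<subseteq> D \<Longrightarrow> card D \<le> card M"
    using ex_has_greatest_nat[of "\<lambda>D. clique G D \<and> C \<subseteq> D" C card "Suc (card (verts G))"] assms by auto
  have "D = M" if "clique G D" "M \<subseteq> D" for D
  proof -
    have "finite D" using that finite_verts by (auto simp: clique_def intro: finite_subset)
    then show ?thesis using card_seteq[of D M] M(2) M(3)[OF that(1)] that by blast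
  qed
  then show ?thesis using M by (auto simp: maximal_clique_def)
qed

lemma maximal_clique_adj: "maximal_clique G M \<Longrightarrow> a \<in> M \<Longrightarrow> b \<in> M \<Longrightarrow> a \<noteq> b \<Longrightarrow> adj a b"
  by (auto simp: maximal_clique_def clique_def)

lemma maximal_clique_subset: "maximal_clique G M \<Longrightarrow> M \<subseteq> verts G"
  by (auto simp: maximal_clique_def clique_def)

lemma maximal_clique_eq: "maximal_clique G M \<Longrightarrow> maximal_clique G N \<Longrightarrow> M \<subseteq> N \<Longrightarrow> M = N"
  by (auto simp: maximal_clique_def)

lemma finite_maximal_cliques: "finite {M. maximal_clique G M}"
  by (rule finite_subset[of _ "Pow (verts G)"]) (use maximal_clique_subset finite_verts in auto)

lemma block_iff:
  assumes "v \<in> verts B"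
  shows "block G B \<longleftrightarrow> (\<exists>M. maximal_clique G M \<and> B = induced G M)"
proof
  assume B: "block G B"
  then have ns: "nonseparable_subgraph G B" by (simp add: block_def)
  obtain M where M: "maximal_clique G M" "verts B \<subseteq> M"
    using maximal_clique_exists[OF nonseparable_is_clique[OF ns]] by blast
  have "nonseparable_subgraph G (induced G M)"
    by (rule nonseparable_clique) (use M assms in \<open>auto simp: maximal_clique_def\<close>)
  moreover have "subgraph B (induced G M)"
  proof -
    have "e \<subseteq> verts B" if "e \<in> edges B" for e
      using ns that unfolding nonseparable_subgraph_def subgraph_def simple_graph_def by blast
    then show ?thesis
      using ns M(2) simple_induced unfolding nonseparable_subgraph_def subgraph_def
      by (auto simp: induced_def)
  qed
  ultimately have "induced G M = B" using B by (simp add: block_def)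
  then show "\<exists>M. maximal_clique G M \<and> B = induced G M" using M by blast
next
  assume "\<exists>M. maximal_clique G M \<and> B = induced G M"
  then obtain M where M: "maximal_clique G M" "B = induced G M" by blast
  have vB: "verts B = M" using M verts_induced maximal_clique_subset by simp
  have "nonseparable_subgraph G B"
    unfolding M(2) by (rule nonseparable_clique) (use M vB assms in \<open>auto simp: maximal_clique_def\<close>)
  moreover have "B' = B" if B': "nonseparable_subgraph G B'" "subgraph B B'" for B'
  proof -
    have "M \<subseteq> verts B'" using B'(2) vB by (simp add: subgraph_def)
    then have v': "verts B' = M"
      using nonseparable_is_clique[OF B'(1)] M(1) by (simp add: maximal_clique_def)
    have "edges B' \<subseteq> edges B"
    proof
      fix e assume e: "e \<in> edges B'"
      then have "e \<in> edges G" "e \<subseteq> verts B'"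
        using B'(1) unfolding nonseparable_subgraph_def subgraph_def simple_graph_def by blast+
      then show "e \<in> edges B" using v' by (simp add: M(2) induced_def)
    qed
    then have "edges B' = edges B" using B'(2) by (auto simp: subgraph_def)
    then show ?thesis using v' vB by simp
  qed
  ultimately show "block G B" by (simp add: block_def)
qed

definition closed_nbh :: "'a \<Rightarrow> 'a set" where
  "closed_nbh v = insert v {u. adj v u}"

lemma maximal_clique_closed_nbh: "maximal_clique G M \<Longrightarrow> v \<in> M \<Longrightarrow> M \<subseteq> closed_nbh v"
  using maximal_clique_adj by (auto simp: closed_nbh_def)

lemma simplicial_maximal_clique:
  assumes "simplicial (verts G) v" "maximal_clique G M" "v \<in> M"
  shows "M = closed_nbh v"
proof -
  have "v \<in> verts G" using assms maximal_clique_subset by blast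
  have "clique G (closed_nbh v)"
    unfolding clique_def
  proof (intro conjI ballI impI)
    show "closed_nbh v \<subseteq> verts G" using \<open>v \<in> verts G\<close> adj_verts by (auto simp: closed_nbh_def)
    fix a b assume "a \<in> closed_nbh v" "b \<in> closed_nbh v" "a \<noteq> b"
    then show "adj a b"
      using assms(1) adj_verts adj_sym by (auto simp: closed_nbh_def simplicial_def)
  qed
  then show ?thesis using assms(2) maximal_clique_closed_nbh[OF assms(2,3)] unfolding maximal_clique_def by metis
qed

lemma maximal_clique_at:
  assumes "v \<in> verts G"
  obtains M where "maximal_clique G M" "v \<in> M"
  using maximal_clique_exists[of "{v}"] assms by (auto simp: clique_def)

lemma maximal_clique_edge:
  assumes "adj v a"
  obtains M where "maximal_clique G M" "v \<in> M" "a \<in> M"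
  using maximal_clique_exists[of "{v, a}"] assms adj_verts[OF assms] adj_sym by (auto simp: clique_def)

lemma cdeg_eq_1_iff:
  assumes v: "v \<in> verts G"
  shows "cdeg G v = 1 \<longleftrightarrow> simplicial (verts G) v"
proof
  assume "cdeg G v = 1"
  then obtain N where N: "{C. maximal_clique G C \<and> v \<in> C} = {N}"
    unfolding cdeg_def by (auto simp: card_1_singleton_iff)
  show "simplicial (verts G) v"
    unfolding simplicial_def
  proof (intro ballI impI)
    fix a b assume "adj v a" "adj v b"
    have "c \<in> N" if c: "adj v c" for c
    proof -
      obtain M where "maximal_clique G M" "v \<in> M" "c \<in> M" using maximal_clique_edge[OF c] .
      then show ?thesis using N by blast
    qed
    then have "a \<in> N" "b \<in> N" "maximal_clique G N" using N \<open>adj v a\<close> \<open>adj v b\<close> by blast+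
    then show "a = b \<or> adj a b" using maximal_clique_adj by blast
  qed
next
  assume s: "simplicial (verts G) v"
  obtain M where M: "maximal_clique G M" "v \<in> M" using maximal_clique_at[OF v] .
  have "{C. maximal_clique G C \<and> v \<in> C} = {closed_nbh v}"
    using simplicial_maximal_clique[OF s] M by blast
  then show "cdeg G v = 1" by (simp add: cdeg_def)
qed

lemma free_vertex_iff: "free_vertex G v \<longleftrightarrow> v \<in> verts G \<and> simplicial (verts G) v"
  using cdeg_eq_1_iff by (auto simp: free_vertex_def)

lemma not_simplicial_obtain:
  assumes "\<not> simplicial (verts G) v"
  obtains a b where "adj v a" "adj v b" "a \<noteq> b" "\<not> adj a b"
  using assms by (auto simp: simplicial_def)

lemma adj_comps_ge_2:
  assumes W: "W \<subseteq> verts G - {v}" and ab: "a \<in> W" "b \<in> W" "adj v a" "adj v b" "a \<noteq> b" "\<not> adj a b"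
  shows "2 \<le> card (adj_comps v W)"
proof -
  obtain C D where C: "C \<in> comps W" "a \<in> C" and D: "D \<in> comps W" "b \<in> D" using comp_of ab by metis
  have "C \<noteq> D"
  proof
    assume "C = D"
    then have "connected_in W a b" using comps_connected C D by blast
    then have "connected_in (verts G - {v}) a b" by (rule connected_mono[OF W])
    then show False using neighbours_adj ab by blast
  qed
  moreover have "C \<in> adj_comps v W" "D \<in> adj_comps v W" using C D ab by (auto simp: adj_comps_def)
  moreover have "finite (adj_comps v W)"
    using finite_comps[OF finite_subset[OF W]] finite_verts by (simp add: adj_comps_def)
  ultimately show ?thesis using card_ge_2I by metis
qed

text \<open>Counting: \<open>v\<close> merges the components it is adjacent to, and only one component remains.\<close>

lemma adj_comps_connected:
  assumes "connected_graph G" "v \<in> verts G"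
  shows "adj_comps v (verts G - {v}) = comps (verts G - {v})"
proof (rule card_seteq)
  have "ncomp (verts G) = 1" using assms by (simp add: connected_graph_comps)
  then show "ncomp (verts G - {v}) \<le> card (adj_comps v (verts G - {v}))"
    using ncomp_insert[of "verts G - {v}" v] finite_verts by (simp add: insert_absorb assms(2))
qed (auto simp: adj_comps_def finite_comps finite_verts)

text \<open>Each component of \<open>G - v\<close> contains a neighbour of \<open>v\<close>, and neighbours of \<open>v\<close> are adjacent exactly if
  they lie in the same component.\<close>

lemma cutpoint_not_simplicial:
  assumes "connected_graph G" "v \<in> verts G"
  shows "cutpoint G v \<longleftrightarrow> \<not> simplicial (verts G) v"
proof -
  have 1: "ncomp (verts G) = 1" using assms by (simp add: connected_graph_comps)
  have c: "cutpoint G v \<longleftrightarrow> 2 \<le> card (adj_comps v (verts G - {v}))"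
    by (auto simp: cutpoint_iff 1 adj_comps_connected[OF assms] assms)
  show ?thesis
  proof
    assume "cutpoint G v"
    then show "\<not> simplicial (verts G) v"
      using card_adj_comps_le_1[of "verts G - {v}" v] by (auto simp: c simplicial_def)
  next
    assume "\<not> simplicial (verts G) v"
    then obtain a b where "adj v a" "adj v b" "a \<noteq> b" "\<not> adj a b" by (rule not_simplicial_obtain)
    then show "cutpoint G v"
      unfolding c using adj_verts by (intro adj_comps_ge_2[where a = a and b = b]) auto
  qed
qed

text \<open>The next lemmas match the maximal cliques at \<open>v\<close> with the components of \<open>G - v\<close> adjacent to \<open>v\<close>.\<close>

lemma maximal_clique_in_comp:
  assumes C: "C \<in> adj_comps v (verts G - {v})" and v: "v \<in> verts G"
  shows "maximal_clique G (insert v {u \<in> C. adj v u})" (is "maximal_clique G ?M")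
  unfolding maximal_clique_def
proof (intro conjI allI impI)
  have C': "C \<in> comps (verts G - {v})" using C by (simp add: adj_comps_def)
  show "clique G ?M"
    unfolding clique_def
  proof (intro conjI ballI impI)
    show "?M \<subseteq> verts G" using v adj_verts by auto
    fix a b assume ab: "a \<in> ?M" "b \<in> ?M" "a \<noteq> b"
    show "adj a b"
    proof (cases "a = v \<or> b = v")
      case False
      then have "connected_in (verts G - {v}) a b" using comps_connected[OF C', of a b] ab by simp
      then show ?thesis using neighbours_adj[of v a b] ab False by auto
    qed (use ab adj_sym in auto)
  qed
  obtain c where c: "c \<in> C" "adj v c" using C by (auto simp: adj_comps_def)
  fix D assume D: "clique G D \<and> ?M \<subseteq> D"
  have "u \<in> ?M" if u: "u \<in> D" for u
  proof (cases "u = v \<or> u = c")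
    case False
    then have "adj v u" "adj c u" "u \<in> verts G - {v}" using D u c by (auto simp: clique_def)
    then have "u \<in> C" using comps_closed[OF C' c(1)] by blast
    then show ?thesis using \<open>adj v u\<close> by simp
  qed (use c in auto)
  then show "D = ?M" using D by blast
qed

lemma maximal_clique_comp:
  assumes M: "maximal_clique G M" "v \<in> M" and a: "adj v a"
  shows "\<exists>C\<in>adj_comps v (verts G - {v}). M = insert v {u \<in> C. adj v u}"
proof -
  have v: "v \<in> verts G" using M maximal_clique_subset by blast
  have "\<exists>c\<in>M. c \<noteq> v"
  proof (rule ccontr)
    assume "\<not> ?thesis"
    then have "\<forall>c\<in>M. c = v" by simp
    then have Mv: "M = {v}" using M(2) by fast
    obtain N where N: "maximal_clique G N" "v \<in> N" "a \<in> N" using maximal_clique_edge[OF a] .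
    then have "{v} = N" using maximal_clique_eq[of "{v}" N] M(1) Mv by simp
    then have "a = v" using N(3) by fast
    then show False using adj_verts[OF a] by simp
  qed
  then obtain c where c: "c \<in> M" "c \<noteq> v" by (elim bexE)
  then have vc: "adj v c" using maximal_clique_adj M by blast
  obtain C where C: "C \<in> comps (verts G - {v})" "c \<in> C"
    using comp_of[of c "verts G - {v}"] c adj_verts[OF vc] by blast
  have CA: "C \<in> adj_comps v (verts G - {v})" using C vc by (auto simp: adj_comps_def)
  have "u \<in> insert v {u \<in> C. adj v u}" if u: "u \<in> M" for u
  proof (cases "u = v \<or> u = c")
    case False
    then have uv: "adj v u" "adj c u" using maximal_clique_adj M c u by auto
    then have "u \<in> C" using comps_closed[OF C, of u] adj_verts[OF uv(1)] by blast
    then show ?thesis using uv by simp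
  qed (use C vc in auto)
  then have "M = insert v {u \<in> C. adj v u}"
    using maximal_clique_eq[OF M(1) maximal_clique_in_comp[OF CA v]] by blast
  then show ?thesis using CA by blast
qed

lemma inj_on_comp_clique: "inj_on (\<lambda>C. insert v {u \<in> C. adj v u}) (adj_comps v (verts G - {v}))"
proof (rule inj_onI)
  fix C D assume C: "C \<in> adj_comps v (verts G - {v})" and D: "D \<in> adj_comps v (verts G - {v})"
    and eq: "insert v {u \<in> C. adj v u} = insert v {u \<in> D. adj v u}"
  obtain c where c: "c \<in> C" "adj v c" using C by (auto simp: adj_comps_def)
  have "c \<in> insert v {u \<in> D. adj v u}" unfolding eq[symmetric] using c by simp
  then have "c \<in> D" using adj_verts[OF c(2)] by auto
  then show "C = D" using comps_disjoint[of C "verts G - {v}" D c] c C D by (simp add: adj_comps_def)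
qed

lemma cdeg_adj_comps:
  assumes "adj v a"
  shows "cdeg G v = card (adj_comps v (verts G - {v}))"
proof -
  have "{M. maximal_clique G M \<and> v \<in> M} = (\<lambda>C. insert v {u \<in> C. adj v u}) ` adj_comps v (verts G - {v})"
    using maximal_clique_comp[OF _ _ assms] maximal_clique_in_comp adj_verts[OF assms] by blast
  then show ?thesis unfolding cdeg_def by (simp add: card_image inj_on_comp_clique)
qed

end

section \<open>Vertices in two endblocks\<close>

context finite_block_graph
begin

lemma endblocks_at_iff:
  assumes "connected_graph G"
  shows "B \<in> endblocks_at G v \<longleftrightarrow>
    (\<exists>M. maximal_clique G M \<and> v \<in> M \<and> B = induced G M \<and> (\<exists>!w. w \<in> M \<and> \<not> simplicial (verts G) w))"
    (is "?L \<longleftrightarrow> ?R")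
proof -
  have *: "(\<exists>!w. w \<in> verts (induced G M) \<and> cutpoint G w) \<longleftrightarrow> (\<exists>!w. w \<in> M \<and> \<not> simplicial (verts G) w)"
    if "maximal_clique G M" for M
  proof -
    have M: "M \<subseteq> verts G" using maximal_clique_subset[OF that] .
    have "w \<in> verts (induced G M) \<and> cutpoint G w \<longleftrightarrow> w \<in> M \<and> \<not> simplicial (verts G) w" for w
      using cutpoint_not_simplicial[OF assms, of w] M by (auto simp: verts_induced[OF M])
    then show ?thesis by simp
  qed
  show ?thesis
  proof
    assume ?L
    then have B: "block G B" "v \<in> verts B" "\<exists>!w. w \<in> verts B \<and> cutpoint G w"
      by (auto simp: endblocks_at_def endblock_def)
    then obtain M where M: "maximal_clique G M" "B = induced G M" using block_iff[OF B(2)] by blast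
    have "v \<in> M" using B(2) verts_induced[OF maximal_clique_subset[OF M(1)]] by (simp add: M(2))
    moreover have "\<exists>!w. w \<in> M \<and> \<not> simplicial (verts G) w" using B(3) *[OF M(1)] by (simp only: M(2))
    ultimately show ?R using M by blast
  next
    assume ?R
    then obtain M where M: "maximal_clique G M" "v \<in> M" "B = induced G M"
      "\<exists>!w. w \<in> M \<and> \<not> simplicial (verts G) w" by blast
    have v: "v \<in> verts B" using M maximal_clique_subset[OF M(1)] by (simp add: verts_induced)
    then have "block G B" using block_iff M by blast
    then show ?L using v M *[OF M(1)] by (simp add: endblocks_at_def endblock_def)
  qed
qed

lemma endblocks_atE:
  assumes "connected_graph G" "B \<in> endblocks_at G v"
  obtains M where "maximal_clique G M" "v \<in> M" "B = induced G M" "verts B = M"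
    "\<And>w w'. w \<in> M \<Longrightarrow> w' \<in> M \<Longrightarrow> \<not> simplicial (verts G) w \<Longrightarrow> \<not> simplicial (verts G) w' \<Longrightarrow> w = w'"
proof -
  obtain M where M: "maximal_clique G M" "v \<in> M" "B = induced G M"
      "\<exists>!w. w \<in> M \<and> \<not> simplicial (verts G) w"
    using assms(2) unfolding endblocks_at_iff[OF assms(1)] by (elim exE conjE)
  have "verts B = M" by (simp add: M(3) verts_induced[OF maximal_clique_subset[OF M(1)]])
  then show ?thesis using M by (intro that[of M]) auto
qed

lemma finite_endblocks_at: "connected_graph G \<Longrightarrow> finite (endblocks_at G v)"
  by (rule finite_surj[OF finite_maximal_cliques, of _ "induced G"]) (auto simp: endblocks_at_iff)

lemma two_distinct: "2 \<le> card S \<Longrightarrow> \<exists>x\<in>S. \<exists>y\<in>S. x \<noteq> y"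
proof (rule ccontr)
  assume S: "2 \<le> card S" "\<not> (\<exists>x\<in>S. \<exists>y\<in>S. x \<noteq> y)"
  then obtain x where "x \<in> S" by fastforce
  then have "S \<subseteq> {x}" using S(2) by blast
  then have "card S \<le> 1" using card_mono[of "{x}" S] by simp
  then show False using S(1) by simp
qed

text \<open>A vertex in two maximal cliques is not simplicial, so it is the only cutpoint of each of its
  endblocks.\<close>

lemma two_endblocks_cliques:
  assumes conn: "connected_graph G" and two: "2 \<le> card (endblocks_at G v)"
  obtains M N where "maximal_clique G M" "v \<in> M" "maximal_clique G N" "v \<in> N" "M \<noteq> N"
    "\<And>w. w \<in> M \<Longrightarrow> w \<noteq> v \<Longrightarrow> simplicial (verts G) w" "\<And>w. w \<in> N \<Longrightarrow> w \<noteq> v \<Longrightarrow> simplicial (verts G) w"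
    "\<not> simplicial (verts G) v"
proof -
  obtain A B where AB: "A \<in> endblocks_at G v" "B \<in> endblocks_at G v" "A \<noteq> B"
    using two_distinct[OF two] by blast
  obtain M where M: "maximal_clique G M" "v \<in> M" "A = induced G M"
      "\<And>w. w \<in> M \<Longrightarrow> \<not> simplicial (verts G) v \<Longrightarrow> \<not> simplicial (verts G) w \<Longrightarrow> w = v"
    using endblocks_atE[OF conn AB(1)] by metis
  obtain N where N: "maximal_clique G N" "v \<in> N" "B = induced G N"
      "\<And>w. w \<in> N \<Longrightarrow> \<not> simplicial (verts G) v \<Longrightarrow> \<not> simplicial (verts G) w \<Longrightarrow> w = v"
    using endblocks_atE[OF conn AB(2)] by metis
  have ne: "M \<noteq> N" using M(3) N(3) AB(3) by metis
  have ns: "\<not> simplicial (verts G) v"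
    using simplicial_maximal_clique[OF _ M(1,2)] simplicial_maximal_clique[OF _ N(1,2)] ne by metis
  show ?thesis
    by (rule that[OF M(1,2) N(1,2) ne _ _ ns]) (use M(4) N(4) ns in metis)+
qed

text \<open>Let \<open>b\<close> and \<open>c\<close> be simplicial vertices of two endblocks at \<open>v\<close>. Both may be added to an optimal set;
  once they are in, \<open>v\<close> joins at least two components and may be left out. So the maximum is the one for
  \<open>G - v\<close>, which has \<open>cdeg v\<close> components; those that come from endblocks at \<open>v\<close> are cliques and
  have gain zero.\<close>

theorem gain_remove_endblocks:
  assumes conn: "connected_graph G" and two: "2 \<le> card (endblocks_at G v)"
  defines "W \<equiv> (\<Union>B\<in>endblocks_at G v. verts B)"
  shows "gain (verts G) + 2 = gain (verts G - ({v} \<union> W)) + cdeg G v"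
    and "2 \<le> cdeg G v" and "\<exists>a. adj v a"
proof -
  obtain M N where MN: "maximal_clique G M" "v \<in> M" "maximal_clique G N" "v \<in> N" "M \<noteq> N"
    "\<And>w. w \<in> M \<Longrightarrow> w \<noteq> v \<Longrightarrow> simplicial (verts G) w" "\<And>w. w \<in> N \<Longrightarrow> w \<noteq> v \<Longrightarrow> simplicial (verts G) w"
    "\<not> simplicial (verts G) v"
    by (rule two_endblocks_cliques[OF conn two]) blast
  have v: "v \<in> verts G" using MN(2) maximal_clique_subset[OF MN(1)] by blast
  let ?V = "verts G - {v}"
  obtain b where b: "b \<in> M" "b \<notin> N" using maximal_clique_eq[OF MN(1,3)] MN(5) by blast
  obtain c where c: "c \<in> N" "c \<notin> M" using maximal_clique_eq[OF MN(3,1)] MN(5) by blast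
  have bv: "b \<noteq> v" "c \<noteq> v" "b \<noteq> c" using b c MN by blast+
  have bs: "simplicial (verts G) b" "simplicial (verts G) c" using MN(6)[of b] MN(7)[of c] b c bv by simp_all
  have vbc: "adj v b" "adj v c" using maximal_clique_adj[OF MN(1,2) b(1)] maximal_clique_adj[OF MN(3,4) c(1)] bv by auto
  have nbc: "\<not> adj b c"
  proof
    assume "adj b c"
    then have "c \<in> closed_nbh b" by (simp add: closed_nbh_def)
    then show False using simplicial_maximal_clique[OF bs(1) MN(1) b(1)] c(2) by simp
  qed
  have bc: "b \<in> verts G" "c \<in> verts G" using vbc adj_verts by blast+
  have fin: "finite (verts G)" by (rule finite_verts)
  show cd2: "2 \<le> cdeg G v"
    unfolding cdeg_adj_comps[OF vbc(1)]
    by (rule adj_comps_ge_2[where a = b and b = c]) (use bc bv vbc nbc in auto)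
  have vV: "prime_dim (verts G) + cdeg G v = prime_dim ?V + 2"
    using prime_dim_insert[of ?V v] fin v cdeg_adj_comps[OF vbc(1)] by (simp add: insert_absorb)
  have "max_prime_dim (verts G) = max_prime_dim ?V"
  proof (rule antisym)
    obtain U where U: "U \<subseteq> verts G" "prime_dim U = max_prime_dim (verts G)" using max_prime_dim_attained[OF fin] by blast
    let ?U = "insert b (insert c U)"
    have sub: "?U \<subseteq> verts G" using U bc by blast
    have "prime_dim U \<le> prime_dim (insert c U)" by (rule prime_dim_insert_simplicial[OF fin U(1) bs(2)])
    also have "\<dots> \<le> prime_dim ?U" by (rule prime_dim_insert_simplicial[OF fin _ bs(1)]) (use sub in blast)
    also have "\<dots> \<le> prime_dim (?U - {v})"
    proof (cases "v \<in> ?U")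
      case True
      have "2 \<le> card (adj_comps v (?U - {v}))"
        by (rule adj_comps_ge_2[where a = b and b = c]) (use sub bv vbc nbc in auto)
      moreover have "finite (?U - {v})" using sub fin finite_subset by blast
      moreover have "insert v (?U - {v}) = ?U" using True by blast
      ultimately show ?thesis using prime_dim_insert[of "?U - {v}" v] by simp
    next
      case False
      then have "?U - {v} = ?U" by blast
      then show ?thesis by simp
    qed
    also have "\<dots> \<le> max_prime_dim ?V" by (rule prime_dim_le_max_prime_dim) (use sub fin in auto)
    finally show "max_prime_dim (verts G) \<le> max_prime_dim ?V" using U by simp
    show "max_prime_dim ?V \<le> max_prime_dim (verts G)"
      by (rule max_prime_dim_leI) (use fin in \<open>auto intro!: prime_dim_le_max_prime_dim\<close>)
  qed
  then have g: "gain (verts G) + 2 = gain ?V + cdeg G v"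
    using max_prime_dim_eq_gain[OF fin] max_prime_dim_eq_gain[of ?V] fin vV by simp
  have W: "\<exists>K. maximal_clique G K \<and> w \<in> K \<and> v \<in> K \<and> K \<subseteq> W \<and> (w \<noteq> v \<longrightarrow> simplicial (verts G) w)"
    if "w \<in> W" for w
  proof -
    obtain B where B: "B \<in> endblocks_at G v" "w \<in> verts B" using \<open>w \<in> W\<close> by (auto simp: W_def)
    obtain K where K: "maximal_clique G K" "v \<in> K" "verts B = K"
      "\<And>w. w \<in> K \<Longrightarrow> \<not> simplicial (verts G) v \<Longrightarrow> \<not> simplicial (verts G) w \<Longrightarrow> w = v"
      using endblocks_atE[OF conn B(1)] by metis
    then have "K \<subseteq> W" using B(1) by (auto simp: W_def)
    then show ?thesis using K B(2) MN(8) by metis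
  qed
  have WV: "W \<subseteq> verts G" using W maximal_clique_subset by blast
  obtain B where "B \<in> endblocks_at G v" using two by fastforce
  then have vW: "v \<in> W" by (auto simp: W_def endblocks_at_def)
  have "gain ((verts G - ({v} \<union> W)) \<union> (W - {v})) = gain (verts G - ({v} \<union> W)) + gain (W - {v})"
  proof (rule gain_disjoint_Un)
    show "finite (W - {v})" using fin finite_subset[OF WV] by blast
    show "\<not> adj a w" if "a \<in> verts G - ({v} \<union> W)" "w \<in> W - {v}" for a w
    proof
      assume aw: "adj a w"
      obtain K where K: "maximal_clique G K" "w \<in> K" "K \<subseteq> W" "simplicial (verts G) w"
        using W[of w] \<open>w \<in> W - {v}\<close> by auto
      have "a \<in> closed_nbh w" using aw adj_sym by (auto simp: closed_nbh_def)
      then have "a \<in> W" using simplicial_maximal_clique[OF K(4,1,2)] K(3) by blast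
      then show False using \<open>a \<in> verts G - ({v} \<union> W)\<close> by blast
    qed
  qed (use fin in auto)
  moreover have "gain (W - {v}) = 0"
  proof (rule gain_simplicial)
    show "finite (W - {v})" using fin finite_subset[OF WV] by blast
    show "simplicial (W - {v}) w" if "w \<in> W - {v}" for w
      using W[of w] that simplicial_subset[of "verts G" w "W - {v}"] WV by auto
  qed
  moreover have "(verts G - ({v} \<union> W)) \<union> (W - {v}) = ?V" using WV vW by blast
  ultimately show "gain (verts G) + 2 = gain (verts G - ({v} \<union> W)) + cdeg G v" using g by simp
  show "\<exists>a. adj v a" using vbc by blast
qed

lemma splits_at_two_comps:
  assumes conn: "connected_graph G" and v: "v \<in> verts G"
    and CD: "comps (verts G - {v}) = {C, D}" "C \<noteq> D"
  shows "splits_into G (induced G (insert v C)) (induced G (insert v D))"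
proof -
  let ?V = "verts G - {v}"
  have side: "insert v K \<subseteq> verts G \<and> v \<notin> K \<and> free_vertex (induced G (insert v K)) v \<and>
      \<not> isolated_vertex (induced G (insert v K)) v" if K: "K \<in> comps ?V" for K
  proof -
    have sub: "insert v K \<subseteq> verts G" "v \<notin> K" using comps_subset[OF K] v by auto
    have "K \<in> adj_comps v ?V" using adj_comps_connected[OF conn v] K by simp
    then obtain k where k: "k \<in> K" "adj v k" by (auto simp: adj_comps_def)
    interpret K: finite_block_graph "induced G (insert v K)" by (rule finite_block_graph_induced)
    have "K.simplicial (verts (induced G (insert v K))) v"
      unfolding K.simplicial_def edges_induced
    proof (intro ballI impI)
      fix a b assume "adj v a \<and> v \<in> insert v K \<and> a \<in> insert v K" "adj v b \<and> v \<in> insert v K \<and> b \<in> insert v K"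
      then have ab: "adj v a" "a \<in> K" "adj v b" "b \<in> K" using adj_verts by auto
      then have "connected_in ?V a b" using comps_connected[OF K] by blast
      then show "a = b \<or> adj a b \<and> a \<in> insert v K \<and> b \<in> insert v K"
        using neighbours_adj[of v a b] ab by blast
    qed
    then have "free_vertex (induced G (insert v K)) v"
      using K.free_vertex_iff sub by (simp add: verts_induced)
    moreover have "{v, k} \<in> edges (induced G (insert v K))" using k by (simp add: edges_induced)
    then have "\<not> isolated_vertex (induced G (insert v K)) v" by (auto simp: isolated_vertex_def)
    ultimately show ?thesis using sub by blast
  qed
  have C: "C \<in> comps ?V" and D: "D \<in> comps ?V" using CD by auto
  have un: "C \<union> D = ?V" using Union_comps[of ?V] CD by simp
  have disj: "C \<inter> D = {}" using comps_disjoint[OF C D] CD by blast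
  have "edges G \<subseteq> edges (induced G (insert v C)) \<union> edges (induced G (insert v D))"
  proof
    fix e assume e: "e \<in> edges G"
    then obtain x y where xy: "e = {x, y}" "x \<noteq> y" using edge_obtain by blast
    then have a: "adj x y" using e by simp
    have V: "x \<in> insert v C \<union> insert v D" "y \<in> insert v C \<union> insert v D" using adj_verts[OF a] un by blast+
    have "x \<in> insert v C \<and> y \<in> insert v C \<or> x \<in> insert v D \<and> y \<in> insert v D"
    proof (cases "x = v \<or> y = v")
      case False
      then have "x \<in> ?V" "y \<in> ?V" using adj_verts[OF a] by auto
      then show ?thesis using comps_closed[OF C, of x y] comps_closed[OF D, of x y] a un by blast
    qed (use V in blast)
    then show "e \<in> edges (induced G (insert v C)) \<union> edges (induced G (insert v D))"
      using a by (simp add: xy edges_induced)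
  qed
  then have E: "edges G = edges (induced G (insert v C)) \<union> edges (induced G (insert v D))"
    by (auto simp: induced_def)
  have V: "verts G = verts (induced G (insert v C)) \<union> verts (induced G (insert v D))"
    using side[OF C] side[OF D] verts_induced un v by auto
  have "G = graph_union (induced G (insert v C)) (induced G (insert v D))"
    unfolding graph_union_def E[symmetric] V[symmetric] by simp
  moreover have "insert v C \<inter> insert v D = {v}" using disj by blast
  ultimately show ?thesis
    unfolding splits_into_def using side[OF C] side[OF D] simple_induced
    by (auto simp: verts_induced)
qed

text \<open>Among all pairs of a nonsimplicial vertex \<open>v\<close> and a component \<open>C\<close> of \<open>G - v\<close>, take one with \<open>C\<close>
  largest. A nonsimplicial vertex \<open>w\<close> in another component of \<open>G - v\<close> would leave a component containing
  \<open>C\<close> and \<open>v\<close>. So every other component of \<open>G - v\<close> gives an endblock at \<open>v\<close>, and there are at least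
  two of them, because a cutpoint leaving just two components would decompose \<open>G\<close>.\<close>

theorem two_endblocks_exist:
  assumes conn: "connected_graph G" and ind: "indecomposable G" and nc: "\<not> complete_graph G"
  shows "\<exists>v\<in>verts G. 2 \<le> card (endblocks_at G v)"
proof -
  have ex: "\<exists>v\<in>verts G. \<not> simplicial (verts G) v"
  proof (rule ccontr)
    assume "\<not> ?thesis"
    then have s: "simplicial (verts G) v" if "v \<in> verts G" for v using that by blast
    have "u = w \<or> adj u w" if "u \<in> verts G" "w \<in> verts G" for u w
    proof -
      have "connected_in (verts G) u w" using conn that by (simp add: connected_graph_def induced_verts)
      then show ?thesis
      proof (induction rule: connected_induct)
        case (step x y)
        then have "x = u \<or> adj x u" using adj_sym by blast
        then show ?case using s[of x] step that by (auto simp: simplicial_def)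
      qed simp
    qed
    then show False using nc by (auto simp: complete_graph_def)
  qed
  define Q where "Q = (\<lambda>(v, C). v \<in> verts G \<and> \<not> simplicial (verts G) v \<and> C \<in> comps (verts G - {v}))"
  have bound: "card C < Suc (card (verts G))" if "Q (v, C)" for v C
  proof -
    have "C \<subseteq> verts G" using that comps_subset[of C "verts G - {v}"] by (auto simp: Q_def)
    then show ?thesis using card_mono[OF finite_verts] less_Suc_eq_le by blast
  qed
  obtain v0 where v0: "v0 \<in> verts G" "\<not> simplicial (verts G) v0" using ex by blast
  then have "ncomp (verts G) < ncomp (verts G - {v0})"
    using cutpoint_not_simplicial[OF conn] cutpoint_iff by blast
  then obtain C0 where "C0 \<in> comps (verts G - {v0})" by (metis all_not_in_conv card.empty not_less_zero)
  then have "Q (v0, C0)" using v0 by (simp add: Q_def)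
  then obtain v C where vC: "Q (v, C)" "\<And>w D. Q (w, D) \<Longrightarrow> card D \<le> card C"
    using ex_has_greatest_nat[of Q "(v0, C0)" "\<lambda>p. card (snd p)" "Suc (card (verts G))"] bound by auto
  let ?V = "verts G - {v}"
  have v: "v \<in> verts G" "\<not> simplicial (verts G) v" and C: "C \<in> comps ?V" using vC by (auto simp: Q_def)
  have adjc: "adj_comps v ?V = comps ?V" by (rule adj_comps_connected[OF conn v(1)])
  have end_comp: "simplicial (verts G) w" if D: "D \<in> comps ?V" "D \<noteq> C" and w: "w \<in> D" for D w
  proof (rule ccontr)
    assume ns: "\<not> simplicial (verts G) w"
    have wV: "w \<in> ?V" using comps_subset[OF D(1)] w by blast
    have wC: "w \<notin> C" using comps_disjoint[OF D(1) C w] D(2) by blast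
    then have sub: "insert v C \<subseteq> verts G - {w}" using comps_subset[OF C] wV v by blast
    obtain C' where C': "C' \<in> comps (verts G - {w})" "v \<in> C'" using comp_of[of v "verts G - {w}"] sub by blast
    obtain c where c: "c \<in> C" "adj v c" using C adjc by (auto simp: adj_comps_def)
    have "u \<in> C'" if u: "u \<in> C" for u
    proof -
      have "connected_in (verts G - {w}) c u"
        by (rule connected_mono[OF _ comps_connected_inner[OF C c(1) u]]) (use sub in blast)
      moreover have "connected_in (verts G - {w}) v c" by (rule connected_adj[OF c(2)]) (use sub c in auto)
      ultimately have "connected_in (verts G - {w}) v u" by (rule connected_trans[rotated])
      then show ?thesis using comps_eq_class[OF C'] sub u by blast
    qed
    then have "insert v C \<subseteq> C'" using C' by blast
    moreover have "finite C'" using comps_subset[OF C'(1)] finite_verts finite_subset by blast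
    ultimately have "card (insert v C) \<le> card C'" by (metis card_mono)
    moreover have "v \<notin> C" "finite C" using comps_subset[OF C] finite_verts finite_subset by blast+
    ultimately have "card C < card C'" by simp
    moreover have "Q (w, C')" using ns wV C' by (simp add: Q_def)
    ultimately show False using vC(2) by fastforce
  qed
  have "3 \<le> ncomp ?V"
  proof -
    have "2 \<le> ncomp ?V"
      using cutpoint_not_simplicial[OF conn v(1)] v(2) conn by (simp add: cutpoint_iff connected_graph_comps)
    moreover have "ncomp ?V \<noteq> 2"
    proof
      assume "ncomp ?V = 2"
      then obtain C1 C2 where "comps ?V = {C1, C2}" "C1 \<noteq> C2" by (auto simp: card_2_iff)
      then show False using splits_at_two_comps[OF conn v(1)] ind by (auto simp: indecomposable_def)
    qed
    ultimately show ?thesis by simp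
  qed
  let ?h = "\<lambda>D. induced G (insert v {u \<in> D. adj v u})"
  have mc: "maximal_clique G (insert v {u \<in> D. adj v u})" if "D \<in> comps ?V" for D
    by (rule maximal_clique_in_comp) (use that adjc v in auto)
  have "inj_on ?h (comps ?V)"
  proof (rule inj_onI)
    fix D E assume DE: "D \<in> comps ?V" "E \<in> comps ?V" "?h D = ?h E"
    have "verts (?h D) = verts (?h E)" by (simp only: DE(3))
    then have eq: "insert v {u \<in> D. adj v u} = insert v {u \<in> E. adj v u}"
      unfolding verts_induced[OF maximal_clique_subset[OF mc[OF DE(1)]]]
        verts_induced[OF maximal_clique_subset[OF mc[OF DE(2)]]] .
    show "D = E" by (rule inj_onD[OF inj_on_comp_clique[of v] eq]) (simp_all only: adjc DE)
  qed
  then have card_h: "card (?h ` (comps ?V - {C})) = ncomp ?V - 1"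
    using C finite_comps[of ?V] finite_verts
    by (subst card_image[OF inj_on_subset]) auto
  have "?h ` (comps ?V - {C}) \<subseteq> endblocks_at G v"
  proof
    fix B assume "B \<in> ?h ` (comps ?V - {C})"
    then obtain D where D: "D \<in> comps ?V" "D \<noteq> C" "B = ?h D" by blast
    have u: "\<exists>!w. w \<in> insert v {u \<in> D. adj v u} \<and> \<not> simplicial (verts G) w"
      using v(2) end_comp[OF D(1,2)] by (intro ex1I[of _ v]) auto
    show "B \<in> endblocks_at G v" unfolding endblocks_at_iff[OF conn]
      by (intro exI[of _ "insert v {u \<in> D. adj v u}"] conjI mc[OF D(1)] D(3) u) simp
  qed
  note h = this
  have "ncomp ?V - 1 \<le> card (endblocks_at G v)"
    using card_mono[OF finite_endblocks_at[OF conn] h] unfolding card_h .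
  then show ?thesis using \<open>3 \<le> ncomp ?V\<close> v(1) by (intro bexI[of _ v]) auto
qed

end

section \<open>Decomposition into indecomposable subgraphs\<close>

definition graph_gain :: "'v ugraph \<Rightarrow> nat" where
  "graph_gain H = finite_graph.gain H (verts H)"

text \<open>The algorithm keeps sets of graphs, so sums over unions of such sets must not lose a graph that
  occurs twice. Edge-disjointness ensures this: a graph occurring twice has no edges, and then it
  contributes nothing.\<close>

definition edge_disjoint :: "'v ugraph set \<Rightarrow> bool" where
  "edge_disjoint \<S> \<longleftrightarrow> (\<forall>P\<in>\<S>. \<forall>Q\<in>\<S>. P \<noteq> Q \<longrightarrow> edges P \<inter> edges Q = {})"

context finite_graph
begin

lemma comps_of_induced:
  assumes "B \<subseteq> A"
  shows "finite_graph.comps (induced G A) B = comps B"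
proof -
  interpret H: finite_graph "induced G A" by unfold_locales (rule simple_induced)
  have "A \<inter> B = B" using assms by blast
  then show ?thesis unfolding H.comps_def comps_def by (simp add: induced_induced)
qed

lemma gain_of_induced:
  assumes "B \<subseteq> A"
  shows "finite_graph.gain (induced G A) B = gain B"
proof -
  interpret H: finite_graph "induced G A" by unfold_locales (rule simple_induced)
  have prime_dim: "H.prime_dim U = prime_dim U" if "U \<subseteq> B" for U
    using comps_of_induced[of U A] that assms by (simp add: H.prime_dim_def prime_dim_def)
  have "H.max_prime_dim B = max_prime_dim B"
    unfolding H.max_prime_dim_def max_prime_dim_def by (rule arg_cong[of _ _ Max], rule image_cong) (use prime_dim in auto)
  then show ?thesis using prime_dim[of B] by (simp add: H.gain_def gain_def)
qed

lemma graph_gain_induced: "A \<subseteq> verts G \<Longrightarrow> graph_gain (induced G A) = gain A"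
  by (simp add: graph_gain_def verts_induced gain_of_induced)

lemma simplicial_of_induced:
  assumes "B \<subseteq> A" "v \<in> A"
  shows "finite_graph.simplicial (induced G A) B v \<longleftrightarrow> simplicial B v"
proof -
  interpret H: finite_graph "induced G A" by unfold_locales (rule simple_induced)
  show ?thesis using assms unfolding H.simplicial_def simplicial_def edges_induced by blast
qed

lemma graph_gain_no_edges: "edges G = {} \<Longrightarrow> graph_gain G = 0"
  unfolding graph_gain_def by (rule gain_simplicial) (auto simp: finite_verts simplicial_def)

lemma graph_gain_complete: "complete_graph G \<Longrightarrow> graph_gain G = 0"
  unfolding graph_gain_def
  by (rule gain_simplicial) (auto simp: finite_verts simplicial_def complete_graph_def)

lemma finite_edges: "finite (edges G)"
  by (rule finite_subset[of _ "Pow (verts G)"]) (use simple finite_verts in \<open>auto simp: simple_graph_def\<close>)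

lemma splits_edges:
  assumes "splits_into G G1 G2"
  shows "edges G = edges G1 \<union> edges G2" "edges G1 \<inter> edges G2 = {}" "edges G1 \<noteq> {}" "edges G2 \<noteq> {}"
    "verts G = verts G1 \<union> verts G2" "\<exists>v. verts G1 \<inter> verts G2 = {v}"
proof -
  obtain v where s: "simple_graph G1" "simple_graph G2" "G = graph_union G1 G2" "verts G1 \<inter> verts G2 = {v}"
    "free_vertex G1 v" "\<not> isolated_vertex G1 v" "free_vertex G2 v" "\<not> isolated_vertex G2 v"
    using assms by (auto simp: splits_into_def)
  show "edges G = edges G1 \<union> edges G2" by (subst s(3)) (simp add: graph_union_def)
  show "verts G = verts G1 \<union> verts G2" by (subst s(3)) (simp add: graph_union_def)
  show "edges G1 \<noteq> {}" "edges G2 \<noteq> {}"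
    using s by (auto simp: free_vertex_def isolated_vertex_def)
  show "edges G1 \<inter> edges G2 = {}"
  proof (rule ccontr)
    assume "edges G1 \<inter> edges G2 \<noteq> {}"
    then obtain e where "e \<in> edges G1" "e \<in> edges G2" by blast
    then have "e \<subseteq> {v}" "card e = 2" using s(1,2,4) unfolding simple_graph_def by blast+
    then show False using card_mono[of "{v}" e] by simp
  qed
  show "\<exists>v. verts G1 \<inter> verts G2 = {v}" using s by blast
qed

lemma splits_induced:
  assumes "splits_into G G1 G2"
  shows "G1 = induced G (verts G1)" "G2 = induced G (verts G2)"
proof -
  obtain v where s: "simple_graph G1" "simple_graph G2" "verts G1 \<inter> verts G2 = {v}"
    using assms by (auto simp: splits_into_def)
  note e = splits_edges[OF assms]
  have eq: "H = induced G (verts H)"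
    if H: "simple_graph H" "simple_graph H'" "verts H \<inter> verts H' = {v}" "edges G = edges H \<union> edges H'"
      "verts H \<subseteq> verts G" for H H'
  proof -
    have "f \<in> edges H" if f: "f \<in> edges G" "f \<subseteq> verts H" for f
    proof (rule ccontr)
      assume "f \<notin> edges H"
      then have "f \<in> edges H'" using f H by blast
      then have "f \<subseteq> {v}" "card f = 2" using H f unfolding simple_graph_def by blast+
      then show False using card_mono[of "{v}" f] by simp
    qed
    then have "edges H = {f \<in> edges G. f \<subseteq> verts H}"
      using H(1,4) unfolding simple_graph_def by blast
    moreover have "verts H = verts G \<inter> verts H" using H(5) by blast
    ultimately show ?thesis by (simp add: induced_def)
  qed
  show "G1 = induced G (verts G1)" by (rule eq[OF s]) (use e in auto)
  show "G2 = induced G (verts G2)" by (rule eq[OF s(2,1)]) (use e s in auto)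
qed

end

lemma recursive_decomposition_exists:
  assumes "simple_graph H"
  shows "\<exists>I. recursive_decomposition H I"
  using assms
proof (induction "card (edges H)" arbitrary: H rule: less_induct)
  case less
  interpret finite_graph H by unfold_locales (rule less.prems)
  show ?case
  proof (cases "indecomposable H")
    case False
    then obtain G1 G2 where s: "splits_into H G1 G2" by (auto simp: indecomposable_def)
    note e = splits_edges[OF s]
    have "card (edges G1) < card (edges H)" "card (edges G2) < card (edges H)"
      using e finite_edges by (auto intro!: psubset_card_mono)
    moreover have "simple_graph G1" "simple_graph G2" using s by (auto simp: splits_into_def)
    ultimately show ?thesis using less.hyps s recursive_decomposition.split by metis
  qed (use recursive_decomposition.indecomposable in blast)
qed

text \<open>Both parts are connected because the numbers of their components add up to one more than that of
  \<open>G\<close>.\<close>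

lemma (in finite_block_graph) splits_connected_gain:
  assumes s: "splits_into G G1 G2" and conn: "connected_graph G"
  shows "connected_graph G1" "connected_graph G2" "graph_gain G = graph_gain G1 + graph_gain G2"
proof -
  note e = splits_edges[OF s] and ind = splits_induced[OF s]
  obtain v where v: "verts G1 \<inter> verts G2 = {v}" "free_vertex G1 v" "free_vertex G2 v"
    using s by (auto simp: splits_into_def)
  let ?A = "verts G1" and ?B = "verts G2"
  have sub: "?A \<subseteq> verts G" "?B \<subseteq> verts G" using e by auto
  have fin: "finite ?A" "finite ?B" using sub finite_verts finite_subset by auto
  have vAB: "v \<in> ?A" "v \<in> ?B" using v by auto
  have G12: "simple_graph G1" "simple_graph G2" using s by (simp_all add: splits_into_def)
  have no: "\<not> adj a b" if "a \<in> ?A - {v}" "b \<in> ?B - {v}" for a b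
  proof
    assume "adj a b"
    then have "{a, b} \<in> edges G1 \<or> {a, b} \<in> edges G2" using e by simp
    then have "{a, b} \<subseteq> ?A \<or> {a, b} \<subseteq> ?B"
      using G12 unfolding simple_graph_def by blast
    then show False using that v(1) by blast
  qed
  have simp: "simplicial (verts K) v" if "K = induced G (verts K)" "verts K \<subseteq> verts G" "free_vertex K v" for K
  proof -
    have K: "finite_block_graph K" by (subst that(1)) (rule finite_block_graph_induced)
    then have "v \<in> verts K" "finite_graph.simplicial K (verts K) v"
      using finite_block_graph.free_vertex_iff[OF K] that(3) by auto
    then show ?thesis
      using simplicial_of_induced[of "verts K" "verts K" v, folded that(1)] by blast
  qed
  have sA: "simplicial ?A v" and sB: "simplicial ?B v" using simp[OF ind(1) sub(1) v(2)] simp[OF ind(2) sub(2) v(3)] .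
  have gw: "gain (?A \<union> ?B) = gain ?A + gain ?B"
    by (rule gain_wedge[OF fin v(1) no sA sB])
  have gg: "graph_gain G1 = gain ?A" "graph_gain G2 = gain ?B"
    using graph_gain_induced[OF sub(1), folded ind(1)] graph_gain_induced[OF sub(2), folded ind(2)] .
  show "graph_gain G = graph_gain G1 + graph_gain G2"
    unfolding gg gw[symmetric] by (simp add: graph_gain_def e(5))
  have "ncomp (?A \<union> ?B) + 1 = ncomp ?A + ncomp ?B"
    by (rule prime_dim_wedge(2)[OF fin v(1) no])
  moreover have "ncomp (?A \<union> ?B) = 1" using conn by (simp add: connected_graph_comps e(5)[symmetric])
  moreover have "ncomp ?A \<noteq> 0" "ncomp ?B \<noteq> 0"
    using comp_of[OF vAB(1)] comp_of[OF vAB(2)] finite_comps fin by auto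
  ultimately have n: "ncomp ?A \<le> 1" "ncomp ?B \<le> 1" by auto
  have "comps K = {K}" if "finite K" "v \<in> K" "ncomp K \<le> 1" for K
    by (rule comps_connectedI) (use that connected_if_ncomp_le_1[of K] in auto)
  from this[OF fin(1) vAB(1) n(1)] this[OF fin(2) vAB(2) n(2)]
  show "connected_graph G1" "connected_graph G2"
    using comps_connected_set[OF sub(1), folded ind(1)] comps_connected_set[OF sub(2), folded ind(2)]
    by blast+
qed

lemma sum_Union_edge_disjoint:
  fixes w :: "'v ugraph \<Rightarrow> nat"
  assumes "finite \<C>" "\<And>C. C \<in> \<C> \<Longrightarrow> finite (D C)"
    and disj: "\<And>C C' P Q. C \<in> \<C> \<Longrightarrow> C' \<in> \<C> \<Longrightarrow> C \<noteq> C' \<Longrightarrow> P \<in> D C \<Longrightarrow> Q \<in> D C' \<Longrightarrow> edges P \<inter> edges Q = {}"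
    and zero: "\<And>C P. C \<in> \<C> \<Longrightarrow> P \<in> D C \<Longrightarrow> edges P = {} \<Longrightarrow> w P = 0"
  shows "sum w (\<Union> (D ` \<C>)) = (\<Sum>C\<in>\<C>. sum w (D C))"
proof -
  let ?N = "\<lambda>S. {P \<in> S. edges P \<noteq> {}}"
  have "sum w (\<Union> (D ` \<C>)) = sum w (\<Union>C\<in>\<C>. ?N (D C))"
    by (rule sum.mono_neutral_right) (use assms in auto)
  also have "\<dots> = (\<Sum>C\<in>\<C>. sum w (?N (D C)))"
  proof (rule sum.UNION_disjoint)
    show "\<forall>C\<in>\<C>. \<forall>C'\<in>\<C>. C \<noteq> C' \<longrightarrow> ?N (D C) \<inter> ?N (D C') = {}"
    proof (intro ballI impI equals0I)
      fix C C' P assume "C \<in> \<C>" "C' \<in> \<C>" "C \<noteq> C'" "P \<in> ?N (D C) \<inter> ?N (D C')"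
      then show False using disj[of C C' P P] by simp
    qed
  qed (use assms in auto)
  also have "\<dots> = (\<Sum>C\<in>\<C>. sum w (D C))"
    by (rule sum.cong[OF refl], rule sum.mono_neutral_left) (use assms in auto)
  finally show ?thesis .
qed

definition good_decomposition :: "'v ugraph \<Rightarrow> 'v ugraph set \<Rightarrow> bool" where
  "good_decomposition H I \<longleftrightarrow> finite I \<and>
    (\<forall>P\<in>I. finite_block_graph P \<and> connected_graph P \<and> indecomposable P \<and> edges P \<subseteq> edges H) \<and>
    edge_disjoint I \<and> sum graph_gain I = graph_gain H \<and> (\<Sum>P\<in>I. card (edges P)) = card (edges H)"

lemma graph_gain_edgeless: "finite_block_graph P \<Longrightarrow> edges P = {} \<Longrightarrow> graph_gain P = 0"
  using finite_graph.graph_gain_no_edges finite_block_graph.axioms(1) by blast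

lemma good_decomposition_Union:
  assumes fin: "finite \<C>" and D: "\<And>C. C \<in> \<C> \<Longrightarrow> good_decomposition C (D C)"
    and disj: "edge_disjoint \<C>" and sub: "\<And>C. C \<in> \<C> \<Longrightarrow> edges C \<subseteq> edges H"
    and gain: "(\<Sum>C\<in>\<C>. graph_gain C) = graph_gain H"
    and card: "(\<Sum>C\<in>\<C>. card (edges C)) = card (edges H)"
  shows "good_decomposition H (\<Union> (D ` \<C>))"
proof -
  have d: "edges P \<inter> edges Q = {}" if "C \<in> \<C>" "C' \<in> \<C>" "C \<noteq> C'" "P \<in> D C" "Q \<in> D C'" for C C' P Q
  proof -
    have "edges P \<subseteq> edges C" "edges Q \<subseteq> edges C'" "edges C \<inter> edges C' = {}"
      using D that disj by (auto simp: good_decomposition_def edge_disjoint_def)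
    then show ?thesis by blast
  qed
  have f: "finite (D C)" if "C \<in> \<C>" for C using D[OF that] by (simp add: good_decomposition_def)
  have z: "graph_gain P = 0" if "C \<in> \<C>" "P \<in> D C" "edges P = {}" for C P
    using graph_gain_edgeless D[OF that(1)] that by (auto simp: good_decomposition_def)
  have "sum graph_gain (\<Union> (D ` \<C>)) = (\<Sum>C\<in>\<C>. sum graph_gain (D C))"
    by (rule sum_Union_edge_disjoint[OF fin f d z])
  also have "\<dots> = graph_gain H"
    unfolding gain[symmetric] by (rule sum.cong) (use D in \<open>auto simp: good_decomposition_def\<close>)
  finally have 1: "sum graph_gain (\<Union> (D ` \<C>)) = graph_gain H" .
  have "(\<Sum>P\<in>\<Union> (D ` \<C>). card (edges P)) = (\<Sum>C\<in>\<C>. \<Sum>P\<in>D C. card (edges P))"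
    by (rule sum_Union_edge_disjoint[OF fin f d]) auto
  also have "\<dots> = card (edges H)"
    unfolding card[symmetric] by (rule sum.cong) (use D in \<open>auto simp: good_decomposition_def\<close>)
  finally have 2: "(\<Sum>P\<in>\<Union> (D ` \<C>). card (edges P)) = card (edges H)" .
  have 3: "edge_disjoint (\<Union> (D ` \<C>))"
    unfolding edge_disjoint_def
  proof (intro ballI impI)
    fix P Q assume "P \<in> \<Union> (D ` \<C>)" "Q \<in> \<Union> (D ` \<C>)" and ne: "P \<noteq> Q"
    then obtain C C' where C: "C \<in> \<C>" "P \<in> D C" "C' \<in> \<C>" "Q \<in> D C'" by blast
    show "edges P \<inter> edges Q = {}"
    proof (cases "C = C'")
      case True
      then show ?thesis using D[OF C(1)] C ne by (auto simp: good_decomposition_def edge_disjoint_def)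
    qed (use d C in blast)
  qed
  have 4: "\<forall>P\<in>\<Union> (D ` \<C>). finite_block_graph P \<and> connected_graph P \<and> indecomposable P \<and> edges P \<subseteq> edges H"
  proof
    fix P assume "P \<in> \<Union> (D ` \<C>)"
    then obtain C where C: "C \<in> \<C>" "P \<in> D C" by blast
    then show "finite_block_graph P \<and> connected_graph P \<and> indecomposable P \<and> edges P \<subseteq> edges H"
      using D[OF C(1)] sub[OF C(1)] unfolding good_decomposition_def by blast
  qed
  show ?thesis unfolding good_decomposition_def using 1 2 3 4 fin f by blast
qed

lemma recursive_decomposition_good:
  assumes "recursive_decomposition H I" "finite_block_graph H" "connected_graph H"
  shows "good_decomposition H I"
  using assms
proof (induction rule: recursive_decomposition.induct)
  case (indecomposable G)
  then show ?case by (auto simp: good_decomposition_def edge_disjoint_def)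
next
  case (split G G1 G2 I1 I2)
  interpret finite_block_graph G by (rule split.prems)
  note e = splits_edges[OF split.hyps(1)] and ind = splits_induced[OF split.hyps(1)]
    and c = splits_connected_gain[OF split.hyps(1) split.prems(2)]
  have b: "finite_block_graph G1" "finite_block_graph G2"
    using finite_block_graph_induced[of "verts G1", folded ind(1)]
      finite_block_graph_induced[of "verts G2", folded ind(2)] .
  have ne: "G1 \<noteq> G2" using e by auto
  have f: "finite (edges G1)" "finite (edges G2)" using finite_edges e by auto
  let ?D = "\<lambda>C. if C = G1 then I1 else I2"
  have "good_decomposition G (\<Union> (?D ` {G1, G2}))"
  proof (rule good_decomposition_Union)
    show "good_decomposition C (?D C)" if "C \<in> {G1, G2}" for C
      using that split.IH b c ne by auto
  qed (use e c ne f in \<open>auto simp: edge_disjoint_def card_Un_disjoint\<close>)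
  then show ?case using ne by (simp add: Un_commute)
qed

context finite_block_graph
begin

lemma components_good:
  assumes "indecomposable_decomposition G I"
  shows "good_decomposition G I"
proof -
  obtain D where D: "\<And>C. C \<in> components G \<Longrightarrow> recursive_decomposition C (D C)" and I: "I = \<Union> (D ` components G)"
    using assms by (auto simp: indecomposable_decomposition_def)
  have comp: "components G = induced G ` comps (verts G)"
    using components_induced[of "verts G"] by (simp add: induced_verts)
  have sub: "C \<subseteq> verts G" if "C \<in> comps (verts G)" for C using comps_subset[OF that] .
  have inj: "inj_on (induced G) (comps (verts G))"
    by (rule inj_on_subset[OF inj_on_induced]) (use sub in blast)
  have fin: "finite (comps (verts G))" by (rule finite_comps[OF finite_verts])
  have disjE: "edges (induced G C) \<inter> edges (induced G C') = {}"
    if "C \<in> comps (verts G)" "C' \<in> comps (verts G)" "C \<noteq> C'" for C C'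
  proof (rule ccontr)
    assume "\<not> ?thesis"
    then obtain f where f: "f \<in> edges G" "f \<subseteq> C" "f \<subseteq> C'" by (auto simp: induced_def)
    then obtain x y where "f = {x, y}" using edge_obtain by blast
    then show False using f comps_disjoint[OF that(1,2), of x] that(3) by blast
  qed
  show ?thesis
    unfolding I
  proof (rule good_decomposition_Union)
    show "finite (components G)" unfolding comp using fin by simp
    show "good_decomposition C (D C)" if C: "C \<in> components G" for C
    proof -
      obtain K where K: "K \<in> comps (verts G)" "C = induced G K" using C unfolding comp by (elim imageE)
      have "connected_graph (induced G K)"
        unfolding comps_connected_set[OF sub[OF K(1)]]
        by (rule comps_connectedI[OF comps_nonempty[OF K(1)] comps_connected_inner[OF K(1)]])
      then show ?thesis
        using recursive_decomposition_good[OF D[OF C]] finite_block_graph_induced[of K] by (simp only: K(2))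
    qed
    show "edge_disjoint (components G)"
      unfolding comp edge_disjoint_def using disjE by blast
    show "edges C \<subseteq> edges G" if "C \<in> components G" for C
      using that unfolding comp by (auto simp: induced_def)
    have "sum graph_gain (components G) = (\<Sum>C\<in>comps (verts G). gain C)"
      unfolding comp sum.reindex[OF inj] by (rule sum.cong) (simp_all add: graph_gain_induced sub)
    then show "sum graph_gain (components G) = graph_gain G"
      using gain_comps[OF finite_verts] by (simp add: graph_gain_def)
    have "(\<Sum>C\<in>components G. card (edges C)) = (\<Sum>C\<in>comps (verts G). card (edges (induced G C)))"
      unfolding comp sum.reindex[OF inj] by simp
    also have "\<dots> = card (\<Union>C\<in>comps (verts G). edges (induced G C))"
      by (rule card_UN_disjoint[symmetric]) (use fin disjE finite_edges in \<open>auto simp: induced_def\<close>)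
    also have "(\<Union>C\<in>comps (verts G). edges (induced G C)) = edges G"
    proof
      show "edges G \<subseteq> (\<Union>C\<in>comps (verts G). edges (induced G C))"
      proof
        fix f assume f: "f \<in> edges G"
        then obtain x y where xy: "f = {x, y}" "x \<noteq> y" using edge_obtain by blast
        then have a: "adj x y" using f by simp
        obtain C where C: "C \<in> comps (verts G)" "x \<in> C" using comp_of adj_verts[OF a] by blast
        then have "y \<in> C" using comps_closed[OF C] adj_verts[OF a] a by blast
        then have "f \<in> edges (induced G C)" using a C xy by (simp add: edges_induced)
        then show "f \<in> (\<Union>C\<in>comps (verts G). edges (induced G C))" using C by blast
      qed
    qed (auto simp: induced_def)
    finally show "(\<Sum>C\<in>components G. card (edges C)) = card (edges G)" .
  qed
qed

lemma decomposition_exists: "\<exists>I. indecomposable_decomposition G I"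
proof -
  have "\<forall>C\<in>components G. \<exists>I. recursive_decomposition C I"
    using recursive_decomposition_exists simple_induced by (auto simp: components_def)
  then obtain D where "\<forall>C\<in>components G. recursive_decomposition C (D C)" by metis
  then show ?thesis by (auto simp: indecomposable_decomposition_def)
qed

lemma remaining_graph_eq:
  assumes "v \<in> verts G"
  shows "remaining_graph G v = induced G (verts G - ({v} \<union> (\<Union>B\<in>endblocks_at G v. verts B)))"
  by (simp add: remaining_graph_def remove_verts_def)

lemma remaining_graph_step:
  assumes conn: "connected_graph G" and v: "v \<in> verts G" and two: "2 \<le> card (endblocks_at G v)"
  shows "finite_block_graph (remaining_graph G v)" "edges (remaining_graph G v) \<subset> edges G"
    "graph_gain G + 2 = graph_gain (remaining_graph G v) + cdeg G v" "2 \<le> cdeg G v"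
proof -
  note g = gain_remove_endblocks[OF conn two]
  show "finite_block_graph (remaining_graph G v)"
    unfolding remaining_graph_eq[OF v] by (rule finite_block_graph_induced)
  obtain a where a: "adj v a" using g(3) by blast
  have "{v, a} \<notin> edges (remaining_graph G v)" unfolding remaining_graph_eq[OF v] edges_induced by blast
  moreover have "edges (remaining_graph G v) \<subseteq> edges G"
    by (auto simp: remaining_graph_eq[OF v] induced_def)
  ultimately show "edges (remaining_graph G v) \<subset> edges G" using a by blast
  show "graph_gain G + 2 = graph_gain (remaining_graph G v) + cdeg G v"
    using g(1) by (simp add: remaining_graph_eq[OF v] graph_gain_induced) (simp add: graph_gain_def)
  show "2 \<le> cdeg G v" by (rule g(2))
qed

end

section \<open>The invariant of the algorithm\<close>

fun invariant :: "nat \<Rightarrow> 'v alg_state \<Rightarrow> bool" where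
  "invariant r (d, \<G>, \<I>) \<longleftrightarrow> finite \<G> \<and> finite \<I> \<and> (\<forall>H\<in>\<G>. finite_block_graph H) \<and>
    (\<forall>P\<in>\<I>. finite_block_graph P \<and> connected_graph P \<and> indecomposable P \<and> \<not> complete_graph P) \<and>
    edge_disjoint \<G> \<and> edge_disjoint \<I> \<and> (\<forall>H\<in>\<G>. \<forall>P\<in>\<I>. edges H \<inter> edges P = {}) \<and>
    d + sum graph_gain \<G> + sum graph_gain \<I> = r"

text \<open>A decomposition does not create edges and is paid for by the summand 1; deleting a vertex with its
  endblocks loses an edge, and the factor 2 leaves enough to pay for the new summand 1.\<close>

fun work :: "'v alg_state \<Rightarrow> nat" where
  "work (d, \<G>, \<I>) = (\<Sum>H\<in>\<G>. 2 * card (edges H) + 1) + (\<Sum>P\<in>\<I>. 2 * card (edges P))"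

lemma invariant_decompose:
  assumes inv: "invariant r (d, \<G>, {})" and H: "H \<in> \<G>" and I: "indecomposable_decomposition H I"
  shows "invariant r (d, \<G> - {H}, {P \<in> I. \<not> complete_graph P})"
    "work (d, \<G> - {H}, {P \<in> I. \<not> complete_graph P}) < work (d, \<G>, {})"
proof -
  have b: "finite_block_graph H" using inv H by simp
  then have good: "good_decomposition H I" using finite_block_graph.components_good I by blast
  let ?I = "{P \<in> I. \<not> complete_graph P}"
  have finI: "finite I" and P: "\<And>P. P \<in> I \<Longrightarrow> finite_block_graph P \<and> connected_graph P \<and> indecomposable P \<and> edges P \<subseteq> edges H"
    and ed: "edge_disjoint I" and gI: "sum graph_gain I = graph_gain H"
    and cI: "(\<Sum>P\<in>I. card (edges P)) = card (edges H)"
    using good by (auto simp: good_decomposition_def)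
  have finG: "finite \<G>" using inv by simp
  have "graph_gain P = 0" if "P \<in> I" "complete_graph P" for P
    using P[OF that(1)] that(2) finite_graph.graph_gain_complete finite_block_graph.axioms(1) by blast
  then have g: "sum graph_gain ?I = graph_gain H"
    unfolding gI[symmetric] by (intro sum.mono_neutral_left) (use finI in auto)
  have "sum graph_gain \<G> = graph_gain H + sum graph_gain (\<G> - {H})"
    by (rule sum.remove[OF finG H])
  moreover have "edges K \<inter> edges P = {}" if "K \<in> \<G> - {H}" "P \<in> ?I" for K P
  proof -
    have "edges K \<inter> edges H = {}" using inv that H by (auto simp: edge_disjoint_def)
    then show ?thesis using P[of P] that by blast
  qed
  moreover have "edge_disjoint ?I" "edge_disjoint (\<G> - {H})"
    using ed inv by (auto simp: edge_disjoint_def)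
  ultimately show "invariant r (d, \<G> - {H}, ?I)"
    using inv g P finI by auto
  have "(\<Sum>P\<in>?I. card (edges P)) \<le> card (edges H)"
    unfolding cI[symmetric] by (rule sum_mono2) (use finI in auto)
  then have "(\<Sum>P\<in>?I. 2 * card (edges P)) < 2 * card (edges H) + 1"
    by (simp add: sum_distrib_left[symmetric])
  moreover have "(\<Sum>K\<in>\<G>. 2 * card (edges K) + 1) = 2 * card (edges H) + 1 + (\<Sum>K\<in>\<G> - {H}. 2 * card (edges K) + 1)"
    by (rule sum.remove[OF finG H])
  ultimately show "work (d, \<G> - {H}, ?I) < work (d, \<G>, {})" by simp
qed

lemma invariant_process:
  assumes inv: "invariant r (d, \<G>, \<I>)" and P: "P \<in> \<I>" and v: "v \<in> verts P" "2 \<le> card (endblocks_at P v)"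
  defines "R \<equiv> remaining_graph P v"
  shows "invariant r (d + cdeg P v - 2, \<G> \<union> {R}, \<I> - {P})"
    "work (d + cdeg P v - 2, \<G> \<union> {R}, \<I> - {P}) < work (d, \<G>, \<I>)"
proof -
  have b: "finite_block_graph P" "connected_graph P" using inv P by auto
  note st = finite_block_graph.remaining_graph_step[OF b v, folded R_def]
  have fin: "finite \<G>" "finite \<I>" using inv by auto
  have disj: "edges H \<inter> edges R = {}" if "H \<in> \<G>" for H
  proof -
    have "edges H \<inter> edges P = {}" using inv P that by simp
    then show ?thesis using st(2) by blast
  qed
  have disj': "edges Q \<inter> edges R = {}" if "Q \<in> \<I> - {P}" for Q
  proof -
    have "edges Q \<inter> edges P = {}" using inv P that by (simp add: edge_disjoint_def)
    then show ?thesis using st(2) by blast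
  qed
  have "sum graph_gain (\<G> \<union> {R}) = sum graph_gain \<G> + graph_gain R"
  \<comment> \<open>If the new graph is already in store, it has no edges and hence no gain.\<close>
  proof (cases "R \<in> \<G>")
    case True
    then have "edges R = {}" using disj by blast
    then show ?thesis using graph_gain_edgeless[OF st(1)] True by (simp add: insert_absorb)
  qed (use fin in simp)
  moreover have "sum graph_gain \<I> = graph_gain P + sum graph_gain (\<I> - {P})"
    by (rule sum.remove[OF fin(2) P])
  moreover have "d + sum graph_gain \<G> + sum graph_gain \<I> = r" using inv by simp
  ultimately have eq: "d + cdeg P v - 2 + sum graph_gain (\<G> \<union> {R}) + sum graph_gain (\<I> - {P}) = r"
    using st(3,4) by simp
  have "edge_disjoint (\<G> \<union> {R})" "edge_disjoint (\<I> - {P})"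
    using inv disj by (auto simp: edge_disjoint_def Int_commute)
  then show "invariant r (d + cdeg P v - 2, \<G> \<union> {R}, \<I> - {P})"
    using inv eq st(1) disj' fin by (auto simp: Int_commute)
  have finE: "finite (edges P)" using finite_graph.finite_edges finite_block_graph.axioms(1) b(1) by blast
  have "card (edges R) < card (edges P)" by (rule psubset_card_mono[OF finE st(2)])
  moreover have "(\<Sum>H\<in>\<G> \<union> {R}. 2 * card (edges H) + 1) \<le> (\<Sum>H\<in>\<G>. 2 * card (edges H) + 1) + (2 * card (edges R) + 1)"
    using fin by (cases "R \<in> \<G>") (simp_all add: insert_absorb)
  moreover have "(\<Sum>Q\<in>\<I>. 2 * card (edges Q)) = 2 * card (edges P) + (\<Sum>Q\<in>\<I> - {P}. 2 * card (edges Q))"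
    by (rule sum.remove[OF fin(2) P])
  ultimately show "work (d + cdeg P v - 2, \<G> \<union> {R}, \<I> - {P}) < work (d, \<G>, \<I>)" by simp
qed

lemma alg_step_invariant:
  assumes "alg_step s s'" "invariant r s"
  shows "invariant r s' \<and> work s' < work s"
  using assms
proof (cases rule: alg_step.cases)
  case (decompose H \<G> I d)
  then show ?thesis using invariant_decompose[of r d \<G> H I] assms(2) by blast
next
  case (process P \<I> v d \<G>)
  then show ?thesis using invariant_process[of r d \<G> \<I> P v] assms(2) by blast
qed

lemma invariant_progress:
  assumes "invariant r s"
  shows "alg_final s \<or> (\<exists>s'. alg_step s s')"
proof -
  obtain d \<G> \<I> where s: "s = (d, \<G>, \<I>)" by (cases s) auto
  show ?thesis
  proof (cases "\<I> = {}")
    case False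
    then obtain P where P: "P \<in> \<I>" by blast
    then have "finite_block_graph P" "connected_graph P" "indecomposable P" "\<not> complete_graph P"
      using assms s by auto
    then obtain v where "v \<in> verts P" "2 \<le> card (endblocks_at P v)"
      using finite_block_graph.two_endblocks_exist by blast
    then show ?thesis using alg_step.process[OF P] s by blast
  next
    case True
    show ?thesis
    proof (cases "\<G> = {}")
      case True
      then show ?thesis using \<open>\<I> = {}\<close> s by (simp add: alg_final_def)
    next
      case False
      then obtain H where H: "H \<in> \<G>" by blast
      then have "finite_block_graph H" using assms s by simp
      then obtain I where "indecomposable_decomposition H I"
        using finite_block_graph.decomposition_exists by blast
      then show ?thesis using alg_step.decompose[OF H] s \<open>\<I> = {}\<close> by blast
    qed
  qed
qed

theorem algorithm_outputs_max_prime_dim: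
  assumes "finite_block_graph G" "connected_graph G"
  shows "algorithm_outputs G (enat (finite_graph.max_prime_dim G (verts G)))"
proof -
  interpret finite_block_graph G by fact
  let ?r = "max_prime_dim (verts G)"
  have "prime_dim (verts G) = card (verts G) + 1" using assms(2) by (simp add: prime_dim_def connected_graph_comps)
  then have "card (verts G) + 1 + graph_gain G = ?r"
    using max_prime_dim_eq_gain[OF finite_verts] by (simp add: graph_gain_def)
  then have init: "invariant ?r (alg_init G)"
    using assms(1) by (simp add: alg_init_def edge_disjoint_def)
  have reach: "invariant ?r s" if "alg_step\<^sup>*\<^sup>* (alg_init G) s" for s
    using that by (induction rule: rtranclp_induct) (use init alg_step_invariant in blast)+
  have "\<nexists>run :: nat \<Rightarrow> _. run 0 = alg_init G \<and> (\<forall>i. alg_step (run i) (run (Suc i)))"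
  proof
    assume "\<exists>run :: nat \<Rightarrow> _. run 0 = alg_init G \<and> (\<forall>i. alg_step (run i) (run (Suc i)))"
    then obtain run :: "nat \<Rightarrow> _" where run: "run 0 = alg_init G" "\<And>i. alg_step (run i) (run (Suc i))" by blast
    have "invariant ?r (run i) \<and> work (run i) + i \<le> work (run 0)" for i
    proof (induction i)
      case (Suc i)
      then show ?case using alg_step_invariant[OF run(2)[of i], of ?r] by auto
    qed (simp add: run init)
    from this[of "Suc (work (run 0))"] show False by simp
  qed
  moreover have "alg_final s \<or> (\<exists>s'. alg_step s s')" if "alg_step\<^sup>*\<^sup>* (alg_init G) s" for s
    using invariant_progress reach that by blast
  moreover have "d = ?r" if "alg_step\<^sup>*\<^sup>* (alg_init G) (d, {}, {})" for d
    using reach[OF that] by simp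
  ultimately show ?thesis unfolding algorithm_outputs_def by blast
qed

theorem theorem2p5:
  fixes G :: "'v::linorder ugraph"
  assumes "simple_graph G" and "connected_graph G" and "block_graph G"
  shows "algorithm_outputs G
    (krull_dim ((edge_poly_ring G :: ('v bvar, 'k::field) mpoly ring) Quot binomial_edge_ideal G))"
proof -
  have "finite_block_graph G"
    by (rule finite_graph.finite_block_graphI[OF finite_graph.intro]) (use assms in simp_all)
  then show ?thesis
    using algorithm_outputs_max_prime_dim assms(2)
    unfolding krull_dim_binomial_edge_ideal[OF assms(1)] by blast
qed

end
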